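(* Let $A=A(\mathbf q,a_1,\dots,a_n)$ be a quantum complete intersection over a field $k$, where $n\ge 2$, all $a_i\ge 2$ and $\mathbf q=(q_{ij})$. (a) If $A$ admits a bi-Frobenius algebra structure whose comultiplication $\Delta$ and counit $\varepsilon$ are of the form $\Delta=\Delta_g$, $\varepsilon=\varepsilon_0$ for some admissible family $g=(g_{\mathbf v,\mathbf a-\mathbf 1-\mathbf v})_{\mathbf v\in V}$, then $q_{ij}^2=1$ for all $1\le i,j\le n$. (b) Conversely, assume that $\sqrt{-1}\in k$ and $q_{ij}^2=1$ for all $1\le i,j\le n$. Then there exists an admissible family $g=(g_{\mathbf v,\mathbf a-\mathbf 1-\mathbf v})_{\mathbf v\in V}$ such that, with comultiplication $\Delta_g$ and counit $\varepsilon_0$, the quadruple $(A,\ (x_{\mathbf a-\mathbf 1})^*,\ x_{\mathbf a-\mathbf 1},\ S)$ is a bi-Frobenius algebra, where $S:A\to A$ is the $k$-linear map given by $S(1)=1$, $S(x_{\mathbf a-\mathbf 1})=x_{\mathbf a-\mathbf 1}$ and $S(x_{\mathbf v})=g_{\mathbf a-\mathbf 1-\mathbf v,\mathbf v}\,\mathbf q^{\langle \mathbf a-\mathbf 1-\mathbf v|\mathbf v\rangle}\,x_{\mathbf v}$ for $\mathbf v\in V$, $\mathbf 0\ne\mathbf v\ne\mathbf a-\mathbf 1$.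
   Context: Quantum complete intersections. Let $k$ be a field, $n\ge 2$, $a_1,\dots,a_n\ge 2$ integers, and $\mathbf q=(q_{ij})$ an $n\times n$ matrix over $k$ with $q_{ii}=-1$ and $q_{ij}q_{ji}=1$ for all $i,j$. Then $A(\mathbf q,a_1,\dots,a_n)=k\langle x_1,\dots,x_n\rangle/\langle x_i^{a_i},\ x_ix_j+q_{ij}x_jx_i,\ 1\le i,j\le n\rangle$. Put $\mathbf a=(a_1,\dots,a_n)$, $\mathbf 0=(0,\dots,0)$, $\mathbf 1=(1,\dots,1)$, and $V=\{\mathbf v\in\mathbb N_0^n\mid v_i\le a_i-1,\ 1\le i\le n\}$. For $\mathbf v\in\mathbb N_0^n$ write $x_{\mathbf v}=x_1^{v_1}\cdots x_n^{v_n}$; then $\{x_{\mathbf v}\mid\mathbf v\in V\}$ is a basis of $A$, and $\{x_{\mathbf v}^*\mid \mathbf v\in V\}$ is its dual basis of $A^*=\mathrm{Hom}_k(A,k)$. For $\mathbf u,\mathbf v\in\mathbb N_0^n$ put $\mathbf q^{\langle\mathbf u|\mathbf v\rangle}=\prod_{1\le i<j\le n}(-1/q_{ij})^{u_jv_i}$, so that $x_{\mathbf u}x_{\mathbf v}=\mathbf q^{\langle\mathbf u|\mathbf v\rangle}x_{\mathbf u+\mathbf v}$. Form of $\Delta$ and $\varepsilon$. An admissible family is a family of nonzero elements $g_{\mathbf v,\mathbf a-\mathbf 1-\mathbf v}\in k$, $\mathbf v\in V$, with $g_{\mathbf 0,\mathbf a-\mathbf 1}=1=g_{\mathbf a-\mathbf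 1,\mathbf 0}$. Given such a family $g$, define $k$-linear maps $\varepsilon_0:A\to k$ and $\Delta_g:A\to A\otimes A$ by $\varepsilon_0(x_{\mathbf v})=\delta_{\mathbf v,\mathbf 0}$; $\Delta_g(1)=1\otimes 1$; $\Delta_g(x_{\mathbf v})=1\otimes x_{\mathbf v}+x_{\mathbf v}\otimes 1$ for $\mathbf v\in V$, $\mathbf 0\ne\mathbf v\ne\mathbf a-\mathbf 1$; $\Delta_g(x_{\mathbf a-\mathbf 1})=\sum_{\mathbf v\in V}g_{\mathbf v,\mathbf a-\mathbf 1-\mathbf v}\,x_{\mathbf v}\otimes x_{\mathbf a-\mathbf 1-\mathbf v}$. These make $A$ a coalgebra. Bi-Frobenius algebras. Let $A$ be a finite-dimensional algebra that is also a coalgebra over $k$ (no compatibility assumed), $t\in A$, $\phi\in A^*$, and let $S:A\to A$ be the linear map $S(a)=\sum\phi(t_1a)t_2$, where $\Delta(t)=\sum t_1\otimes t_2$. The quadruple $(A,\phi,t,S)$ (or $A$) is a bi-Frobenius algebra if: (i) $\varepsilon$ is an algebra homomorphism and $1_A$ is group-like; (ii) $(A,\phi)$ is a Frobenius algebra, i.e. $A^*=A\rightharpoonup\phi$ where $(a\rightharpoonup\phi)(x)=\phi(xa)$, and $(A,t)$ is a Frobenius coalgebra, i.e. $A=t\leftharpoonup A^*$ where $t\leftharpoonup f=\sum f(t_1)t_2$; (iii) $S$ is an algebra anti-homomorphism and a coalgebra anti-homomorphism (i.e. $\varepsilon\circ S=\varepsilon$ and $\Delta(S(a))=\sum S(a_2)\otimes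 S(a_1)$ for all $a\in A$). $S$ is called the antipode. An algebra "admits a bi-Frobenius algebra structure" if there are $\Delta,\varepsilon,\phi,t$ making it a bi-Frobenius algebra. *)

theory Defs
  imports "HOL-Algebra.Module" "HOL-Algebra.QuotRing" "HOL-Library.Poly_Mapping" "HOL-Library.FuncSet"
begin

section \<open>Vector spaces and algebras over a field type\<close>

text \<open>The base field is a type \<open>'k :: field\<close>. Vector spaces and algebras over it are records of
  the HOL-Algebra type \<open>('k, 'a) module\<close>. For a mere vector space the ring operations \<open>mult\<close>
  and \<open>one\<close> of the record carry no meaning.\<close>

definition ground :: "('k::field, 'k) module"
  where "ground = \<lparr>carrier = UNIV, monoid.mult = (*), one = 1, ring.zero = 0, add = (+), smult = (*)\<rparr>"

definition k_algebra :: "('k::field, 'a) module \<Rightarrow> bool"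
  where "k_algebra A \<longleftrightarrow> ring A \<and> module (ground :: ('k, 'k) module) A \<and>
    (\<forall>c. \<forall>x\<in>carrier A. \<forall>y\<in>carrier A.
       (c \<odot>\<^bsub>A\<^esub> x) \<otimes>\<^bsub>A\<^esub> y = c \<odot>\<^bsub>A\<^esub> (x \<otimes>\<^bsub>A\<^esub> y) \<and>
       x \<otimes>\<^bsub>A\<^esub> (c \<odot>\<^bsub>A\<^esub> y) = c \<odot>\<^bsub>A\<^esub> (x \<otimes>\<^bsub>A\<^esub> y))"

definition finite_dimensional :: "('k::field, 'a) module \<Rightarrow> bool"
  where "finite_dimensional M \<longleftrightarrow> (\<exists>B. finite B \<and> B \<subseteq> carrier M \<and>
    (\<forall>x\<in>carrier M. \<exists>c. x = (\<Oplus>\<^bsub>M\<^esub>b\<in>B. c b \<odot>\<^bsub>M\<^esub> b)))"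

definition k_linear :: "('k::field, 'a) module \<Rightarrow> ('k, 'b) module \<Rightarrow> ('a \<Rightarrow> 'b) \<Rightarrow> bool"
  where "k_linear M N f \<longleftrightarrow> f \<in> carrier M \<rightarrow> carrier N \<and>
    (\<forall>x\<in>carrier M. \<forall>y\<in>carrier M. f (x \<oplus>\<^bsub>M\<^esub> y) = f x \<oplus>\<^bsub>N\<^esub> f y) \<and>
    (\<forall>c. \<forall>x\<in>carrier M. f (c \<odot>\<^bsub>M\<^esub> x) = c \<odot>\<^bsub>N\<^esub> f x)"

definition quotient_module :: "('k::field, 'a) module \<Rightarrow> 'a set \<Rightarrow> ('k, 'a set) module"
  where "quotient_module M I =
    ring.extend (M Quot I) (module.fields (\<lambda>c X. \<Union>x\<in>X. I +>\<^bsub>M\<^esub> (c \<odot>\<^bsub>M\<^esub> x)))"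

definition generated_submodule :: "('k::field, 'a) module \<Rightarrow> 'a set \<Rightarrow> 'a set"
  where "generated_submodule M G = \<Inter>{N. submodule N (ground :: ('k, 'k) module) M \<and> G \<subseteq> N}"


section \<open>Tensor products\<close>

definition free_space :: "'x set \<Rightarrow> ('k::field, 'x \<Rightarrow>\<^sub>0 'k) module"
  where "free_space X = \<lparr>carrier = {p. Poly_Mapping.keys p \<subseteq> X},
    monoid.mult = undefined, one = undefined,
    ring.zero = 0, add = (+), smult = (\<lambda>c. Poly_Mapping.map ((*) c))\<rparr>"

definition bilinear_relations ::
    "('k::field, 'a) module \<Rightarrow> ('k, 'b) module \<Rightarrow> ('a \<times> 'b \<Rightarrow>\<^sub>0 'k) set"
  where "bilinear_relations M N =
    {Poly_Mapping.single (x \<oplus>\<^bsub>M\<^esub> x', y) 1 - Poly_Mapping.single (x, y) 1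
       - Poly_Mapping.single (x', y) 1 |x x' y. x \<in> carrier M \<and> x' \<in> carrier M \<and> y \<in> carrier N} \<union>
    {Poly_Mapping.single (x, y \<oplus>\<^bsub>N\<^esub> y') 1 - Poly_Mapping.single (x, y) 1
       - Poly_Mapping.single (x, y') 1 |x y y'. x \<in> carrier M \<and> y \<in> carrier N \<and> y' \<in> carrier N} \<union>
    {Poly_Mapping.single (c \<odot>\<^bsub>M\<^esub> x, y) 1 - Poly_Mapping.single (x, y) c |c x y.
       x \<in> carrier M \<and> y \<in> carrier N} \<union>
    {Poly_Mapping.single (x, c \<odot>\<^bsub>N\<^esub> y) 1 - Poly_Mapping.single (x, y) c |c x y.
       x \<in> carrier M \<and> y \<in> carrier N}"

definition tensor_null ::
    "('k::field, 'a) module \<Rightarrow> ('k, 'b) module \<Rightarrow> ('a \<times> 'b \<Rightarrow>\<^sub>0 'k) set"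
  where "tensor_null M N =
    generated_submodule (free_space (carrier M \<times> carrier N)) (bilinear_relations M N)"

definition tensor_product :: "('k::field, 'a) module \<Rightarrow> ('k, 'b) module \<Rightarrow>
    ('k, ('a \<times> 'b \<Rightarrow>\<^sub>0 'k) set) module"
  where "tensor_product M N =
    quotient_module (free_space (carrier M \<times> carrier N)) (tensor_null M N)"

definition pure_tensor :: "('k::field, 'a) module \<Rightarrow> ('k, 'b) module \<Rightarrow>
    'a \<Rightarrow> 'b \<Rightarrow> ('a \<times> 'b \<Rightarrow>\<^sub>0 'k) set"
  where "pure_tensor M N x y =
    tensor_null M N +>\<^bsub>free_space (carrier M \<times> carrier N)\<^esub> Poly_Mapping.single (x, y) 1"

text \<open>\<open>sweedler P T \<beta>\<close> is the sum of \<open>\<beta> t\<^sub>1 t\<^sub>2\<close> in \<open>P\<close>, where \<open>T\<close> is the sum of the tensors of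
  \<open>t\<^sub>1\<close> and \<open>t\<^sub>2\<close>. It is independent of the chosen representative whenever \<open>\<beta>\<close> is bilinear, and is
  only used for such \<open>\<beta>\<close>.\<close>

definition sweedler :: "('k::field, 'c) module \<Rightarrow> ('a \<times> 'b \<Rightarrow>\<^sub>0 'k) set \<Rightarrow> ('a \<Rightarrow> 'b \<Rightarrow> 'c) \<Rightarrow> 'c"
  where "sweedler P T \<beta> = (let p = (SOME p. p \<in> T) in
    \<Oplus>\<^bsub>P\<^esub>z\<in>Poly_Mapping.keys p. Poly_Mapping.lookup p z \<odot>\<^bsub>P\<^esub> \<beta> (fst z) (snd z))"


section \<open>Coalgebras and bi-Frobenius algebras\<close>

text \<open>Coassociativity is stated in \<open>A \<otimes> (A \<otimes> A)\<close>; the inner sum on its right-hand side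
  contains the associativity isomorphism.\<close>

definition k_coalgebra ::
    "('k::field, 'a) module \<Rightarrow> ('a \<Rightarrow> ('a \<times> 'a \<Rightarrow>\<^sub>0 'k) set) \<Rightarrow> ('a \<Rightarrow> 'k) \<Rightarrow> bool"
  where "k_coalgebra A \<Delta> \<epsilon> \<longleftrightarrow>
    module (ground :: ('k, 'k) module) A \<and>
    k_linear A (tensor_product A A) \<Delta> \<and>
    k_linear A ground \<epsilon> \<and>
    (\<forall>a\<in>carrier A. sweedler A (\<Delta> a) (\<lambda>x y. \<epsilon> x \<odot>\<^bsub>A\<^esub> y) = a) \<and>
    (\<forall>a\<in>carrier A. sweedler A (\<Delta> a) (\<lambda>x y. \<epsilon> y \<odot>\<^bsub>A\<^esub> x) = a) \<and>
    (\<forall>a\<in>carrier A.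
       sweedler (tensor_product A (tensor_product A A)) (\<Delta> a)
         (\<lambda>x y. pure_tensor A (tensor_product A A) x (\<Delta> y)) =
       sweedler (tensor_product A (tensor_product A A)) (\<Delta> a)
         (\<lambda>x y. sweedler (tensor_product A (tensor_product A A)) (\<Delta> x)
           (\<lambda>u v. pure_tensor A (tensor_product A A) u (pure_tensor A A v y))))"

text \<open>The inclusion of all \<open>a \<rightharpoonup> \<phi>\<close> in the dual space is automatic for linear \<open>\<phi>\<close>.\<close>

definition frobenius_algebra :: "('k::field, 'a) module \<Rightarrow> ('a \<Rightarrow> 'k) \<Rightarrow> bool"
  where "frobenius_algebra A \<phi> \<longleftrightarrow> k_linear A ground \<phi> \<and>
    (\<forall>f. k_linear A ground f \<longrightarrow> (\<exists>a\<in>carrier A. \<forall>x\<in>carrier A. f x = \<phi> (x \<otimes>\<^bsub>A\<^esub> a)))"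

definition frobenius_coalgebra ::
    "('k::field, 'a) module \<Rightarrow> ('a \<Rightarrow> ('a \<times> 'a \<Rightarrow>\<^sub>0 'k) set) \<Rightarrow> 'a \<Rightarrow> bool"
  where "frobenius_coalgebra A \<Delta> t \<longleftrightarrow> t \<in> carrier A \<and>
    carrier A = {sweedler A (\<Delta> t) (\<lambda>x y. f x \<odot>\<^bsub>A\<^esub> y) |f. k_linear A ground f}"

definition bi_frobenius :: "('k::field, 'a) module \<Rightarrow> ('a \<Rightarrow> ('a \<times> 'a \<Rightarrow>\<^sub>0 'k) set) \<Rightarrow> ('a \<Rightarrow> 'k) \<Rightarrow>
    ('a \<Rightarrow> 'k) \<Rightarrow> 'a \<Rightarrow> ('a \<Rightarrow> 'a) \<Rightarrow> bool"
  where "bi_frobenius A \<Delta> \<epsilon> \<phi> t S \<longleftrightarrow>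
    k_algebra A \<and> finite_dimensional A \<and> k_coalgebra A \<Delta> \<epsilon> \<and>
    \<comment> \<open>the counit is an algebra homomorphism and the unit is group-like\<close>
    \<epsilon> \<in> ring_hom A ground \<and> \<Delta> \<one>\<^bsub>A\<^esub> = pure_tensor A A \<one>\<^bsub>A\<^esub> \<one>\<^bsub>A\<^esub> \<and>
    frobenius_algebra A \<phi> \<and> frobenius_coalgebra A \<Delta> t \<and>
    (\<forall>a\<in>carrier A. S a = sweedler A (\<Delta> t) (\<lambda>x y. \<phi> (x \<otimes>\<^bsub>A\<^esub> a) \<odot>\<^bsub>A\<^esub> y)) \<and>
    \<comment> \<open>the antipode is an anti-homomorphism of algebras and of coalgebras\<close>
    k_linear A A S \<and> S \<one>\<^bsub>A\<^esub> = \<one>\<^bsub>A\<^esub> \<and>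
    (\<forall>x\<in>carrier A. \<forall>y\<in>carrier A. S (x \<otimes>\<^bsub>A\<^esub> y) = S y \<otimes>\<^bsub>A\<^esub> S x) \<and>
    (\<forall>a\<in>carrier A. \<epsilon> (S a) = \<epsilon> a) \<and>
    (\<forall>a\<in>carrier A. \<Delta> (S a) =
       sweedler (tensor_product A A) (\<Delta> a) (\<lambda>x y. pure_tensor A A (S y) (S x)))"


section \<open>Quantum complete intersections\<close>

text \<open>The free algebra on \<open>x\<^sub>1, \<dots>, x\<^sub>n\<close> is the monoid algebra of the free monoid on \<open>{1..n}\<close>;
  its multiplication is the convolution product of \<^theory>\<open>HOL-Library.Poly_Mapping\<close>.\<close>

datatype 'x free_monoid = Word (letters: "'x list")

instantiation free_monoid :: (type) monoid_add
begin

definition zero_free_monoid :: "'a free_monoid"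
  where "0 = Word []"

definition plus_free_monoid :: "'a free_monoid \<Rightarrow> 'a free_monoid \<Rightarrow> 'a free_monoid"
  where "v + w = Word (letters v @ letters w)"

instance
  by standard (simp_all add: zero_free_monoid_def plus_free_monoid_def)

end

type_synonym 'k words = "nat free_monoid \<Rightarrow>\<^sub>0 'k"

definition free_algebra :: "nat \<Rightarrow> ('k::field, 'k words) module"
  where "free_algebra n = \<lparr>carrier = {p. \<forall>w\<in>Poly_Mapping.keys p. set (letters w) \<subseteq> {1..n}},
    monoid.mult = (*), one = 1, ring.zero = 0, add = (+), smult = (\<lambda>c. Poly_Mapping.map ((*) c))\<rparr>"

definition free_var :: "nat \<Rightarrow> ('k::field) words"
  where "free_var i = Poly_Mapping.single (Word [i]) 1"

definition qci_ideal :: "nat \<Rightarrow> (nat \<Rightarrow> nat \<Rightarrow> 'k::field) \<Rightarrow> (nat \<Rightarrow> nat) \<Rightarrow> 'k words set"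
  where "qci_ideal n q a = genideal (free_algebra n)
    ({free_var i ^ a i |i. i \<in> {1..n}} \<union>
     {free_var i * free_var j + Poly_Mapping.map ((*) (q i j)) (free_var j * free_var i) |i j.
        i \<in> {1..n} \<and> j \<in> {1..n}})"

definition qci :: "nat \<Rightarrow> (nat \<Rightarrow> nat \<Rightarrow> 'k::field) \<Rightarrow> (nat \<Rightarrow> nat) \<Rightarrow> ('k, 'k words set) module"
  where "qci n q a = quotient_module (free_algebra n) (qci_ideal n q a)"

definition qci_var :: "nat \<Rightarrow> (nat \<Rightarrow> nat \<Rightarrow> 'k::field) \<Rightarrow> (nat \<Rightarrow> nat) \<Rightarrow> nat \<Rightarrow> 'k words set"
  where "qci_var n q a i = qci_ideal n q a +>\<^bsub>free_algebra n\<^esub> free_var i"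

text \<open>Multi-indices \<open>v\<close> are extensional functions on \<open>{1..n}\<close>; \<open>qci_monom n q a v\<close> is the ordered
  product \<open>x\<^sub>1\<^bsup>v 1\<^esup> \<cdots> x\<^sub>n\<^bsup>v n\<^esup>\<close>.\<close>

definition qci_monom ::
    "nat \<Rightarrow> (nat \<Rightarrow> nat \<Rightarrow> 'k::field) \<Rightarrow> (nat \<Rightarrow> nat) \<Rightarrow> (nat \<Rightarrow> nat) \<Rightarrow> 'k words set"
  where "qci_monom n q a v =
    foldr (\<lambda>i y. (qci_var n q a i [^]\<^bsub>qci n q a\<^esub> v i) \<otimes>\<^bsub>qci n q a\<^esub> y) [1..<Suc n] \<one>\<^bsub>qci n q a\<^esub>"

definition exponents :: "nat \<Rightarrow> (nat \<Rightarrow> nat) \<Rightarrow> (nat \<Rightarrow> nat) set"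
  where "exponents n a = (\<Pi>\<^sub>E i\<in>{1..n}. {0..a i - 1})"

definition zero_exponent :: "nat \<Rightarrow> nat \<Rightarrow> nat"
  where "zero_exponent n = (\<lambda>i\<in>{1..n}. 0)"

definition top_exponent :: "nat \<Rightarrow> (nat \<Rightarrow> nat) \<Rightarrow> nat \<Rightarrow> nat"
  where "top_exponent n a = (\<lambda>i\<in>{1..n}. a i - 1)"

definition co_exponent :: "nat \<Rightarrow> (nat \<Rightarrow> nat) \<Rightarrow> (nat \<Rightarrow> nat) \<Rightarrow> nat \<Rightarrow> nat"
  where "co_exponent n a v = (\<lambda>i\<in>{1..n}. a i - 1 - v i)"

definition q_bracket :: "nat \<Rightarrow> (nat \<Rightarrow> nat \<Rightarrow> 'k::field) \<Rightarrow> (nat \<Rightarrow> nat) \<Rightarrow> (nat \<Rightarrow> nat) \<Rightarrow> 'k"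
  where "q_bracket n q u v =
    (\<Prod>(i, j)\<in>{(i, j). 1 \<le> i \<and> i < j \<and> j \<le> n}. (- 1 / q i j) ^ (u j * v i))"

text \<open>\<open>dual_monom n q a v\<close> is the element of the dual basis belonging to \<open>v\<close>, that is, the
  coordinate function of the basis of monomials.\<close>

definition dual_monom :: "nat \<Rightarrow> (nat \<Rightarrow> nat \<Rightarrow> 'k::field) \<Rightarrow> (nat \<Rightarrow> nat) \<Rightarrow> (nat \<Rightarrow> nat) \<Rightarrow>
    'k words set \<Rightarrow> 'k"
  where "dual_monom n q a v x =
    (THE c. c \<in> extensional (exponents n a) \<and>
       x = (\<Oplus>\<^bsub>qci n q a\<^esub>u\<in>exponents n a. c u \<odot>\<^bsub>qci n q a\<^esub> qci_monom n q a u)) v"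

text \<open>The linear map to \<open>M\<close> sending each basis monomial with exponent \<open>v\<close> to \<open>f v\<close>:\<close>

definition linear_extension :: "nat \<Rightarrow> (nat \<Rightarrow> nat \<Rightarrow> 'k::field) \<Rightarrow> (nat \<Rightarrow> nat) \<Rightarrow>
    ('k, 'b) module \<Rightarrow> ((nat \<Rightarrow> nat) \<Rightarrow> 'b) \<Rightarrow> 'k words set \<Rightarrow> 'b"
  where "linear_extension n q a M f x =
    (\<Oplus>\<^bsub>M\<^esub>v\<in>exponents n a. dual_monom n q a v x \<odot>\<^bsub>M\<^esub> f v)"

text \<open>A family \<open>g\<close> is represented by a function of both indices, of which only the values at
  \<open>(v, a - 1 - v)\<close> matter.\<close>

definition admissible ::
    "nat \<Rightarrow> (nat \<Rightarrow> nat) \<Rightarrow> ((nat \<Rightarrow> nat) \<Rightarrow> (nat \<Rightarrow> nat) \<Rightarrow> 'k::field) \<Rightarrow> bool"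
  where "admissible n a g \<longleftrightarrow>
    (\<forall>v\<in>exponents n a. g v (co_exponent n a v) \<noteq> 0) \<and>
    g (zero_exponent n) (top_exponent n a) = 1 \<and>
    g (top_exponent n a) (zero_exponent n) = 1"

definition eps0 :: "nat \<Rightarrow> (nat \<Rightarrow> nat \<Rightarrow> 'k::field) \<Rightarrow> (nat \<Rightarrow> nat) \<Rightarrow> 'k words set \<Rightarrow> 'k"
  where "eps0 n q a =
    linear_extension n q a ground (\<lambda>v. if v = zero_exponent n then 1 else 0)"

definition Delta_g :: "nat \<Rightarrow> (nat \<Rightarrow> nat \<Rightarrow> 'k::field) \<Rightarrow> (nat \<Rightarrow> nat) \<Rightarrow>
    ((nat \<Rightarrow> nat) \<Rightarrow> (nat \<Rightarrow> nat) \<Rightarrow> 'k) \<Rightarrow>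
    'k words set \<Rightarrow> ('k words set \<times> 'k words set \<Rightarrow>\<^sub>0 'k) set"
  where "Delta_g n q a g =
    (let A = qci n q a; AA = tensor_product A A; x = qci_monom n q a in
     linear_extension n q a AA (\<lambda>v.
       if v = zero_exponent n then pure_tensor A A \<one>\<^bsub>A\<^esub> \<one>\<^bsub>A\<^esub>
       else if v = top_exponent n a then
         (\<Oplus>\<^bsub>AA\<^esub>u\<in>exponents n a.
            g u (co_exponent n a u) \<odot>\<^bsub>AA\<^esub> pure_tensor A A (x u) (x (co_exponent n a u)))
       else pure_tensor A A \<one>\<^bsub>A\<^esub> (x v) \<oplus>\<^bsub>AA\<^esub> pure_tensor A A (x v) \<one>\<^bsub>A\<^esub>))"

definition antipode_g :: "nat \<Rightarrow> (nat \<Rightarrow> nat \<Rightarrow> 'k::field) \<Rightarrow> (nat \<Rightarrow> nat) \<Rightarrow>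
    ((nat \<Rightarrow> nat) \<Rightarrow> (nat \<Rightarrow> nat) \<Rightarrow> 'k) \<Rightarrow> 'k words set \<Rightarrow> 'k words set"
  where "antipode_g n q a g =
    (let A = qci n q a; x = qci_monom n q a in
     linear_extension n q a A (\<lambda>v.
       if v = zero_exponent n then \<one>\<^bsub>A\<^esub>
       else if v = top_exponent n a then x (top_exponent n a)
       else (g (co_exponent n a v) v * q_bracket n q (co_exponent n a v) v) \<odot>\<^bsub>A\<^esub> x v))"

end

theory Submission
  imports Defs
begin

text \<open>Ordering the letters of a word costs a product of factors \<open>- q\<^sub>i\<^sub>j\<close>. The coefficients of the
  resulting normal form vanish on the defining ideal, so the ordered monomials are linearly independent
  in the quotient.

  Necessity: the antipode preserves primitive elements, and \<open>S x = \<Sum>\<phi>(t\<^sub>1 x) t\<^sub>2\<close> has top coefficient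
  proportional to \<open>\<phi> x\<close>; hence \<open>\<phi>\<close> is a multiple of the dual top monomial, and \<open>S\<close> scales every monomial
  between \<open>1\<close> and the top one by a nonzero factor. Applying the anti-homomorphism \<open>S\<close> to \<open>x\<^sub>i x\<^sub>j\<close> and to
  \<open>x\<^sub>j x\<^sub>i\<close> gives \<open>q\<^sub>i\<^sub>j\<^sup>2 = 1\<close>.

  Sufficiency: \<open>S\<close> has to scale \<open>x\<^sub>v\<close> by factors \<open>s\<^sub>v\<close> with \<open>s\<^sub>u\<^sub>+\<^sub>v\<close> equal to \<open>s\<^sub>u s\<^sub>v\<close> times the commutation
  sign of \<open>x\<^sub>u\<close> and \<open>x\<^sub>v\<close>, and with \<open>s\<^sub>v\<close> unchanged under \<open>v \<mapsto> a - 1 - v\<close>. With \<open>\<langle>u|v\<rangle>\<close> the bracket, these are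
  \<open>s\<^sub>v = \<langle>v|v\<rangle> \<Prod>\<sigma>\<^sub>i\<^bsup>v i\<^esup>\<close>, where \<open>\<sigma>\<^sub>i\<^sup>2\<close> is the commutation sign of \<open>x\<^sub>i\<close> with the top monomial;
  this is where a square root of \<open>- 1\<close> is used. The value at the top exponent is a sign, and
  changing the sign of one \<open>\<sigma>\<^sub>i\<close> with \<open>a\<^sub>i - 1\<close> odd normalises it to \<open>1\<close>.\<close>

section \<open>Linear maps\<close>

text \<open>The formula for \<open>s\<close> comes from solving its two conditions. If all squares
  of the q_ij are 1, brackets are signs and \<open>B u v * B v u\<close> is a symmetric bicharacter
  of the exponents. The function \<open>B v v\<close> is quadratic with this bicharacter as
  polarisation, so it meets the first condition, and any two nonvanishing solutions on all exponents
  differ by a character, that is, by a product of powers of the \<sigma> i. The coefficients of S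
  and \<Delta> determine each other through \<open>s v = g (co v) v * B (co v) v\<close>. Comparing
  coefficients of \<Delta>(S x) for the top monomial x then forces the square of \<open>s v\<close>
  to be \<open>B v (co v) * B (co v) v\<close>; unit exponents v yield the prescribed square of
  \<sigma> i. In the necessity part, monomials strictly between 1 and the top one, which exist
  because n is at least 2, are what distinguishes the top monomial from primitive elements. The
  formal obstacle is that \<open>sweedler\<close> evaluates a chosen representative. Each Sweedler
  sum is therefore recognised as a linear map on the tensor product, and identities of linear maps
  are checked on monomials.\<close>

lemma ground_simps [simp]:
  "carrier ground = UNIV" "x \<otimes>\<^bsub>ground\<^esub> y = x * y" "\<one>\<^bsub>ground\<^esub> = 1" "\<zero>\<^bsub>ground\<^esub> = 0"
  "x \<oplus>\<^bsub>ground\<^esub> y = x + y" "c \<odot>\<^bsub>ground\<^esub> x = c * x"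
  by (simp_all add: ground_def)

lemma cring_ground: "cring (ground :: ('k::field, 'k) module)"
proof (rule cringI)
  have "\<exists>y\<in>carrier ground. y \<oplus>\<^bsub>ground\<^esub> x = \<zero>\<^bsub>ground\<^esub>" for x :: 'k
    by (rule bexI[of _ "-x"]) simp_all
  then show "abelian_group (ground :: ('k, 'k) module)"
    by (intro abelian_groupI) (simp_all add: ac_simps)
  show "comm_monoid (ground :: ('k, 'k) module)"
    by (intro comm_monoidI) (simp_all add: ac_simps)
qed (simp add: algebra_simps)

locale vspace = module "ground :: ('k::field, 'k) module" M for M :: "('k::field, 'a) module" (structure)

lemma vspaceI:
  fixes M :: "('k::field, 'a) module" (structure)
  assumes "\<And>x y. x \<in> carrier M \<Longrightarrow> y \<in> carrier M \<Longrightarrow> x \<oplus> y \<in> carrier M"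
    and "\<zero> \<in> carrier M"
    and "\<And>x y z. x \<in> carrier M \<Longrightarrow> y \<in> carrier M \<Longrightarrow> z \<in> carrier M \<Longrightarrow> (x \<oplus> y) \<oplus> z = x \<oplus> (y \<oplus> z)"
    and "\<And>x y. x \<in> carrier M \<Longrightarrow> y \<in> carrier M \<Longrightarrow> x \<oplus> y = y \<oplus> x"
    and "\<And>x. x \<in> carrier M \<Longrightarrow> \<zero> \<oplus> x = x"
    and "\<And>x. x \<in> carrier M \<Longrightarrow> \<exists>y\<in>carrier M. y \<oplus> x = \<zero>"
    and "\<And>c x. x \<in> carrier M \<Longrightarrow> c \<odot> x \<in> carrier M"
    and "\<And>c d x. x \<in> carrier M \<Longrightarrow> (c + d) \<odot> x = c \<odot> x \<oplus> d \<odot> x"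
    and "\<And>c x y. x \<in> carrier M \<Longrightarrow> y \<in> carrier M \<Longrightarrow> c \<odot> (x \<oplus> y) = c \<odot> x \<oplus> c \<odot> y"
    and "\<And>c d x. x \<in> carrier M \<Longrightarrow> (c * d) \<odot> x = c \<odot> (d \<odot> x)"
    and "\<And>x. x \<in> carrier M \<Longrightarrow> 1 \<odot> x = x"
  shows "vspace M"
  unfolding vspace_def
  by (rule moduleI[OF cring_ground abelian_groupI]) (use assms in auto)

text \<open>The module laws with the operations of the record \<open>ground\<close> evaluated to
  those of the field type, so that scalars can be handled by field arithmetic.\<close>

lemma (in vspace) smultD:
  "x \<in> carrier M \<Longrightarrow> c \<odot> x \<in> carrier M"
  "x \<in> carrier M \<Longrightarrow> (c + d) \<odot> x = c \<odot> x \<oplus> d \<odot> x"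
  "x \<in> carrier M \<Longrightarrow> y \<in> carrier M \<Longrightarrow> c \<odot> (x \<oplus> y) = c \<odot> x \<oplus> c \<odot> y"
  "x \<in> carrier M \<Longrightarrow> (c * d) \<odot> x = c \<odot> (d \<odot> x)"
  "x \<in> carrier M \<Longrightarrow> 1 \<odot> x = x"
  "x \<in> carrier M \<Longrightarrow> 0 \<odot> x = \<zero>"
  "c \<odot> \<zero> = \<zero>"
  using smult_closed[of c x] smult_l_distr[of c d x] smult_r_distr[of c x y]
    smult_assoc1[of c d x] smult_one[of x] smult_l_null[of x] smult_r_null[of c] by auto

lemma (in vspace) minus_eq_smult: "x \<in> carrier M \<Longrightarrow> \<ominus> x = (- 1) \<odot> x"
proof -
  assume x: "x \<in> carrier M"
  have "(- 1) \<odot> x \<oplus> x = (- 1 + 1) \<odot> x"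
    using smultD(2)[of x "- 1" 1] x by (simp add: smultD)
  also have "\<dots> = \<zero>" using x by (simp add: smultD)
  finally show "\<ominus> x = (- 1) \<odot> x"
    using M.minus_equality[of "(- 1) \<odot> x" x] x by (simp add: smultD)
qed

lemma (in vspace) finsum_smult:
  "finite S \<Longrightarrow> f \<in> S \<rightarrow> carrier M \<Longrightarrow> c \<odot> (\<Oplus>i\<in>S. f i) = (\<Oplus>i\<in>S. c \<odot> f i)"
  by (rule finsum_smult_ldistr) auto

lemma (in vspace) finsum_smult_add:
  assumes "f \<in> S \<rightarrow> carrier M"
  shows "(\<Oplus>i\<in>S. (c i + d i) \<odot> f i) = (\<Oplus>i\<in>S. c i \<odot> f i) \<oplus> (\<Oplus>i\<in>S. d i \<odot> f i)"
proof -
  have "(\<Oplus>i\<in>S. (c i + d i) \<odot> f i) = (\<Oplus>i\<in>S. c i \<odot> f i \<oplus> d i \<odot> f i)"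
    using assms by (intro M.finsum_cong') (auto simp: smultD Pi_iff)
  also have "\<dots> = (\<Oplus>i\<in>S. c i \<odot> f i) \<oplus> (\<Oplus>i\<in>S. d i \<odot> f i)"
    using assms by (intro M.finsum_addf) (auto simp: smultD)
  finally show ?thesis .
qed

lemma (in vspace) finsum_delta:
  assumes "finite S" "f \<in> S \<rightarrow> carrier M" "i \<in> S"
  shows "(\<Oplus>j\<in>S. (if j = i then 1 else 0) \<odot> f j) = f i"
proof -
  have "(\<Oplus>j\<in>S. (if j = i then 1 else 0) \<odot> f j) = (\<Oplus>j\<in>S. if i = j then f j else \<zero>)"
    using assms by (intro M.finsum_cong') (auto simp: smultD Pi_iff)
  also have "\<dots> = f i" using assms by (intro M.finsum_singleton)
  finally show ?thesis .
qed

lemma vspace_ground: "vspace (ground :: ('k::field, 'k) module)"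
  by (rule vspaceI) (auto simp: algebra_simps intro: exI[of _ "- x" for x])

lemma ground_finsum: "(\<Oplus>\<^bsub>ground\<^esub>i\<in>S. f i) = (\<Sum>i\<in>S. f i :: 'k::field)"
proof -
  interpret vspace "ground :: ('k, 'k) module" by (rule vspace_ground)
  show ?thesis
    by (induction S rule: infinite_finite_induct) (auto simp: R.finsum_infinite)
qed

lemma k_linearI:
  assumes "\<And>x. x \<in> carrier M \<Longrightarrow> f x \<in> carrier N"
    and "\<And>x y. x \<in> carrier M \<Longrightarrow> y \<in> carrier M \<Longrightarrow> f (x \<oplus>\<^bsub>M\<^esub> y) = f x \<oplus>\<^bsub>N\<^esub> f y"
    and "\<And>c x. x \<in> carrier M \<Longrightarrow> f (c \<odot>\<^bsub>M\<^esub> x) = c \<odot>\<^bsub>N\<^esub> f x"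
  shows "k_linear M N f"
  using assms by (auto simp: k_linear_def)

lemma k_linearD:
  assumes "k_linear M N f"
  shows "x \<in> carrier M \<Longrightarrow> f x \<in> carrier N"
    and "x \<in> carrier M \<Longrightarrow> y \<in> carrier M \<Longrightarrow> f (x \<oplus>\<^bsub>M\<^esub> y) = f x \<oplus>\<^bsub>N\<^esub> f y"
    and "x \<in> carrier M \<Longrightarrow> f (c \<odot>\<^bsub>M\<^esub> x) = c \<odot>\<^bsub>N\<^esub> f x"
  using assms by (auto simp: k_linear_def)

lemma k_linear_comp: "k_linear M N f \<Longrightarrow> k_linear N P h \<Longrightarrow> k_linear M P (\<lambda>x. h (f x))"
  by (auto simp: k_linear_def Pi_iff)

lemma k_linear_id: "k_linear M M (\<lambda>x. x)"
  by (auto simp: k_linear_def)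

lemma k_linear_zero:
  assumes "vspace M" "vspace N" "k_linear M N f"
  shows "f \<zero>\<^bsub>M\<^esub> = \<zero>\<^bsub>N\<^esub>"
proof -
  interpret M: vspace M by fact
  interpret N: vspace N by fact
  have "f (0 \<odot>\<^bsub>M\<^esub> \<zero>\<^bsub>M\<^esub>) = 0 \<odot>\<^bsub>N\<^esub> f \<zero>\<^bsub>M\<^esub>"
    using k_linearD(3)[OF assms(3)] M.M.zero_closed .
  then show ?thesis
    using k_linearD(1)[OF assms(3), of "\<zero>\<^bsub>M\<^esub>"] by (simp add: M.smultD N.smultD)
qed

lemma k_linear_finsum:
  assumes "vspace M" "vspace N" "k_linear M N f" "h \<in> S \<rightarrow> carrier M"
  shows "f (\<Oplus>\<^bsub>M\<^esub>i\<in>S. h i) = (\<Oplus>\<^bsub>N\<^esub>i\<in>S. f (h i))"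
proof -
  interpret M: vspace M by fact
  interpret N: vspace N by fact
  have "f \<zero>\<^bsub>M\<^esub> = \<zero>\<^bsub>N\<^esub>" by (rule k_linear_zero) fact+
  show ?thesis
  proof (cases "finite S")
    case True
    from this assms(4) show ?thesis
    proof induction
      case empty then show ?case using \<open>f \<zero>\<^bsub>M\<^esub> = \<zero>\<^bsub>N\<^esub>\<close> by simp
    next
      case (insert i S)
      then have 1: "h i \<in> carrier M" "h \<in> S \<rightarrow> carrier M" by auto
      then have 2: "f (h i) \<in> carrier N" "(\<lambda>i. f (h i)) \<in> S \<rightarrow> carrier N"
        using k_linearD(1)[OF assms(3)] by auto
      show ?case using insert 1 2
        by (simp add: k_linearD(2)[OF assms(3)] M.M.finsum_closed)
    qed
  next
    case False then show ?thesis
      using \<open>f \<zero>\<^bsub>M\<^esub> = \<zero>\<^bsub>N\<^esub>\<close> by (simp add: M.M.finsum_infinite N.M.finsum_infinite)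
  qed
qed

lemma k_linear_functional_smult:
  assumes "vspace N" "k_linear M ground f" "y \<in> carrier N"
  shows "k_linear M N (\<lambda>x. f x \<odot>\<^bsub>N\<^esub> y)"
proof -
  interpret N: vspace N by fact
  show ?thesis using assms(3) k_linearD[OF assms(2)]
    by (intro k_linearI) (simp_all add: N.smultD)
qed

lemma k_linear_smult_const:
  assumes "vspace N" shows "k_linear N N (\<lambda>y. c \<odot>\<^bsub>N\<^esub> y)"
proof -
  interpret N: vspace N by fact
  have "c \<odot>\<^bsub>N\<^esub> (d \<odot>\<^bsub>N\<^esub> x) = d \<odot>\<^bsub>N\<^esub> (c \<odot>\<^bsub>N\<^esub> x)" if "x \<in> carrier N" for d x
    using N.smultD(4)[OF that, of c d] N.smultD(4)[OF that, of d c] by (simp add: mult.commute)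
  then show ?thesis by (intro k_linearI) (simp_all add: N.smultD)
qed

definition k_bilinear :: "('k::field, 'a) module \<Rightarrow> ('k, 'b) module \<Rightarrow> ('k, 'c) module \<Rightarrow>
    ('a \<Rightarrow> 'b \<Rightarrow> 'c) \<Rightarrow> bool"
  where "k_bilinear M N P \<beta> \<longleftrightarrow> (\<forall>x\<in>carrier M. k_linear N P (\<beta> x)) \<and>
    (\<forall>y\<in>carrier N. k_linear M P (\<lambda>x. \<beta> x y))"

lemma k_bilinearI:
  assumes "\<And>x. x \<in> carrier M \<Longrightarrow> k_linear N P (\<beta> x)"
    and "\<And>y. y \<in> carrier N \<Longrightarrow> k_linear M P (\<lambda>x. \<beta> x y)"
  shows "k_bilinear M N P \<beta>"
  using assms by (auto simp: k_bilinear_def)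

lemma k_bilinearD:
  assumes "k_bilinear M N P \<beta>"
  shows "x \<in> carrier M \<Longrightarrow> k_linear N P (\<beta> x)" "y \<in> carrier N \<Longrightarrow> k_linear M P (\<lambda>x. \<beta> x y)"
  using assms by (auto simp: k_bilinear_def)

section \<open>Quotient spaces\<close>

lemma (in vspace) submodule_abelian_subgroup:
  assumes "submodule I ground M"
  shows "abelian_subgroup I M"
  by (rule abelian_subgroupI3)
    (use assms in \<open>auto simp: submodule_def additive_subgroup_def intro: M.abelian_group_axioms\<close>)

lemma quotient_module_simps:
  "carrier (quotient_module M I) = a_rcosets\<^bsub>M\<^esub> I"
  "\<zero>\<^bsub>quotient_module M I\<^esub> = I"
  "X \<oplus>\<^bsub>quotient_module M I\<^esub> Y = X <+>\<^bsub>M\<^esub> Y"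
  "X \<otimes>\<^bsub>quotient_module M I\<^esub> Y = rcoset_mult M I X Y"
  "\<one>\<^bsub>quotient_module M I\<^esub> = I +>\<^bsub>M\<^esub> \<one>\<^bsub>M\<^esub>"
  "c \<odot>\<^bsub>quotient_module M I\<^esub> X = (\<Union>x\<in>X. I +>\<^bsub>M\<^esub> (c \<odot>\<^bsub>M\<^esub> x))"
  by (simp_all add: quotient_module_def ring.extend_def module.fields_def FactRing_def)

lemma carrier_quotient_module: "carrier (quotient_module M I) = (\<lambda>x. I +>\<^bsub>M\<^esub> x) ` carrier M"
  by (auto simp: quotient_module_simps A_RCOSETS_def' a_r_coset_def')

locale quotient_vspace = vspace M for M :: "('k::field, 'a) module" (structure) +
  fixes I
  assumes submodule: "submodule I ground M"
begin

sublocale abelian_subgroup I M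
  by (rule submodule_abelian_subgroup[OF submodule])

lemma smult_mem: "x \<in> I \<Longrightarrow> c \<odot> x \<in> I"
  using submoduleE(4)[OF submodule] by simp

lemma mem_coset_iff: "x \<in> carrier M \<Longrightarrow> y \<in> I +> x \<longleftrightarrow> y \<in> carrier M \<and> y \<oplus> \<ominus> x \<in> I"
  using a_rcos_module a_elemrcos_carrier by blast

lemma coset_eq_iff:
  assumes "x \<in> carrier M" "y \<in> carrier M"
  shows "I +> x = I +> y \<longleftrightarrow> x \<oplus> \<ominus> y \<in> I"
  using assms mem_coset_iff[of y x] a_repr_independence'[of x y] a_repr_independenceD[of x y] by metis

text \<open>The scalar action on cosets is defined as a union over all representatives. The united
  cosets coincide because \<open>I\<close> is stable under scalars, and a coset is nonempty, so the
  union equals each of them.\<close>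

lemma coset_smult:
  assumes x: "x \<in> carrier M"
  shows "c \<odot>\<^bsub>quotient_module M I\<^esub> (I +> x) = I +> (c \<odot> x)"
proof -
  have *: "I +> (c \<odot> y) = I +> (c \<odot> x)" if "y \<in> I +> x" for y
  proof -
    have y: "y \<in> carrier M" "y \<oplus> \<ominus> x \<in> I" using that x mem_coset_iff by auto
    then have "c \<odot> (y \<oplus> \<ominus> x) \<in> I" by (intro smult_mem)
    moreover have "c \<odot> (y \<oplus> \<ominus> x) = c \<odot> y \<oplus> \<ominus> (c \<odot> x)"
      using x y smult_r_minus[of c x] smultD(3)[of y "\<ominus> x" c] by simp
    ultimately have "c \<odot> y \<oplus> \<ominus> (c \<odot> x) \<in> I" by simp
    then show ?thesis using coset_eq_iff[of "c \<odot> y" "c \<odot> x"] x y(1) smultD(1) by blast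
  qed
  have "x \<in> I +> x" using x by (rule a_rcos_self)
  then have "I +> x \<noteq> {}" by blast
  then show ?thesis
    unfolding quotient_module_simps by (rule SUP_eq_const) (rule *)
qed

lemma coset_add:
  "x \<in> carrier M \<Longrightarrow> y \<in> carrier M \<Longrightarrow>
    (I +> x) \<oplus>\<^bsub>quotient_module M I\<^esub> (I +> y) = I +> (x \<oplus> y)"
  by (simp add: quotient_module_simps a_rcos_sum)

lemma coset_zero: "I +> \<zero> = \<zero>\<^bsub>quotient_module M I\<^esub>"
  by (simp add: quotient_module_simps a_rcos_const)

lemma vspace_quotient: "vspace (quotient_module M I)"
proof (rule vspaceI)
  show "\<zero>\<^bsub>quotient_module M I\<^esub> \<in> carrier (quotient_module M I)"
    unfolding coset_zero[symmetric] carrier_quotient_module by blast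
  show "\<exists>Y\<in>carrier (quotient_module M I). Y \<oplus>\<^bsub>quotient_module M I\<^esub> X = \<zero>\<^bsub>quotient_module M I\<^esub>"
    if "X \<in> carrier (quotient_module M I)" for X
  proof -
    from that obtain x where x: "x \<in> carrier M" "X = I +> x" by (auto simp: carrier_quotient_module)
    then show ?thesis
      by (intro bexI[of _ "I +> \<ominus> x"])
        (auto simp: coset_add carrier_quotient_module coset_zero[symmetric] M.l_neg)
  qed
qed (auto simp: carrier_quotient_module coset_add coset_smult smultD M.a_ac coset_zero[symmetric])

lemma k_linear_coset: "k_linear M (quotient_module M I) (\<lambda>x. I +> x)"
  by (rule k_linearI) (auto simp: coset_add coset_smult carrier_quotient_module)

text \<open>Descent to the quotient, phrased with an arbitrarily chosen representative because both
  \<open>sweedler\<close> and the coordinate functionals \<open>coord\<close> are evaluated in this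
  way.\<close>

lemma factor_some:
  assumes "vspace P" "k_linear M P L" "\<And>x. x \<in> I \<Longrightarrow> L x = \<zero>\<^bsub>P\<^esub>"
  shows "x \<in> carrier M \<Longrightarrow> L (SOME p. p \<in> I +> x) = L x"
    and "k_linear (quotient_module M I) P (\<lambda>X. L (SOME p. p \<in> X))"
proof -
  interpret P: vspace P by fact
  have *: "L y = L x" if "x \<in> carrier M" "y \<in> I +> x" for x y
  proof -
    have y: "y \<in> carrier M" "y \<oplus> \<ominus> x \<in> I" using that mem_coset_iff by auto
    have "L y = L ((y \<oplus> \<ominus> x) \<oplus> x)" using y that(1) by (simp add: M.a_assoc M.l_neg)
    also have "\<dots> = L (y \<oplus> \<ominus> x) \<oplus>\<^bsub>P\<^esub> L x"
      using y that(1) k_linearD(2)[OF assms(2), of "y \<oplus> \<ominus> x" x] by simp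
    also have "\<dots> = L x" using assms(3)[OF y(2)] k_linearD(1)[OF assms(2) that(1)] by simp
    finally show ?thesis .
  qed
  have **: "L (SOME p. p \<in> I +> x) = L x" if "x \<in> carrier M" for x
    using that a_rcos_self[OF that] by (intro *) (auto intro: someI)
  then show "x \<in> carrier M \<Longrightarrow> L (SOME p. p \<in> I +> x) = L x" .
  show "k_linear (quotient_module M I) P (\<lambda>X. L (SOME p. p \<in> X))"
    by (rule k_linearI)
      (auto simp: carrier_quotient_module coset_add coset_smult ** smultD k_linearD[OF assms(2)])
qed

end

section \<open>Tensor products and Sweedler sums\<close>

lemma free_space_simps:
  "carrier (free_space X) = {p. Poly_Mapping.keys p \<subseteq> X}"
  "\<zero>\<^bsub>free_space X\<^esub> = 0" "p \<oplus>\<^bsub>free_space X\<^esub> r = p + r"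
  "c \<odot>\<^bsub>free_space X\<^esub> p = Poly_Mapping.map ((*) c) p"
  by (simp_all add: free_space_def)

lemma lookup_map_times: "Poly_Mapping.lookup (Poly_Mapping.map ((*) c) p) z = c * Poly_Mapping.lookup p z" for c :: "'k::field"
  by (simp add: Poly_Mapping.map.rep_eq when_def)

lemma keys_map_times: "Poly_Mapping.keys (Poly_Mapping.map ((*) c) p) \<subseteq> Poly_Mapping.keys p" for c :: "'k::field"
  by (auto simp: in_keys_iff lookup_map_times)

lemma vspace_free_space: "vspace (free_space X :: ('k::field, _) module)"
proof (rule vspaceI)
  show "\<exists>r\<in>carrier (free_space X). r \<oplus>\<^bsub>free_space X\<^esub> p = \<zero>\<^bsub>free_space X\<^esub>"
    if "p \<in> carrier (free_space X)" for p :: "'a \<Rightarrow>\<^sub>0 'k"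
    using that by (intro bexI[of _ "- p"]) (simp_all add: free_space_simps)
  show "p \<in> carrier (free_space X) \<Longrightarrow> r \<in> carrier (free_space X) \<Longrightarrow>
      p \<oplus>\<^bsub>free_space X\<^esub> r \<in> carrier (free_space X)" for p r :: "'a \<Rightarrow>\<^sub>0 'k"
    using Poly_Mapping.keys_add[of p r] by (auto simp: free_space_simps)
  show "p \<in> carrier (free_space X) \<Longrightarrow> c \<odot>\<^bsub>free_space X\<^esub> p \<in> carrier (free_space X)"
    for p :: "'a \<Rightarrow>\<^sub>0 'k" and c
    using keys_map_times[of c p] by (auto simp: free_space_simps)
qed (auto simp: free_space_simps lookup_map_times lookup_add algebra_simps intro!: poly_mapping_eqI)

text \<open>The linear map out of a free space given by its universal property. The sum inside
  \<open>sweedler\<close> is such a map, applied to the chosen representative.\<close>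

definition free_extension :: "('k::field, 'c) module \<Rightarrow> ('x \<Rightarrow> 'c) \<Rightarrow> ('x \<Rightarrow>\<^sub>0 'k) \<Rightarrow> 'c"
  where "free_extension P h p = (\<Oplus>\<^bsub>P\<^esub>z\<in>Poly_Mapping.keys p. Poly_Mapping.lookup p z \<odot>\<^bsub>P\<^esub> h z)"

context vspace
begin

text \<open>The support of a sum may be smaller than the union of the supports. Summing over a fixed
  larger set makes the expression visibly additive.\<close>

lemma free_extension_superset:
  assumes "finite Z" "Poly_Mapping.keys p \<subseteq> Z" "h \<in> Z \<rightarrow> carrier M"
  shows "free_extension M h p = (\<Oplus>z\<in>Z. Poly_Mapping.lookup p z \<odot> h z)"
  unfolding free_extension_def
  by (rule M.add.finprod_mono_neutral_cong_left)
    (use assms in \<open>auto simp: smultD Pi_iff in_keys_iff\<close>)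

lemma k_linear_free_extension:
  fixes X :: "'x set"
  assumes h: "h \<in> X \<rightarrow> carrier M"
  shows "k_linear (free_space X) M (free_extension M h)"
proof (rule k_linearI)
  fix p :: "'x \<Rightarrow>\<^sub>0 'k" assume p: "p \<in> carrier (free_space X)"
  then have p': "Poly_Mapping.keys p \<subseteq> X" by (simp add: free_space_simps)
  then show "free_extension M h p \<in> carrier M"
    unfolding free_extension_def using h p' by (intro M.finsum_closed) (auto simp: smultD Pi_iff subset_iff)
  show "free_extension M h (c \<odot>\<^bsub>free_space X\<^esub> p) = c \<odot> free_extension M h p" for c
  proof -
    have "free_extension M h (c \<odot>\<^bsub>free_space X\<^esub> p) = (\<Oplus>z\<in>Poly_Mapping.keys p. (c * Poly_Mapping.lookup p z) \<odot> h z)"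
      using p' h keys_map_times[of c p]
      by (subst free_extension_superset[of "Poly_Mapping.keys p"]) (auto simp: free_space_simps lookup_map_times)
    also have "\<dots> = (\<Oplus>z\<in>Poly_Mapping.keys p. c \<odot> (Poly_Mapping.lookup p z \<odot> h z))"
      using p' h by (intro M.finsum_cong') (auto simp: smultD Pi_iff subset_iff)
    also have "\<dots> = c \<odot> free_extension M h p"
      unfolding free_extension_def using p' h by (intro finsum_smult[symmetric]) (auto simp: smultD Pi_iff subset_iff)
    finally show ?thesis .
  qed
next
  fix p r :: "'x \<Rightarrow>\<^sub>0 'k" assume p: "p \<in> carrier (free_space X)"
  then have p': "Poly_Mapping.keys p \<subseteq> X" by (simp add: free_space_simps)
  assume r: "r \<in> carrier (free_space X)"
  then have r': "Poly_Mapping.keys r \<subseteq> X" by (simp add: free_space_simps)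
  let ?Z = "Poly_Mapping.keys p \<union> Poly_Mapping.keys r"
  have hZ: "h \<in> ?Z \<rightarrow> carrier M" using h p' r' by auto
  have "free_extension M h (p + r) = (\<Oplus>z\<in>?Z. (Poly_Mapping.lookup p z + Poly_Mapping.lookup r z) \<odot> h z)"
    using hZ Poly_Mapping.keys_add[of p r] by (subst free_extension_superset[of ?Z]) (auto simp: lookup_add)
  also have "\<dots> = (\<Oplus>z\<in>?Z. Poly_Mapping.lookup p z \<odot> h z) \<oplus> (\<Oplus>z\<in>?Z. Poly_Mapping.lookup r z \<odot> h z)"
    by (rule finsum_smult_add[OF hZ])
  also have "\<dots> = free_extension M h p \<oplus> free_extension M h r"
    using hZ by (simp add: free_extension_superset[of ?Z])
  finally show "free_extension M h (p \<oplus>\<^bsub>free_space X\<^esub> r) = free_extension M h p \<oplus> free_extension M h r"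
    by (simp add: free_space_simps)
qed

lemma free_extension_single:
  assumes "h z \<in> carrier M"
  shows "free_extension M h (Poly_Mapping.single z c) = c \<odot> h z"
  by (subst free_extension_superset[of "{z}"]) (use assms in \<open>auto simp: smultD\<close>)

lemma generated_submodule:
  assumes "G \<subseteq> carrier M"
  shows "submodule (generated_submodule M G) ground M" "G \<subseteq> generated_submodule M G"
    "submodule N ground M \<Longrightarrow> G \<subseteq> N \<Longrightarrow> generated_submodule M G \<subseteq> N"
proof -
  \<comment> \<open>The whole space belongs to the family that is intersected, so the intersection
    stays within the carrier.\<close>
  have c: "carrier M \<in> {N. submodule N ground M \<and> G \<subseteq> N}" using carrier_is_submodule assms by auto
  show "submodule (generated_submodule M G) ground M"
    unfolding generated_submodule_def
  proof (rule submoduleI)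
    show "\<Inter> {N. submodule N ground M \<and> G \<subseteq> N} \<subseteq> carrier M" using c by blast
    show "\<zero> \<in> \<Inter> {N. submodule N ground M \<and> G \<subseteq> N}"
      by (auto simp: submodule_def dest!: subgroup.one_closed)
  qed (use submoduleE(3,4,5) in auto)
qed (auto simp: generated_submodule_def)

end

text \<open>Kernels are the submodules to which minimality of a generated submodule gets applied: a
  linear map that kills generators kills everything they generate.\<close>

lemma submodule_kernel:
  assumes "vspace M" "vspace N" "k_linear M N f"
  shows "submodule {x \<in> carrier M. f x = \<zero>\<^bsub>N\<^esub>} ground M"
proof -
  interpret M: vspace M by fact
  interpret N: vspace N by fact
  show ?thesis
    by (rule M.submoduleI)
      (auto simp: M.smultD N.smultD k_linearD[OF assms(3)] k_linear_zero[OF assms] M.minus_eq_smult)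
qed

locale vspace_pair = M: vspace M + N: vspace N
  for M :: "('k::field, 'a) module" and N :: "('k::field, 'b) module"
begin

abbreviation "F \<equiv> free_space (carrier M \<times> carrier N) :: ('k, _) module"

lemma bilinear_relations_subset: "bilinear_relations M N \<subseteq> carrier F"
proof
  fix p assume "p \<in> bilinear_relations M N"
  then show "p \<in> carrier F"
    unfolding bilinear_relations_def
    by (auto simp: free_space_simps M.smultD N.smultD split: if_splits dest!: subsetD[OF Poly_Mapping.keys_diff])
qed

lemma quotient_vspace_tensor: "quotient_vspace F (tensor_null M N)"
  using vspace.generated_submodule(1)[OF vspace_free_space bilinear_relations_subset] vspace_free_space
  by (simp add: quotient_vspace_def quotient_vspace_axioms_def tensor_null_def)

sublocale T: quotient_vspace F "tensor_null M N"
  by (rule quotient_vspace_tensor)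

lemma vspace_tensor: "vspace (tensor_product M N)"
  unfolding tensor_product_def by (rule T.vspace_quotient)

lemma single_in_F: "x \<in> carrier M \<Longrightarrow> y \<in> carrier N \<Longrightarrow> Poly_Mapping.single (x, y) c \<in> carrier F"
  by (simp add: free_space_simps)

lemma single_add_in_F:
  assumes "x \<in> carrier M" "y \<in> carrier N" "x' \<in> carrier M" "y' \<in> carrier N"
  shows "Poly_Mapping.single (x, y) c + Poly_Mapping.single (x', y') d \<in> carrier F"
  using T.M.add.m_closed[OF single_in_F[OF assms(1,2), of c] single_in_F[OF assms(3,4), of d]]
  by (simp add: free_space_simps(3))

lemma pure_tensor_closed:
  "x \<in> carrier M \<Longrightarrow> y \<in> carrier N \<Longrightarrow> pure_tensor M N x y \<in> carrier (tensor_product M N)"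
  unfolding tensor_product_def pure_tensor_def
  by (intro k_linearD(1)[OF T.k_linear_coset] single_in_F)

lemma relation_in_null:
  assumes "p - r \<in> bilinear_relations M N" "p \<in> carrier F" "r \<in> carrier F"
  shows "tensor_null M N +>\<^bsub>F\<^esub> p = tensor_null M N +>\<^bsub>F\<^esub> r"
proof -
  have "\<ominus>\<^bsub>F\<^esub> r = - r"
    using assms(3) by (intro T.M.minus_equality) (simp_all add: free_space_simps)
  moreover have "p - r \<in> tensor_null M N"
    using vspace.generated_submodule(2)[OF vspace_free_space bilinear_relations_subset] assms(1)
    by (auto simp: tensor_null_def)
  ultimately show ?thesis using assms by (simp add: T.coset_eq_iff free_space_simps(3))
qed

lemma coset_single:
  assumes "x \<in> carrier M" "y \<in> carrier N"
  shows "tensor_null M N +>\<^bsub>F\<^esub> Poly_Mapping.single (x, y) c = c \<odot>\<^bsub>tensor_product M N\<^esub> pure_tensor M N x y"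
  unfolding pure_tensor_def tensor_product_def
  by (subst T.coset_smult) (use assms in \<open>simp_all add: single_in_F free_space_simps(4)\<close>)

lemma coset_sum:
  assumes "x \<in> carrier M" "y \<in> carrier N" "x' \<in> carrier M" "y' \<in> carrier N"
  shows "tensor_null M N +>\<^bsub>F\<^esub> (Poly_Mapping.single (x, y) 1 + Poly_Mapping.single (x', y') 1) =
    pure_tensor M N x y \<oplus>\<^bsub>tensor_product M N\<^esub> pure_tensor M N x' y'"
  unfolding pure_tensor_def tensor_product_def
  using T.coset_add[OF single_in_F[OF assms(1,2), of 1] single_in_F[OF assms(3,4), of 1]]
  by (simp add: free_space_simps(3))

lemma k_bilinear_pure_tensor: "k_bilinear M N (tensor_product M N) (pure_tensor M N)"
proof (rule k_bilinearI; rule k_linearI)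
  fix x x' y y' c
  assume x: "x \<in> carrier M"
  show "y \<in> carrier N \<Longrightarrow> pure_tensor M N x y \<in> carrier (tensor_product M N)" for y
    by (rule pure_tensor_closed[OF x])
  show "y \<in> carrier N \<Longrightarrow> pure_tensor M N x y \<in> carrier (tensor_product M N)" for y
    by (rule pure_tensor_closed[OF x])
  assume y: "y \<in> carrier N"
  have "pure_tensor M N x (c \<odot>\<^bsub>N\<^esub> y) = tensor_null M N +>\<^bsub>F\<^esub> Poly_Mapping.single (x, y) c"
    unfolding pure_tensor_def
    by (rule relation_in_null) (use x y in \<open>auto simp: bilinear_relations_def N.smultD intro!: single_in_F\<close>)
  then show "pure_tensor M N x (c \<odot>\<^bsub>N\<^esub> y) = c \<odot>\<^bsub>tensor_product M N\<^esub> pure_tensor M N x y"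
    using x y by (simp add: coset_single)
  have "pure_tensor M N (c \<odot>\<^bsub>M\<^esub> x) y = tensor_null M N +>\<^bsub>F\<^esub> Poly_Mapping.single (x, y) c"
    unfolding pure_tensor_def
    by (rule relation_in_null) (use x y in \<open>auto simp: bilinear_relations_def M.smultD intro!: single_in_F\<close>)
  then show "pure_tensor M N (c \<odot>\<^bsub>M\<^esub> x) y = c \<odot>\<^bsub>tensor_product M N\<^esub> pure_tensor M N x y"
    using x y by (simp add: coset_single)
  { assume y': "y' \<in> carrier N"
    have "pure_tensor M N x (y \<oplus>\<^bsub>N\<^esub> y') = tensor_null M N +>\<^bsub>F\<^esub>
       (Poly_Mapping.single (x, y) 1 + Poly_Mapping.single (x, y') 1)"
      unfolding pure_tensor_def
      by (rule relation_in_null)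
        (use x y y' single_add_in_F in \<open>auto simp: bilinear_relations_def diff_diff_eq intro!: single_in_F\<close>)
    then show "pure_tensor M N x (y \<oplus>\<^bsub>N\<^esub> y') =
        pure_tensor M N x y \<oplus>\<^bsub>tensor_product M N\<^esub> pure_tensor M N x y'"
      using x y y' by (simp add: coset_sum) }
  { assume x': "x' \<in> carrier M"
    have "pure_tensor M N (x \<oplus>\<^bsub>M\<^esub> x') y = tensor_null M N +>\<^bsub>F\<^esub>
       (Poly_Mapping.single (x, y) 1 + Poly_Mapping.single (x', y) 1)"
      unfolding pure_tensor_def
      by (rule relation_in_null)
        (use x y x' single_add_in_F in \<open>auto simp: bilinear_relations_def diff_diff_eq intro!: single_in_F\<close>)
    then show "pure_tensor M N (x \<oplus>\<^bsub>M\<^esub> x') y =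
        pure_tensor M N x y \<oplus>\<^bsub>tensor_product M N\<^esub> pure_tensor M N x' y"
      using x y x' by (simp add: coset_sum) }
qed

end

lemma sweedler_eq_free_extension:
  "sweedler P T \<beta> = free_extension P (\<lambda>z. \<beta> (fst z) (snd z)) (SOME p. p \<in> T)"
  by (simp add: sweedler_def free_extension_def Let_def)

context
  fixes M :: "('k::field, 'a) module" and N :: "('k, 'b) module" and P :: "('k, 'c) module" and \<beta>
  assumes M: "vspace M" and N: "vspace N" and P: "vspace P" and \<beta>: "k_bilinear M N P \<beta>"
begin

interpretation vspace_pair M N
  using M N by (rule vspace_pair.intro)

interpretation P: vspace P
  by (rule P)

text \<open>Well-definedness of Sweedler sums. Bilinearity of \<beta> sends each of the four
  families of relations to zero, and the kernel is a submodule, so it contains all of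
  \<open>tensor_null\<close>.\<close>

lemma sweedler_aux:
  "k_linear F P (free_extension P (\<lambda>z. \<beta> (fst z) (snd z)))"
  "p \<in> tensor_null M N \<Longrightarrow> free_extension P (\<lambda>z. \<beta> (fst z) (snd z)) p = \<zero>\<^bsub>P\<^esub>"
proof -
  let ?L = "free_extension P (\<lambda>z. \<beta> (fst z) (snd z))"
  note lin = k_linearD[OF k_bilinearD(1)[OF \<beta>]] k_linearD[OF k_bilinearD(2)[OF \<beta>]]
  show L: "k_linear F P ?L"
    by (rule P.k_linear_free_extension) (auto simp: lin)
  have diff: "?L (p - r) = ?L p \<oplus>\<^bsub>P\<^esub> (- 1) \<odot>\<^bsub>P\<^esub> ?L r" if "p \<in> carrier F" "r \<in> carrier F" for p r
  proof -
    have "p - r = p \<oplus>\<^bsub>F\<^esub> ((- 1) \<odot>\<^bsub>F\<^esub> r)"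
      by (auto simp: free_space_simps lookup_add lookup_minus lookup_map_times intro!: poly_mapping_eqI)
    then show ?thesis using that by (simp add: k_linearD[OF L] T.smultD)
  qed
  have cl: "p - r \<in> carrier F" if "p \<in> carrier F" "r \<in> carrier F" for p r :: "('a \<times> 'b) \<Rightarrow>\<^sub>0 'k"
    using that Poly_Mapping.keys_diff[of p r] by (auto simp: free_space_simps)
  have sg: "?L (Poly_Mapping.single (x, y) c) = c \<odot>\<^bsub>P\<^esub> \<beta> x y"
    if "x \<in> carrier M" "y \<in> carrier N" for x y c
    using that by (subst P.free_extension_single) (auto simp: lin)
  have neg: "x \<oplus>\<^bsub>P\<^esub> (- 1) \<odot>\<^bsub>P\<^esub> x = \<zero>\<^bsub>P\<^esub>" if "x \<in> carrier P" for x
    using that by (simp add: P.minus_eq_smult[symmetric] P.M.r_neg)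
  have neg2: "x \<oplus>\<^bsub>P\<^esub> y \<oplus>\<^bsub>P\<^esub> (- 1) \<odot>\<^bsub>P\<^esub> x \<oplus>\<^bsub>P\<^esub> (- 1) \<odot>\<^bsub>P\<^esub> y = \<zero>\<^bsub>P\<^esub>"
    if "x \<in> carrier P" "y \<in> carrier P" for x y
  proof -
    have "x \<oplus>\<^bsub>P\<^esub> y \<oplus>\<^bsub>P\<^esub> (- 1) \<odot>\<^bsub>P\<^esub> x \<oplus>\<^bsub>P\<^esub> (- 1) \<odot>\<^bsub>P\<^esub> y =
      (x \<oplus>\<^bsub>P\<^esub> y) \<oplus>\<^bsub>P\<^esub> (- 1) \<odot>\<^bsub>P\<^esub> (x \<oplus>\<^bsub>P\<^esub> y)"
      using that by (simp add: P.smultD P.M.a_assoc)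
    then show ?thesis using that neg by simp
  qed
  have "bilinear_relations M N \<subseteq> {p \<in> carrier F. ?L p = \<zero>\<^bsub>P\<^esub>}"
  proof
    fix p assume p: "p \<in> bilinear_relations M N"
    then have "?L p = \<zero>\<^bsub>P\<^esub>"
      unfolding bilinear_relations_def
      by (auto simp: diff cl single_in_F M.smultD N.smultD sg lin P.smultD neg neg2)
    then show "p \<in> {p \<in> carrier F. ?L p = \<zero>\<^bsub>P\<^esub>}"
      using p bilinear_relations_subset by auto
  qed
  then show "p \<in> tensor_null M N \<Longrightarrow> ?L p = \<zero>\<^bsub>P\<^esub>"
    using vspace.generated_submodule(3)[OF vspace_free_space bilinear_relations_subset
        submodule_kernel[OF vspace_free_space P L]]
    by (auto simp: tensor_null_def)
qed

text \<open>The universal property of the tensor product: this is the linear map induced by \<beta>,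
  and its values on pure tensors are those of \<beta>.\<close>

lemma k_linear_sweedler: "k_linear (tensor_product M N) P (\<lambda>T. sweedler P T \<beta>)"
  unfolding sweedler_eq_free_extension tensor_product_def
  by (rule T.factor_some(2)[OF P sweedler_aux])

lemma sweedler_pure_tensor:
  assumes "x \<in> carrier M" "y \<in> carrier N"
  shows "sweedler P (pure_tensor M N x y) \<beta> = \<beta> x y"
  unfolding sweedler_eq_free_extension pure_tensor_def
  by (subst T.factor_some(1)[OF P sweedler_aux])
    (use assms k_linearD[OF k_bilinearD(1)[OF \<beta>]] in
      \<open>auto simp: single_in_F P.free_extension_single P.smultD\<close>)

end

lemma vspace_tensor_product: "vspace M \<Longrightarrow> vspace N \<Longrightarrow> vspace (tensor_product M N)"
  by (rule vspace_pair.vspace_tensor[OF vspace_pair.intro])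

lemma k_bilinear_pure_tensor: "vspace M \<Longrightarrow> vspace N \<Longrightarrow> k_bilinear M N (tensor_product M N) (pure_tensor M N)"
  by (rule vspace_pair.k_bilinear_pure_tensor[OF vspace_pair.intro])

lemmas pure_tensor_linear = k_bilinearD[OF k_bilinear_pure_tensor]

lemma k_linear_cong:
  assumes "vspace M" "k_linear M N f" "\<And>x. x \<in> carrier M \<Longrightarrow> f x = h x"
  shows "k_linear M N h"
proof -
  interpret vspace M by fact
  show ?thesis
    by (rule k_linearI) (simp_all add: assms(3)[symmetric] k_linearD[OF assms(2)] smultD)
qed

lemma k_linear_finsum_fun:
  assumes "vspace M" "\<And>i. i \<in> S \<Longrightarrow> k_linear N M (f i)"
  shows "k_linear N M (\<lambda>y. \<Oplus>\<^bsub>M\<^esub>i\<in>S. f i y)"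
proof -
  interpret M: vspace M by fact
  note f = k_linearD[OF assms(2)]
  show ?thesis
  proof (rule k_linearI)
    fix y y' c assume y: "y \<in> carrier N"
    show "(\<Oplus>\<^bsub>M\<^esub>i\<in>S. f i y) \<in> carrier M"
      using f y by (intro M.M.finsum_closed) auto
    show "(\<Oplus>\<^bsub>M\<^esub>i\<in>S. f i (c \<odot>\<^bsub>N\<^esub> y)) = c \<odot>\<^bsub>M\<^esub> (\<Oplus>\<^bsub>M\<^esub>i\<in>S. f i y)"
    proof (cases "finite S")
      case True
      have "(\<Oplus>\<^bsub>M\<^esub>i\<in>S. f i (c \<odot>\<^bsub>N\<^esub> y)) = (\<Oplus>\<^bsub>M\<^esub>i\<in>S. c \<odot>\<^bsub>M\<^esub> f i y)"
        using f y by (intro M.M.finsum_cong') (auto simp: M.smultD)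
      then show ?thesis using True f y by (subst M.finsum_smult) auto
    qed (simp add: M.M.finsum_infinite M.smultD)
    assume y': "y' \<in> carrier N"
    have "(\<Oplus>\<^bsub>M\<^esub>i\<in>S. f i (y \<oplus>\<^bsub>N\<^esub> y')) = (\<Oplus>\<^bsub>M\<^esub>i\<in>S. f i y \<oplus>\<^bsub>M\<^esub> f i y')"
      using f y y' by (intro M.M.finsum_cong') auto
    then show "(\<Oplus>\<^bsub>M\<^esub>i\<in>S. f i (y \<oplus>\<^bsub>N\<^esub> y')) = (\<Oplus>\<^bsub>M\<^esub>i\<in>S. f i y) \<oplus>\<^bsub>M\<^esub> (\<Oplus>\<^bsub>M\<^esub>i\<in>S. f i y')"
      using f y y' by (subst M.M.finsum_addf[symmetric]) auto
  qed
qed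

text \<open>One representative of \<open>T\<close> serves all parameters, which turns the Sweedler
  sum into a finite sum of maps linear in the parameter. The iterated sums of coassociativity and
  the formula for the antipode depend on a parameter in this way.\<close>

lemma k_linear_sweedler_parameter:
  assumes M: "vspace M" and N: "vspace N" and P: "vspace P"
    and Q: "vspace Q"
    and \<beta>: "\<And>y. y \<in> carrier Q \<Longrightarrow> k_bilinear M N P (\<beta> y)"
    and lin: "\<And>u v. u \<in> carrier M \<Longrightarrow> v \<in> carrier N \<Longrightarrow> k_linear Q P (\<lambda>y. \<beta> y u v)"
    and T: "T \<in> carrier (tensor_product M N)"
  shows "k_linear Q P (\<lambda>y. sweedler P T (\<beta> y))"
proof -
  interpret vspace_pair M N using M N by (rule vspace_pair.intro)
  interpret P: vspace P by (rule P)
  obtain p where p: "p \<in> carrier F" "T = tensor_null M N +>\<^bsub>F\<^esub> p"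
    using T by (auto simp: tensor_product_def carrier_quotient_module)
  let ?h = "\<lambda>y. \<Oplus>\<^bsub>P\<^esub>z\<in>Poly_Mapping.keys p. Poly_Mapping.lookup p z \<odot>\<^bsub>P\<^esub> \<beta> y (fst z) (snd z)"
  have eq: "sweedler P T (\<beta> y) = ?h y" if "y \<in> carrier Q" for y
  proof -
    have "sweedler P T (\<beta> y) = free_extension P (\<lambda>z. \<beta> y (fst z) (snd z)) p"
      unfolding sweedler_eq_free_extension p(2)
      by (rule T.factor_some(1)[OF P sweedler_aux[OF M N P \<beta>[OF that]] p(1)])
    then show ?thesis by (simp add: free_extension_def)
  qed
  have keys: "Poly_Mapping.keys p \<subseteq> carrier M \<times> carrier N"
    using p(1) by (simp add: free_space_simps)
  have "k_linear Q P (\<lambda>y. Poly_Mapping.lookup p z \<odot>\<^bsub>P\<^esub> \<beta> y (fst z) (snd z))"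
    if "z \<in> Poly_Mapping.keys p" for z
    by (rule k_linear_comp[OF lin k_linear_smult_const[OF P]]) (use keys that in auto)
  then have h: "k_linear Q P ?h"
    by (intro k_linear_finsum_fun P)
  show ?thesis by (rule k_linear_cong[OF Q h eq[symmetric]])
qed

section \<open>Normal forms of words\<close>

lemma letters_plus: "letters (v + w) = letters v @ letters w"
  by (simp add: plus_free_monoid_def)

lemma restrict_eqD: "restrict f A = restrict g A \<Longrightarrow> x \<in> A \<Longrightarrow> f x = g x"
  by (metis restrict_apply')

lemma count_list_replicate: "count_list (replicate m i) j = (if j = i then m else 0)"
  by (induction m) auto

locale quantum_ci =
  fixes n :: nat and a :: "nat \<Rightarrow> nat" and q :: "nat \<Rightarrow> nat \<Rightarrow> 'k::field"
  assumes n_ge: "n \<ge> 2"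
    and a_ge: "\<And>i. i \<in> {1..n} \<Longrightarrow> a i \<ge> 2"
    and q_diag: "\<And>i. i \<in> {1..n} \<Longrightarrow> q i i = - 1"
    and q_inv: "\<And>i j. i \<in> {1..n} \<Longrightarrow> j \<in> {1..n} \<Longrightarrow> q i j * q j i = 1"
begin

section \<open>The bracket as a bicharacter\<close>

abbreviation "B \<equiv> q_bracket n q"

lemma finite_index_pairs: "finite {(i, j). 1 \<le> i \<and> i < j \<and> j \<le> n}"
  by (rule finite_subset[of _ "{1..n} \<times> {1..n}"]) auto

lemma B_cong:
  "(\<And>i. i \<in> {1..n} \<Longrightarrow> u i = u' i) \<Longrightarrow> (\<And>i. i \<in> {1..n} \<Longrightarrow> v i = v' i) \<Longrightarrow> B u v = B u' v'"
  unfolding q_bracket_def by (rule prod.cong) auto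

lemma B_add_left: "B (\<lambda>i. u i + v i) w = B u w * B v w"
  unfolding q_bracket_def prod.distrib[symmetric]
  by (rule prod.cong) (auto simp: algebra_simps power_add)

lemma B_add_right: "B w (\<lambda>i. u i + v i) = B w u * B w v"
  unfolding q_bracket_def prod.distrib[symmetric]
  by (rule prod.cong) (auto simp: algebra_simps power_add)

lemma B_zero [simp]: "B (\<lambda>i. 0) v = 1" "B v (\<lambda>i. 0) = 1"
  by (auto simp: q_bracket_def intro: prod.neutral)

lemma q_nz: "i \<in> {1..n} \<Longrightarrow> j \<in> {1..n} \<Longrightarrow> q i j \<noteq> 0"
  using q_inv[of i j] by auto

lemma B_nz: "B u v \<noteq> 0"
  unfolding q_bracket_def using finite_index_pairs q_nz by auto

lemma count_list_append_fun: "count_list (u @ w) = (\<lambda>i. count_list u i + count_list w i)"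
  by auto

text \<open>The price of moving the letter \<open>i\<close> to the right past all smaller letters of
  \<open>v\<close>. Only pairs \<open>(j, i)\<close> with \<open>j < i\<close> contribute to the
  bracket, and \<open>- 1 / q j i = - q i j\<close>.\<close>

lemma B_unit:
  assumes i: "i \<in> {1..n}"
  shows "B (count_list [i]) v = (\<Prod>j\<in>{1..<i}. (- q i j) ^ v j)"
proof -
  have "B (count_list [i]) v = (\<Prod>(j, l)\<in>(\<lambda>j. (j, i)) ` {1..<i}. (- 1 / q j l) ^ (count_list [i] l * v j))"
    unfolding q_bracket_def using i
    by (intro prod.mono_neutral_right finite_index_pairs) (auto simp: image_iff)
  also have "\<dots> = (\<Prod>j\<in>{1..<i}. (- 1 / q j i) ^ v j)"
    by (subst prod.reindex) (auto simp: inj_on_def)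
  also have "\<dots> = (\<Prod>j\<in>{1..<i}. (- q i j) ^ v j)"
  proof (rule prod.cong[OF refl])
    fix j assume "j \<in> {1..<i}"
    then have "q i j * q j i = 1" using i by (intro q_inv) auto
    then have "- 1 / q j i = - q i j" by (cases "q j i = 0") (simp_all add: field_simps)
    then show "(- 1 / q j i) ^ v j = (- q i j) ^ v j" by simp
  qed
  finally show ?thesis .
qed

lemma B_units:
  assumes "i \<in> {1..n}" "j \<in> {1..n}"
  shows "B (count_list [i]) (count_list [j]) = (if j < i then - q i j else 1)"
proof -
  have "B (count_list [i]) (count_list [j]) = (\<Prod>l\<in>{1..<i}. if l = j then - q i j else 1)"
    unfolding B_unit[OF assms(1)] by (rule prod.cong) auto
  then show ?thesis using assms by simp
qed

text \<open>The factor between a word and its sorted rearrangement in the quantum complete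
  intersection: the tail is sorted, then the first letter is inserted.\<close>

fun word_scalar :: "nat list \<Rightarrow> 'k" where
  "word_scalar [] = 1"
| "word_scalar (i # w) = B (count_list [i]) (count_list w) * word_scalar w"

text \<open>The deviation of \<open>word_scalar\<close> from multiplicativity depends on the
  exponents of the two words only. This is what makes normal form coefficients compatible with
  multiplication.\<close>

lemma word_scalar_append:
  "word_scalar (u @ w) = word_scalar u * word_scalar w * B (count_list u) (count_list w)"
proof (induction u)
  case (Cons i u)
  have *: "B (count_list (i # u)) (count_list w) = B (count_list [i]) (count_list w) * B (count_list u) (count_list w)"
    using count_list_append_fun[of "[i]" u] by (simp only: B_add_left append.simps)
  have "word_scalar ((i # u) @ w) = B (count_list [i]) (count_list (u @ w)) * word_scalar (u @ w)"
    by simp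
  also have "\<dots> = word_scalar (i # u) * word_scalar w * B (count_list (i # u)) (count_list w)"
    unfolding Cons * count_list_append_fun B_add_right by simp
  finally show ?case .
next
  case Nil
  have "count_list ([] :: nat list) = (\<lambda>i. 0)" by auto
  then show ?case by simp
qed

abbreviation word_exponent :: "nat list \<Rightarrow> nat \<Rightarrow> nat"
  where "word_exponent w \<equiv> restrict (count_list w) {1..n}"

text \<open>The coefficient at \<open>v\<close> after sorting every word of \<open>p\<close>. It is
  defined by a closed formula on words instead of a rewriting process, so linearity is immediate and
  no confluence has to be established.\<close>

definition nf :: "'k words \<Rightarrow> (nat \<Rightarrow> nat) \<Rightarrow> 'k" where
  "nf p v = (\<Sum>w\<in>Poly_Mapping.keys p. Poly_Mapping.lookup p w *
     (if word_exponent (letters w) = v then word_scalar (letters w) else 0))"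

lemma nf_zero [simp]: "nf 0 v = 0"
  by (simp add: nf_def)

lemma nf_add: "nf (p + r) v = nf p v + nf r v"
  unfolding nf_def by (rule setsum_keys_plus_distrib) (auto simp: algebra_simps)

lemma nf_single: "nf (Poly_Mapping.single w c) v =
    c * (if word_exponent (letters w) = v then word_scalar (letters w) else 0)"
  by (simp add: nf_def)

lemma nf_sum: "nf (sum f S) v = (\<Sum>x\<in>S. nf (f x) v)"
  by (induction S rule: infinite_finite_induct) (auto simp: nf_add)

lemma poly_mapping_decompose:
  "p = (\<Sum>w\<in>Poly_Mapping.keys p. Poly_Mapping.single w (Poly_Mapping.lookup p w))"
  by (rule poly_mapping_eqI)
    (auto simp: lookup_sum lookup_single when_def in_keys_iff sum.If_cases Int_def
      intro: sum.neutral)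

lemma nf_smult: "nf (Poly_Mapping.single 0 c * p) v = c * nf p v"
proof -
  have "Poly_Mapping.single 0 c * p =
      (\<Sum>w\<in>Poly_Mapping.keys p. Poly_Mapping.single w (c * Poly_Mapping.lookup p w))"
    by (subst poly_mapping_decompose) (simp add: sum_distrib_left mult_single)
  then show ?thesis
    by (simp add: nf_sum nf_single sum_distrib_left mult.assoc nf_def[of p])
qed

lemma nf_uminus: "nf (- p) v = - nf p v"
  using nf_add[of p "- p" v] by (simp add: eq_neg_iff_add_eq_0 add.commute)

lemma extensional_exponents: "v \<in> exponents n a \<Longrightarrow> v \<in> extensional {1..n}"
  by (auto simp: exponents_def PiE_def)

text \<open>Exponents add under concatenation, and by \<open>word_scalar_append\<close> the
  additional factor depends on a word of \<open>p\<close> through its exponent alone, hence is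
  constant on the words that contribute. So a coefficient of the product is a scalar times one
  single coefficient of \<open>p\<close>.\<close>

lemma nf_single_mult:
  assumes v: "v \<in> extensional {1..n}"
  shows "nf (Poly_Mapping.single u c * p) v =
    (if \<forall>i\<in>{1..n}. count_list (letters u) i \<le> v i
     then c * word_scalar (letters u) *
       B (count_list (letters u)) (\<lambda>i. v i - count_list (letters u) i) *
       nf p (\<lambda>i\<in>{1..n}. v i - count_list (letters u) i) else 0)"
proof -
  let ?u = "count_list (letters u)" and ?v = "\<lambda>i\<in>{1..n}. v i - count_list (letters u) i"
  have 1: "nf (Poly_Mapping.single u c * p) v = (\<Sum>w\<in>Poly_Mapping.keys p. c * Poly_Mapping.lookup p w *
     (if word_exponent (letters u @ letters w) = v then word_scalar (letters u @ letters w) else 0))"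
  proof -
    have "Poly_Mapping.single u c * p =
        (\<Sum>w\<in>Poly_Mapping.keys p. Poly_Mapping.single (u + w) (c * Poly_Mapping.lookup p w))"
      by (subst poly_mapping_decompose[of p], simp only: sum_distrib_left mult_single)
    then show ?thesis by (simp only: nf_sum nf_single letters_plus)
  qed
  have 2: "word_exponent (letters u @ letters w) = v \<longleftrightarrow>
      (\<forall>i\<in>{1..n}. ?u i \<le> v i) \<and> word_exponent (letters w) = ?v" for w
  proof -
    have "word_exponent (letters u @ letters w) = v \<longleftrightarrow> (\<forall>i\<in>{1..n}. ?u i + count_list (letters w) i = v i)"
      using v by (auto simp: fun_eq_iff restrict_def extensional_def)
    also have "\<dots> \<longleftrightarrow> (\<forall>i\<in>{1..n}. ?u i \<le> v i) \<and> (\<forall>i\<in>{1..n}. count_list (letters w) i = v i - ?u i)"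
      by (auto; fastforce)
    also have "\<dots> \<longleftrightarrow> (\<forall>i\<in>{1..n}. ?u i \<le> v i) \<and> word_exponent (letters w) = ?v"
      by (auto simp: fun_eq_iff restrict_def; metis)
    finally show ?thesis .
  qed
  have 3: "B ?u (count_list (letters w)) = B ?u (\<lambda>i. v i - ?u i)" if "word_exponent (letters w) = ?v" for w
    by (rule B_cong[OF refl restrict_eqD[OF that]])
  show ?thesis
  proof (cases "\<forall>i\<in>{1..n}. ?u i \<le> v i")
    case True
    have "c * Poly_Mapping.lookup p w *
        (if (\<forall>i\<in>{1..n}. ?u i \<le> v i) \<and> word_exponent (letters w) = ?v then word_scalar (letters u @ letters w) else 0) =
      c * word_scalar (letters u) * B ?u (\<lambda>i. v i - ?u i) *
        (Poly_Mapping.lookup p w * (if word_exponent (letters w) = ?v then word_scalar (letters w) else 0))" for w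
    proof (cases "word_exponent (letters w) = ?v")
      case w: True
      then show ?thesis using True unfolding word_scalar_append 3[OF w] by simp
    qed simp
    then show ?thesis unfolding 1 2 nf_def[of p] sum_distrib_left if_P[OF True] by (intro sum.cong refl)
  next
    case False
    show ?thesis
      unfolding 1 2 by (simp only: False simp_thms if_False mult_zero_right sum.neutral_const)
  qed
qed

lemma nf_mult_single:
  assumes v: "v \<in> extensional {1..n}"
  shows "nf (p * Poly_Mapping.single u c) v =
    (if \<forall>i\<in>{1..n}. count_list (letters u) i \<le> v i
     then c * word_scalar (letters u) *
       B (\<lambda>i. v i - count_list (letters u) i) (count_list (letters u)) *
       nf p (\<lambda>i\<in>{1..n}. v i - count_list (letters u) i) else 0)"
proof -
  let ?u = "count_list (letters u)" and ?v = "\<lambda>i\<in>{1..n}. v i - count_list (letters u) i"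
  have 1: "nf (p * Poly_Mapping.single u c) v = (\<Sum>w\<in>Poly_Mapping.keys p. c * Poly_Mapping.lookup p w *
     (if word_exponent (letters w @ letters u) = v then word_scalar (letters w @ letters u) else 0))"
  proof -
    have "p * Poly_Mapping.single u c =
        (\<Sum>w\<in>Poly_Mapping.keys p. Poly_Mapping.single (w + u) (Poly_Mapping.lookup p w * c))"
      by (subst poly_mapping_decompose[of p], simp only: sum_distrib_right mult_single)
    then show ?thesis by (simp only: nf_sum nf_single letters_plus mult.commute[of c])
  qed
  have 2: "word_exponent (letters w @ letters u) = v \<longleftrightarrow>
      (\<forall>i\<in>{1..n}. ?u i \<le> v i) \<and> word_exponent (letters w) = ?v" for w
  proof -
    have "word_exponent (letters w @ letters u) = v \<longleftrightarrow> (\<forall>i\<in>{1..n}. count_list (letters w) i + ?u i = v i)"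
      using v by (auto simp: fun_eq_iff restrict_def extensional_def)
    also have "\<dots> \<longleftrightarrow> (\<forall>i\<in>{1..n}. ?u i \<le> v i) \<and> (\<forall>i\<in>{1..n}. count_list (letters w) i = v i - ?u i)"
      by (auto; fastforce)
    also have "\<dots> \<longleftrightarrow> (\<forall>i\<in>{1..n}. ?u i \<le> v i) \<and> word_exponent (letters w) = ?v"
      by (auto simp: fun_eq_iff restrict_def; metis)
    finally show ?thesis .
  qed
  have 3: "B (count_list (letters w)) ?u = B (\<lambda>i. v i - ?u i) ?u" if "word_exponent (letters w) = ?v" for w
    by (rule B_cong[OF restrict_eqD[OF that] refl])
  show ?thesis
  proof (cases "\<forall>i\<in>{1..n}. ?u i \<le> v i")
    case True
    have "c * Poly_Mapping.lookup p w *
        (if (\<forall>i\<in>{1..n}. ?u i \<le> v i) \<and> word_exponent (letters w) = ?v then word_scalar (letters w @ letters u) else 0) =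
      c * word_scalar (letters u) * B (\<lambda>i. v i - ?u i) ?u *
        (Poly_Mapping.lookup p w * (if word_exponent (letters w) = ?v then word_scalar (letters w) else 0))" for w
    proof (cases "word_exponent (letters w) = ?v")
      case w: True
      then show ?thesis using True unfolding word_scalar_append 3[OF w] by simp
    qed simp
    then show ?thesis unfolding 1 2 nf_def[of p] sum_distrib_left if_P[OF True] by (intro sum.cong refl)
  next
    case False
    show ?thesis
      unfolding 1 2 by (simp only: False simp_thms if_False mult_zero_right sum.neutral_const)
  qed
qed

lemma sub_in_exponents:
  "v \<in> exponents n a \<Longrightarrow> (\<lambda>i\<in>{1..n}. v i - u i) \<in> exponents n a"
  by (force simp: exponents_def PiE_iff)

section \<open>The defining ideal\<close>

abbreviation "FA \<equiv> free_algebra n :: ('k, 'k words) module"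
abbreviation "I \<equiv> qci_ideal n q a"

lemma FA_simps:
  "carrier FA = {p. \<forall>w\<in>Poly_Mapping.keys p. set (letters w) \<subseteq> {1..n}}"
  "x \<otimes>\<^bsub>FA\<^esub> y = x * y" "\<one>\<^bsub>FA\<^esub> = 1" "\<zero>\<^bsub>FA\<^esub> = 0" "x \<oplus>\<^bsub>FA\<^esub> y = x + y"
  "c \<odot>\<^bsub>FA\<^esub> x = Poly_Mapping.single 0 c * x"
  by (simp_all add: free_algebra_def mult_map_scale_conv_mult)

lemma FA_closed:
  "x \<in> carrier FA \<Longrightarrow> y \<in> carrier FA \<Longrightarrow> x + y \<in> carrier FA"
  "x \<in> carrier FA \<Longrightarrow> y \<in> carrier FA \<Longrightarrow> x * y \<in> carrier FA"
  "x \<in> carrier FA \<Longrightarrow> y \<in> carrier FA \<Longrightarrow> x - y \<in> carrier FA"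
  "x \<in> carrier FA \<Longrightarrow> - x \<in> carrier FA"
  "0 \<in> carrier FA" "1 \<in> carrier FA"
proof -
  show "x \<in> carrier FA \<Longrightarrow> y \<in> carrier FA \<Longrightarrow> x + y \<in> carrier FA"
    using Poly_Mapping.keys_add[of x y] unfolding FA_simps by blast
  show "x \<in> carrier FA \<Longrightarrow> y \<in> carrier FA \<Longrightarrow> x - y \<in> carrier FA"
    using Poly_Mapping.keys_diff[of x y] unfolding FA_simps by blast
  show "x \<in> carrier FA \<Longrightarrow> - x \<in> carrier FA"
    unfolding FA_simps by simp
  show "0 \<in> carrier FA" "1 \<in> carrier FA"
    unfolding FA_simps by (simp_all add: zero_free_monoid_def)
  assume xy: "x \<in> carrier FA" "y \<in> carrier FA"
  have "set (letters w) \<subseteq> {1..n}" if w: "w \<in> Poly_Mapping.keys (x * y)" for w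
  proof -
    obtain u v where "u \<in> Poly_Mapping.keys x" "v \<in> Poly_Mapping.keys y" "w = u + v"
      using keys_mult[of x y] w by blast
    then show ?thesis using xy unfolding FA_simps by (simp add: letters_plus)
  qed
  then show "x * y \<in> carrier FA" unfolding FA_simps by blast
qed

lemma single_closed: "set (letters w) \<subseteq> {1..n} \<Longrightarrow> Poly_Mapping.single w c \<in> carrier FA"
  by (simp add: FA_simps)

lemma const_closed: "Poly_Mapping.single 0 c \<in> carrier FA"
  by (simp add: single_closed zero_free_monoid_def)

lemma FA_sum_closed: "(\<And>x. x \<in> S \<Longrightarrow> f x \<in> carrier FA) \<Longrightarrow> sum f S \<in> carrier FA"
  by (induction S rule: infinite_finite_induct) (auto simp: FA_closed)

lemma const_commute: "Poly_Mapping.single 0 c * p = p * Poly_Mapping.single 0 c" for p :: "'k words"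
  by (subst (1 2) poly_mapping_decompose[of p])
    (simp add: sum_distrib_left sum_distrib_right mult_single mult.commute)

lemma const_mult: "Poly_Mapping.single 0 (c * d) = Poly_Mapping.single 0 c * (Poly_Mapping.single 0 d :: 'k words)"
  by (simp add: mult_single)

lemma abelian_group_FA: "abelian_group FA"
proof (rule abelian_groupI)
  show "\<exists>y\<in>carrier FA. y \<oplus>\<^bsub>FA\<^esub> x = \<zero>\<^bsub>FA\<^esub>" if "x \<in> carrier FA" for x
    using that by (intro bexI[of _ "- x"]) (auto simp: FA_simps(2-) FA_closed)
qed (simp_all add: FA_simps(2-) FA_closed ac_simps)

lemma ring_FA: "ring FA"
  by (rule ringI[OF abelian_group_FA monoidI])
    (simp_all add: FA_simps(2-) FA_closed algebra_simps)

lemma vspace_FA: "vspace FA"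
  unfolding vspace_def
  by (rule moduleI[OF cring_ground abelian_group_FA])
    (simp_all add: FA_simps(2-) FA_closed const_closed distrib_left distrib_right single_add const_mult mult.assoc)

lemma FA_minus: "x \<in> carrier FA \<Longrightarrow> \<ominus>\<^bsub>FA\<^esub> x = - x"
  using abelian_group.minus_equality[OF abelian_group_FA, of "- x" x]
  by (simp add: FA_simps(2-) FA_closed)

lemma free_var_closed: "i \<in> {1..n} \<Longrightarrow> free_var i \<in> carrier FA"
  by (simp add: free_var_def single_closed)

lemma free_var_power: "free_var i ^ m = Poly_Mapping.single (Word (replicate m i)) (1 :: 'k)"
  by (induction m) (auto simp: free_var_def mult_single plus_free_monoid_def zero_free_monoid_def
      simp flip: single_one)

definition relators :: "'k words set" where
  "relators = {free_var i ^ a i |i. i \<in> {1..n}} \<union>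
     {free_var i * free_var j + Poly_Mapping.map ((*) (q i j)) (free_var j * free_var i) |i j.
        i \<in> {1..n} \<and> j \<in> {1..n}}"

lemma relators_closed: "relators \<subseteq> carrier FA"
  by (auto simp: relators_def free_var_power mult_map_scale_conv_mult
      intro!: FA_closed const_closed single_closed free_var_closed)

lemma I_eq: "I = genideal FA relators"
  by (simp add: qci_ideal_def relators_def)

lemma ideal_I: "ideal I FA"
  unfolding I_eq by (rule ring.genideal_ideal[OF ring_FA relators_closed])

lemma relators_in_I: "relators \<subseteq> I"
  unfolding I_eq by (rule ring.genideal_self[OF ring_FA relators_closed])

lemma I_closed:
  "x \<in> I \<Longrightarrow> y \<in> I \<Longrightarrow> x + y \<in> I" "x \<in> I \<Longrightarrow> - x \<in> I" "0 \<in> I" "x \<in> I \<Longrightarrow> x \<in> carrier FA"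
  "x \<in> I \<Longrightarrow> y \<in> carrier FA \<Longrightarrow> x * y \<in> I" "x \<in> I \<Longrightarrow> y \<in> carrier FA \<Longrightarrow> y * x \<in> I"
proof -
  interpret ideal I FA by (rule ideal_I)
  show "x \<in> I \<Longrightarrow> x \<in> carrier FA" by (rule a_Hcarr)
  show "x \<in> I \<Longrightarrow> - x \<in> I"
    using I_l_closed[of x "- 1"] FA_closed(4)[OF FA_closed(6)] by (simp add: FA_simps(2-))
  show "x \<in> I \<Longrightarrow> y \<in> I \<Longrightarrow> x + y \<in> I" using additive_subgroup.a_closed[OF additive_subgroup_axioms, of x y] by (simp add: FA_simps(2-))
  show "0 \<in> I" using additive_subgroup.zero_closed[OF additive_subgroup_axioms] by (simp add: FA_simps(2-))
  show "x \<in> I \<Longrightarrow> y \<in> carrier FA \<Longrightarrow> x * y \<in> I" using I_r_closed[of x y] by (simp add: FA_simps(2-))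
  show "x \<in> I \<Longrightarrow> y \<in> carrier FA \<Longrightarrow> y * x \<in> I" using I_l_closed[of x y] by (simp add: FA_simps(2-))
qed

lemma I_diff_trans: "x - y \<in> I \<Longrightarrow> y - z \<in> I \<Longrightarrow> x - z \<in> I"
  using I_closed(1)[of "x - y" "y - z"] by simp

lemma I_sum: "(\<And>x. x \<in> S \<Longrightarrow> f x \<in> I) \<Longrightarrow> sum f S \<in> I"
  by (induction S rule: infinite_finite_induct) (auto simp: I_closed)

text \<open>Coefficients of a product at \<open>v\<close> are combinations of coefficients of
  \<open>p\<close> at exponents \<open>v - u\<close>, and these are again exponents of basis
  monomials. Hence the common kernel is stable under multiplication from both sides.\<close>

lemma ideal_kernel_nf: "ideal {p \<in> carrier FA. \<forall>v\<in>exponents n a. nf p v = 0} FA"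
proof (rule idealI[OF ring_FA])
  let ?K = "{p \<in> carrier FA. \<forall>v\<in>exponents n a. nf p v = 0}"
  interpret FA: abelian_group FA by (rule abelian_group_FA)
  show "subgroup ?K (add_monoid FA)"
    by (rule FA.add.subgroupI)
      (auto simp: FA_simps(2-) FA_closed nf_add nf_uminus FA_minus
        intro!: exI[of _ 0])
  fix p x assume p: "p \<in> ?K" and x: "x \<in> carrier FA"
  have "nf (x * p) v = 0" "nf (p * x) v = 0" if v: "v \<in> exponents n a" for v
  proof -
    have "nf (\<Sum>w\<in>Poly_Mapping.keys x. Poly_Mapping.single w (Poly_Mapping.lookup x w) * p) v = 0"
         "nf (\<Sum>w\<in>Poly_Mapping.keys x. p * Poly_Mapping.single w (Poly_Mapping.lookup x w)) v = 0"
      using v p sub_in_exponents[OF v] extensional_exponents[OF v]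
      by (simp_all add: nf_sum nf_single_mult nf_mult_single sum.neutral)
    then show "nf (x * p) v = 0" "nf (p * x) v = 0"
      by (subst poly_mapping_decompose[of x], simp only: sum_distrib_left sum_distrib_right)+
  qed
  then show "x \<otimes>\<^bsub>FA\<^esub> p \<in> ?K" "p \<otimes>\<^bsub>FA\<^esub> x \<in> ?K"
    using p x by (auto simp: FA_simps(2-) FA_closed)
qed

text \<open>By minimality of the generated ideal only the relators matter. A power
  \<open>free_var i ^ a i\<close> has an exponent outside the basis range, and in a commutation
  relator both words have the same exponent and cancelling scalars. Linear independence of the
  monomials rests on this.\<close>

lemma nf_ideal:
  assumes "p \<in> I" "v \<in> exponents n a"
  shows "nf p v = 0"
proof -
  have "nf r v = 0" if r: "r \<in> relators" and v: "v \<in> exponents n a" for r v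
  proof -
    from r consider i where "i \<in> {1..n}" "r = free_var i ^ a i"
      | i j where "i \<in> {1..n}" "j \<in> {1..n}"
        "r = free_var i * free_var j + Poly_Mapping.map ((*) (q i j)) (free_var j * free_var i)"
      by (auto simp: relators_def)
    then show ?thesis
    proof cases
      case 1
      have "v i \<in> {0..a i - 1}" using v 1(1) unfolding exponents_def by (rule PiE_mem)
      then have "v i \<noteq> a i" using a_ge[OF 1(1)] by simp
      moreover have "count_list (replicate (a i) i) i = a i" by (simp add: count_list_replicate)
      ultimately have "word_exponent (replicate (a i) i) \<noteq> v" using 1(1) by (metis restrict_apply')
      then show ?thesis by (simp add: 1 free_var_power nf_single)
    next
      case 2
      have e: "count_list [i, j] = count_list [j, i]" by auto
      \<comment> \<open>The three cases: \<open>1 - q i j * q j i = 0\<close> for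
        \<open>i < j\<close>, \<open>- q i j + q i j = 0\<close> for \<open>j < i\<close>, and
        \<open>1 + q i i = 0\<close> for \<open>i = j\<close>.\<close>
      have "word_scalar [i, j] + q i j * word_scalar [j, i] = 0"
      proof -
        have z: "count_list ([] :: nat list) = (\<lambda>i. 0)" by auto
        show ?thesis
          using B_units[of i j] B_units[of j i] 2(1,2) q_inv[of i j] q_diag[of i]
          by (cases i j rule: linorder_cases) (simp_all add: z del: count_list.simps)
      qed
      moreover have "nf r v = (if word_exponent [i, j] = v then word_scalar [i, j] + q i j * word_scalar [j, i] else 0)"
        using e by (simp add: 2 mult_map_scale_conv_mult nf_add nf_smult free_var_def mult_single nf_single
          letters_plus del: word_scalar.simps count_list.simps)
      ultimately show ?thesis by simp
    qed
  qed
  then have "relators \<subseteq> {p \<in> carrier FA. \<forall>v\<in>exponents n a. nf p v = 0}"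
    using relators_closed by auto
  then have "I \<subseteq> {p \<in> carrier FA. \<forall>v\<in>exponents n a. nf p v = 0}"
    unfolding I_eq by (rule ring.genideal_minimal[OF ring_FA ideal_kernel_nf])
  then show ?thesis using assms by auto
qed

section \<open>Reduction to ordered monomials\<close>

declare upt_Suc [simp del]

text \<open>Formed over an arbitrary list of letters so that the ordered word can be cut before and
  after the block of a given letter.\<close>

definition blocks :: "(nat \<Rightarrow> nat) \<Rightarrow> nat list \<Rightarrow> nat list"
  where "blocks v l = concat (map (\<lambda>j. replicate (v j) j) l)"

abbreviation ordered_word :: "(nat \<Rightarrow> nat) \<Rightarrow> nat list"
  where "ordered_word v \<equiv> blocks v [1..<Suc n]"

lemma blocks_cong: "(\<And>j. j \<in> set l \<Longrightarrow> u j = v j) \<Longrightarrow> blocks u l = blocks v l"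
  by (simp add: blocks_def cong: map_cong)

lemma set_blocks: "set (blocks v l) \<subseteq> set l"
  by (auto simp: blocks_def)

lemma blocks_append: "blocks v (l @ l') = blocks v l @ blocks v l'"
  by (simp add: blocks_def)

lemma prod_list_blocks:
  "distinct l \<Longrightarrow> prod_list (map f (blocks v l)) = (\<Prod>j\<in>set l. f j ^ v j :: 'k)"
  by (induction l) (auto simp: blocks_def prod_list_replicate)

lemma ordered_word_split:
  assumes "i \<in> {1..n}"
  shows "ordered_word v = blocks v [1..<i] @ replicate (v i) i @ blocks v [Suc i..<Suc n]"
proof -
  have "[1..<Suc n] = [1..<i] @ [i] @ [Suc i..<Suc n]"
    using assms upt_add_eq_append[of 1 i "Suc n - i"] by (simp add: upt_conv_Cons)
  then show ?thesis by (simp add: blocks_append) (simp add: blocks_def)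
qed

lemma single_word_mult:
  "Poly_Mapping.single (Word u) c * Poly_Mapping.single (Word w) d = Poly_Mapping.single (Word (u @ w)) (c * d :: 'k)"
  by (simp add: mult_single plus_free_monoid_def)

lemma word_closed: "set w \<subseteq> {1..n} \<Longrightarrow> Poly_Mapping.single (Word w) c \<in> carrier FA"
  by (simp add: single_closed)

lemma I_word_sandwich:
  assumes "Poly_Mapping.single (Word w) c - Poly_Mapping.single (Word w') c' \<in> I"
    and "set u \<subseteq> {1..n}" "set v \<subseteq> {1..n}"
  shows "Poly_Mapping.single (Word (u @ w @ v)) (d * c) - Poly_Mapping.single (Word (u @ w' @ v)) (d * c') \<in> I"
proof -
  have "Poly_Mapping.single (Word u) d *
      (Poly_Mapping.single (Word w) c - Poly_Mapping.single (Word w') c') * Poly_Mapping.single (Word v) 1 \<in> I"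
    using assms by (intro I_closed word_closed)
  then show ?thesis
    by (simp add: left_diff_distrib right_diff_distrib single_word_mult)
qed

lemma swap_letters:
  assumes "i \<in> {1..n}" "j \<in> {1..n}"
  shows "Poly_Mapping.single (Word [i, j]) 1 - Poly_Mapping.single (Word [j, i]) (- q i j) \<in> I"
proof -
  have "free_var i * free_var j + Poly_Mapping.map ((*) (q i j)) (free_var j * free_var i) \<in> I"
    using relators_in_I assms by (auto simp: relators_def)
  then show ?thesis
    by (simp add: free_var_def single_word_mult mult_map_scale_conv_mult zero_free_monoid_def single_uminus)
qed

lemma move_letter:
  assumes "i \<in> {1..n}" "set w \<subseteq> {1..n}"
  shows "Poly_Mapping.single (Word (i # w)) 1 -
    Poly_Mapping.single (Word (w @ [i])) (prod_list (map (\<lambda>j. - q i j) w)) \<in> I"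
  using assms(2)
proof (induction w)
  case Nil then show ?case by (simp add: I_closed)
next
  case (Cons j w)
  have "Poly_Mapping.single (Word (i # j # w)) 1 - Poly_Mapping.single (Word (j # i # w)) (- q i j) \<in> I"
    using I_word_sandwich[OF swap_letters[of i j], of "[]" w 1] assms(1) Cons.prems by simp
  moreover have "Poly_Mapping.single (Word (j # i # w)) (- q i j) -
      Poly_Mapping.single (Word (j # w @ [i])) (- q i j * prod_list (map (\<lambda>j. - q i j) w)) \<in> I"
    using I_word_sandwich[OF Cons.IH, of "[j]" "[]" "- q i j"] Cons.prems by simp
  ultimately show ?case using I_diff_trans by fastforce
qed

text \<open>The letter passes exactly the blocks of smaller letters and then merges with its own
  block, so the total factor is the one computed in \<open>B_unit\<close>.\<close>

lemma insert_letter: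
  assumes i: "i \<in> {1..n}"
  shows "Poly_Mapping.single (Word (i # ordered_word v)) 1 -
    Poly_Mapping.single (Word (ordered_word (\<lambda>j. v j + count_list [i] j))) (B (count_list [i]) v) \<in> I"
proof -
  let ?v = "\<lambda>j. v j + count_list [i] j"
  let ?p = "blocks v [1..<i]" and ?s = "replicate (v i) i @ blocks v [Suc i..<Suc n]"
  have p: "set ?p \<subseteq> {1..n}" "set ?s \<subseteq> {1..n}"
    using i set_blocks[of v "[1..<i]"] set_blocks[of v "[Suc i..<Suc n]"] by fastforce+
  have e: "blocks ?v [1..<i] = ?p" "blocks ?v [Suc i..<Suc n] = blocks v [Suc i..<Suc n]"
    by (rule blocks_cong; simp)+
  have "prod_list (map (\<lambda>j. - q i j) ?p) = B (count_list [i]) v"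
    unfolding B_unit[OF i] by (subst prod_list_blocks) auto
  then show ?thesis
    using I_word_sandwich[OF move_letter[OF i p(1)], of "[]" ?s 1] p(2) e
    unfolding ordered_word_split[OF i] by simp
qed

text \<open>Insertion sort modulo the ideal; each insertion contributes one factor in the recursion
  of \<open>word_scalar\<close>.\<close>

lemma reduce_word:
  "set w \<subseteq> {1..n} \<Longrightarrow> Poly_Mapping.single (Word w) 1 -
    Poly_Mapping.single (Word (ordered_word (count_list w))) (word_scalar w) \<in> I"
proof (induction w)
  case Nil
  have b: "blocks (\<lambda>j. 0) l = []" for l by (simp add: blocks_def)
  show ?case by (simp add: b I_closed)
next
  case (Cons i w)
  have "Poly_Mapping.single (Word (i # w)) 1 -
      Poly_Mapping.single (Word (i # ordered_word (count_list w))) (word_scalar w) \<in> I"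
    using I_word_sandwich[OF Cons.IH, of "[i]" "[]" 1] Cons.prems by simp
  moreover have "count_list (i # w) = (\<lambda>j. count_list w j + count_list [i] j)" by auto
  then have "Poly_Mapping.single (Word (i # ordered_word (count_list w))) (word_scalar w) -
      Poly_Mapping.single (Word (ordered_word (count_list (i # w)))) (word_scalar (i # w)) \<in> I"
    using I_word_sandwich[OF insert_letter[of i "count_list w"], of "[]" "[]" "word_scalar w"] Cons.prems
    by (simp add: mult.commute)
  ultimately show ?case by (rule I_diff_trans)
qed

text \<open>The block of the letter \<open>i\<close> is long enough to contain the word of the
  relator \<open>free_var i ^ a i\<close>.\<close>

lemma ordered_word_in_I:
  assumes i: "i \<in> {1..n}" and "v i \<ge> a i"
  shows "Poly_Mapping.single (Word (ordered_word v)) c \<in> I"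
proof -
  have "Poly_Mapping.single (Word (replicate (a i) i)) 1 \<in> I"
    using relators_in_I i by (auto simp: relators_def free_var_power[symmetric])
  then have "Poly_Mapping.single (Word (blocks v [1..<i])) c * Poly_Mapping.single (Word (replicate (a i) i)) 1 *
      Poly_Mapping.single (Word (replicate (v i - a i) i @ blocks v [Suc i..<Suc n])) 1 \<in> I"
    using i set_blocks[of v "[1..<i]"] set_blocks[of v "[Suc i..<Suc n]"]
    by (intro I_closed word_closed) fastforce+
  moreover have "replicate (v i) i = replicate (a i) i @ replicate (v i - a i) i"
    using assms(2) by (simp flip: replicate_add)
  ultimately show ?thesis
    unfolding ordered_word_split[OF i] by (simp add: single_word_mult)
qed

lemma finite_exponents: "finite (exponents n a)"
  by (auto simp: exponents_def intro!: finite_PiE)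

definition normal_form :: "'k words \<Rightarrow> 'k words" where
  "normal_form p = (\<Sum>v\<in>exponents n a. Poly_Mapping.single (Word (ordered_word v)) (nf p v))"

lemma normal_form_sum: "normal_form (sum f S) = (\<Sum>x\<in>S. normal_form (f x))"
  by (induction S rule: infinite_finite_induct)
    (auto simp: normal_form_def nf_add single_add sum.distrib)

text \<open>The spanning half of the basis statement. The sorted word either has an admissible
  exponent and is then the normal form, or has a block that is too long and lies in the
  ideal.\<close>

lemma minus_normal_form_single:
  assumes w: "set w \<subseteq> {1..n}"
  shows "Poly_Mapping.single (Word w) c - normal_form (Poly_Mapping.single (Word w) c) \<in> I"
proof -
  let ?e = "word_exponent w"
  have 1: "Poly_Mapping.single (Word w) c -
      Poly_Mapping.single (Word (ordered_word (count_list w))) (c * word_scalar w) \<in> I"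
    using I_word_sandwich[OF reduce_word[OF w], of "[]" "[]" c] by simp
  have 2: "normal_form (Poly_Mapping.single (Word w) c) =
      (if ?e \<in> exponents n a then Poly_Mapping.single (Word (ordered_word ?e)) (c * word_scalar w) else 0)"
  proof -
    have "normal_form (Poly_Mapping.single (Word w) c) = (\<Sum>v\<in>exponents n a.
        if ?e = v then Poly_Mapping.single (Word (ordered_word v)) (c * word_scalar w) else 0)"
      unfolding normal_form_def nf_single by (rule sum.cong) auto
    then show ?thesis using finite_exponents by simp
  qed
  have e: "ordered_word ?e = ordered_word (count_list w)"
    by (rule blocks_cong) auto
  show ?thesis
  proof (cases "?e \<in> exponents n a")
    case True then show ?thesis using 1 2 e by simp
  next
    case False
    then obtain i where "i \<in> {1..n}" "\<not> count_list w i \<le> a i - 1"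
      by (auto simp: exponents_def PiE_iff)
    then have "Poly_Mapping.single (Word (ordered_word (count_list w))) (c * word_scalar w) \<in> I"
      by (intro ordered_word_in_I[of i]) auto
    from I_closed(1)[OF 1 this] show ?thesis using 2 False by simp
  qed
qed

lemma minus_normal_form:
  assumes p: "p \<in> carrier FA"
  shows "p - normal_form p \<in> I"
proof -
  let ?f = "\<lambda>w. Poly_Mapping.single w (Poly_Mapping.lookup p w)"
  have "?f w - normal_form (?f w) \<in> I" if "w \<in> Poly_Mapping.keys p" for w
    using minus_normal_form_single[of "letters w"] that p by (simp add: FA_simps)
  then have "(\<Sum>w\<in>Poly_Mapping.keys p. ?f w - normal_form (?f w)) \<in> I"
    by (rule I_sum)
  moreover have "(\<Sum>w\<in>Poly_Mapping.keys p. ?f w - normal_form (?f w)) = p - normal_form p"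
    by (simp add: sum_subtractf poly_mapping_decompose[of p, symmetric] flip: normal_form_sum)
  ultimately show ?thesis by simp
qed

lemma count_blocks: "distinct l \<Longrightarrow> count_list (blocks v l) j = (if j \<in> set l then v j else 0)"
proof (induction l)
  case (Cons i l)
  then show ?case by (auto simp: blocks_def count_list_replicate)
qed (simp add: blocks_def)

text \<open>Putting a letter in front of letters that are not smaller costs nothing, as
  \<open>B_unit\<close> involves smaller letters only. Hence ordered words have coefficient 1 at
  their own exponent.\<close>

lemma word_scalar_sorted: "sorted w \<Longrightarrow> set w \<subseteq> {1..n} \<Longrightarrow> word_scalar w = 1"
proof (induction w)
  case (Cons i w)
  have "count_list w j = 0" if "j < i" for j
    using Cons.prems(1) that by (auto simp: count_list_0_iff)
  then have "B (count_list [i]) (count_list w) = 1"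
    using Cons.prems(2) by (subst B_unit) (auto intro: prod.neutral)
  then show ?case using Cons by simp
qed simp

lemma sorted_blocks: "sorted_wrt (<) l \<Longrightarrow> sorted (blocks v l)"
  by (induction l) (auto simp: blocks_def sorted_append)

lemma ordered_word_scalar: "word_scalar (ordered_word v) = 1"
  using set_blocks[of v "[1..<Suc n]"] by (intro word_scalar_sorted sorted_blocks) auto

lemma ordered_word_count: "i \<in> {1..n} \<Longrightarrow> count_list (ordered_word v) i = v i"
  by (subst count_blocks) auto

lemma ordered_word_exponent: "v \<in> extensional {1..n} \<Longrightarrow> word_exponent (ordered_word v) = v"
  using ordered_word_count by (auto simp: fun_eq_iff restrict_def extensional_def)

end

context quantum_ci begin

declare One_nat_def [simp del]

section \<open>The monomial basis\<close>

abbreviation "A \<equiv> qci n q a"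
abbreviation "V \<equiv> exponents n a"
abbreviation "X \<equiv> qci_monom n q a"
abbreviation "X_dual \<equiv> dual_monom n q a"
abbreviation cls :: "'k words \<Rightarrow> 'k words set" where "cls p \<equiv> I +>\<^bsub>FA\<^esub> p"

sublocale Q: quotient_vspace FA I
proof -
  interpret vspace FA by (rule vspace_FA)
  have "submodule I ground FA"
    by (rule submoduleI)
      (auto simp: FA_simps(2-) FA_minus I_closed const_closed)
  then show "quotient_vspace FA I"
    by (simp add: quotient_vspace_def quotient_vspace_axioms_def vspace_FA)
qed

lemma A_eq: "A = quotient_module FA I"
  by (simp add: qci_def)

lemma vspace_A: "vspace A"
  unfolding A_eq by (rule Q.vspace_quotient)

sublocale A: vspace A
  by (rule vspace_A)

lemma carrier_A: "carrier A = cls ` carrier FA"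
  unfolding A_eq by (rule carrier_quotient_module)

lemma k_linear_cls: "k_linear FA A cls"
  unfolding A_eq by (rule Q.k_linear_coset)

lemma cls_closed: "p \<in> carrier FA \<Longrightarrow> cls p \<in> carrier A"
  by (simp add: carrier_A)

lemma cls_add: "p \<in> carrier FA \<Longrightarrow> r \<in> carrier FA \<Longrightarrow> cls (p + r) = cls p \<oplus>\<^bsub>A\<^esub> cls r"
  using k_linearD(2)[OF k_linear_cls, of p r] by (simp add: FA_simps(5))

lemma cls_smult: "p \<in> carrier FA \<Longrightarrow> cls (Poly_Mapping.single 0 c * p) = c \<odot>\<^bsub>A\<^esub> cls p"
  using k_linearD(3)[OF k_linear_cls, of p c] by (simp add: FA_simps(6))

lemma cls_mult: "p \<in> carrier FA \<Longrightarrow> r \<in> carrier FA \<Longrightarrow> cls p \<otimes>\<^bsub>A\<^esub> cls r = cls (p * r)"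
  using ideal.rcoset_mult_add[OF ideal_I, of p r]
  by (simp add: A_eq quotient_module_simps FA_simps(2))

lemma one_A: "\<one>\<^bsub>A\<^esub> = cls 1"
  by (simp add: A_eq quotient_module_simps FA_simps(3))

lemma zero_A: "\<zero>\<^bsub>A\<^esub> = cls 0"
  using Q.coset_zero by (simp add: A_eq FA_simps(4))

lemma cls_eq_iff:
  assumes "p \<in> carrier FA" "r \<in> carrier FA"
  shows "cls p = cls r \<longleftrightarrow> p - r \<in> I"
  using Q.coset_eq_iff[OF assms] assms by (simp add: FA_minus FA_simps(5))

lemma cls_sum:
  assumes "\<And>x. x \<in> S \<Longrightarrow> f x \<in> carrier FA"
  shows "cls (sum f S) = (\<Oplus>\<^bsub>A\<^esub>x\<in>S. cls (f x))"
  using assms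
proof (induction S rule: infinite_finite_induct)
  case (insert x S)
  then show ?case by (simp add: cls_add FA_sum_closed cls_closed Pi_iff)
qed (simp_all add: zero_A A.M.finsum_infinite)

lemma ring_A: "ring A"
proof (rule ringI[OF A.M.abelian_group_axioms monoidI])
qed (auto simp: carrier_A one_A cls_mult FA_closed algebra_simps simp flip: cls_add)

lemma k_algebra_A: "k_algebra A"
proof -
  have "Poly_Mapping.single 0 c * p * r = Poly_Mapping.single 0 c * (p * r)"
    "p * (Poly_Mapping.single 0 c * r) = Poly_Mapping.single 0 c * (p * r)" for c and p r :: "'k words"
    using const_commute[of c p] by (simp_all flip: mult.assoc)
  then show ?thesis
    unfolding k_algebra_def using ring_A A.module_axioms
    by (auto simp: carrier_A cls_mult FA_closed const_closed simp flip: cls_smult)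
qed

lemma ordered_word_closed: "Poly_Mapping.single (Word (ordered_word v)) c \<in> carrier FA"
  by (rule word_closed) (use set_blocks[of v "[1..<Suc n]"] in auto)

lemma X_eq: "X v = cls (Poly_Mapping.single (Word (ordered_word v)) 1)"
proof -
  interpret A: ring A by (rule ring_A)
  have pow: "qci_var n q a i [^]\<^bsub>A\<^esub> m = cls (Poly_Mapping.single (Word (replicate m i)) 1)"
    if "i \<in> {1..n}" for i m
  proof (induction m)
    case 0 show ?case by (simp add: one_A flip: zero_free_monoid_def)
  next
    case (Suc m)
    have "qci_var n q a i [^]\<^bsub>A\<^esub> Suc m = cls (Poly_Mapping.single (Word (replicate m i)) 1) \<otimes>\<^bsub>A\<^esub> cls (free_var i)"
      by (simp only: A.nat_pow_Suc Suc) (simp only: qci_var_def)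
    also have "\<dots> = cls (Poly_Mapping.single (Word (replicate m i)) 1 * free_var i)"
      using that by (intro cls_mult word_closed free_var_closed) auto
    also have "Poly_Mapping.single (Word (replicate m i)) 1 * free_var i = Poly_Mapping.single (Word (replicate (Suc m) i)) (1 :: 'k)"
      by (simp add: free_var_def single_word_mult replicate_append_same)
    finally show ?case .
  qed
  have "foldr (\<lambda>i y. (qci_var n q a i [^]\<^bsub>A\<^esub> v i) \<otimes>\<^bsub>A\<^esub> y) l \<one>\<^bsub>A\<^esub> =
      cls (Poly_Mapping.single (Word (blocks v l)) 1)" if "set l \<subseteq> {1..n}" for l
    using that
  proof (induction l)
    case Nil then show ?case by (simp add: one_A blocks_def flip: zero_free_monoid_def)
  next
    case (Cons i l)
    then have "foldr (\<lambda>i y. (qci_var n q a i [^]\<^bsub>A\<^esub> v i) \<otimes>\<^bsub>A\<^esub> y) (i # l) \<one>\<^bsub>A\<^esub> =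
      cls (Poly_Mapping.single (Word (replicate (v i) i)) 1) \<otimes>\<^bsub>A\<^esub> cls (Poly_Mapping.single (Word (blocks v l)) 1)"
      by (simp add: pow)
    also have "\<dots> = cls (Poly_Mapping.single (Word (blocks v (i # l))) 1)"
      using Cons.prems set_blocks[of v l]
      by (subst cls_mult) (auto intro!: word_closed simp: single_word_mult blocks_def)
    finally show ?case .
  qed
  moreover have "set [1..<Suc n] \<subseteq> {1..n}" by auto
  ultimately show ?thesis unfolding qci_monom_def by blast
qed

lemma X_closed: "X v \<in> carrier A"
  unfolding X_eq by (intro cls_closed ordered_word_closed)

lemma X_zero_exponent: "X (zero_exponent n) = \<one>\<^bsub>A\<^esub>"
proof -
  have "ordered_word (zero_exponent n) = ordered_word (\<lambda>i. 0)"
    by (rule blocks_cong) (auto simp: zero_exponent_def)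
  also have "\<dots> = []" by (simp add: blocks_def)
  finally show ?thesis by (simp add: X_eq one_A flip: zero_free_monoid_def)
qed

lemma X_eq_zero: "i \<in> {1..n} \<Longrightarrow> v i \<ge> a i \<Longrightarrow> X v = \<zero>\<^bsub>A\<^esub>"
  unfolding X_eq zero_A
  by (subst cls_eq_iff) (auto intro: ordered_word_in_I ordered_word_closed FA_closed)

lemma cls_single: "cls (Poly_Mapping.single (Word (ordered_word v)) c) = c \<odot>\<^bsub>A\<^esub> X v"
proof -
  have "Poly_Mapping.single (Word (ordered_word v)) c =
      Poly_Mapping.single 0 c * Poly_Mapping.single (Word (ordered_word v)) 1"
    by (simp add: mult_single)
  then show ?thesis
    unfolding X_eq by (simp only: cls_smult[OF ordered_word_closed])
qed

text \<open>Both factors are sorted and carry scalar 1, so sorting the concatenated word leaves just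
  the bracket. Exponents may exceed the basis range here; the monomial on the right is then
  zero.\<close>

lemma X_mult: "X u \<otimes>\<^bsub>A\<^esub> X v = B u v \<odot>\<^bsub>A\<^esub> X (\<lambda>i\<in>{1..n}. u i + v i)"
proof -
  let ?w = "ordered_word u @ ordered_word v" and ?s = "\<lambda>i\<in>{1..n}. u i + v i"
  have w: "set ?w \<subseteq> {1..n}"
    using set_blocks[of u "[1..<Suc n]"] set_blocks[of v "[1..<Suc n]"] by auto
  have "X u \<otimes>\<^bsub>A\<^esub> X v = cls (Poly_Mapping.single (Word ?w) 1)"
    unfolding X_eq by (subst cls_mult) (auto intro!: ordered_word_closed simp: single_word_mult)
  also have "\<dots> = cls (Poly_Mapping.single (Word (ordered_word (count_list ?w))) (word_scalar ?w))"
    by (subst cls_eq_iff[OF word_closed[OF w] ordered_word_closed]) (rule reduce_word[OF w])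
  also have "ordered_word (count_list ?w) = ordered_word ?s"
    using ordered_word_count by (intro blocks_cong) auto
  also have "word_scalar ?w = B u v"
    unfolding word_scalar_append ordered_word_scalar
    using ordered_word_count by (auto intro: B_cong)
  finally show ?thesis by (simp only: cls_single)
qed

text \<open>The functional that \<open>nf\<close> induces on the quotient. In contrast,
  \<open>dual_monom\<close> is a definite description, which can be evaluated only once coordinates
  are known to exist and to be unique; \<open>coord\<close> supplies both facts.\<close>

definition coord :: "(nat \<Rightarrow> nat) \<Rightarrow> 'k words set \<Rightarrow> 'k"
  where "coord v Y = nf (SOME p. p \<in> Y) v"

lemma k_linear_nf: "k_linear FA ground (\<lambda>p. nf p v)"
  by (rule k_linearI) (simp_all add: FA_simps(2-) nf_add nf_smult)

lemma coord_cls: "v \<in> V \<Longrightarrow> p \<in> carrier FA \<Longrightarrow> coord v (cls p) = nf p v"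
  unfolding coord_def
  by (rule Q.factor_some(1)[OF vspace_ground k_linear_nf]) (simp_all add: nf_ideal)

lemma k_linear_coord: "v \<in> V \<Longrightarrow> k_linear A ground (coord v)"
  unfolding coord_def A_eq
  by (rule Q.factor_some(2)[OF vspace_ground k_linear_nf]) (simp_all add: nf_ideal)

lemma coord_X: "u \<in> V \<Longrightarrow> v \<in> V \<Longrightarrow> coord v (X u) = (if u = v then 1 else 0)"
  by (simp add: X_eq coord_cls ordered_word_closed nf_single ordered_word_scalar
      ordered_word_exponent extensional_exponents)

lemma coord_expansion:
  assumes "Y \<in> carrier A"
  shows "Y = (\<Oplus>\<^bsub>A\<^esub>v\<in>V. coord v Y \<odot>\<^bsub>A\<^esub> X v)"
proof -
  from assms obtain p where p: "p \<in> carrier FA" "Y = cls p" by (auto simp: carrier_A)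
  have "normal_form p \<in> carrier FA"
    unfolding normal_form_def by (intro FA_sum_closed ordered_word_closed)
  then have "cls p = cls (normal_form p)"
    using p minus_normal_form by (simp add: cls_eq_iff)
  also have "\<dots> = (\<Oplus>\<^bsub>A\<^esub>v\<in>V. nf p v \<odot>\<^bsub>A\<^esub> X v)"
    unfolding normal_form_def by (subst cls_sum) (auto intro: ordered_word_closed simp: cls_single)
  also have "\<dots> = (\<Oplus>\<^bsub>A\<^esub>v\<in>V. coord v Y \<odot>\<^bsub>A\<^esub> X v)"
    using p by (intro A.M.finsum_cong') (auto simp: coord_cls X_closed A.smultD)
  finally show ?thesis using p by simp
qed

lemma coord_combination:
  assumes "v \<in> V"
  shows "coord v (\<Oplus>\<^bsub>A\<^esub>u\<in>V. c u \<odot>\<^bsub>A\<^esub> X u) = c v"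
proof -
  have "coord v (\<Oplus>\<^bsub>A\<^esub>u\<in>V. c u \<odot>\<^bsub>A\<^esub> X u) = (\<Sum>u\<in>V. c u * coord v (X u))"
    using k_linearD(3)[OF k_linear_coord[OF assms]] X_closed
    by (subst k_linear_finsum[OF vspace_A vspace_ground k_linear_coord[OF assms]])
      (auto simp: ground_finsum A.smultD)
  also have "\<dots> = (\<Sum>u\<in>V. if u = v then c u else 0)"
    using assms by (intro sum.cong) (auto simp: coord_X)
  finally show ?thesis using assms finite_exponents by simp
qed

lemma X_dual_eq_coord:
  assumes "v \<in> V" "Y \<in> carrier A"
  shows "X_dual v Y = coord v Y"
proof -
  have "(THE c. c \<in> extensional V \<and> Y = (\<Oplus>\<^bsub>A\<^esub>u\<in>V. c u \<odot>\<^bsub>A\<^esub> X u)) = (\<lambda>v\<in>V. coord v Y)"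
  proof (rule the_equality)
    have "(\<Oplus>\<^bsub>A\<^esub>u\<in>V. (\<lambda>v\<in>V. coord v Y) u \<odot>\<^bsub>A\<^esub> X u) = (\<Oplus>\<^bsub>A\<^esub>u\<in>V. coord u Y \<odot>\<^bsub>A\<^esub> X u)"
      by (rule A.M.finsum_cong') (auto simp: X_closed A.smultD)
    then show "(\<lambda>v\<in>V. coord v Y) \<in> extensional V \<and>
        Y = (\<Oplus>\<^bsub>A\<^esub>u\<in>V. (\<lambda>v\<in>V. coord v Y) u \<odot>\<^bsub>A\<^esub> X u)"
      using coord_expansion[OF assms(2)] by simp
    fix c assume c: "c \<in> extensional V \<and> Y = (\<Oplus>\<^bsub>A\<^esub>u\<in>V. c u \<odot>\<^bsub>A\<^esub> X u)"
    then have "coord v Y = c v" if "v \<in> V" for v using coord_combination[OF that, of c] by simp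
    then show "c = (\<lambda>v\<in>V. coord v Y)" using c by (auto simp: extensional_def restrict_def)
  qed
  then show ?thesis using assms by (simp add: dual_monom_def)
qed

lemma k_linear_X_dual: "v \<in> V \<Longrightarrow> k_linear A ground (X_dual v)"
  using k_linear_coord[of v] k_linearD[OF k_linear_coord[of v]]
  by (intro k_linearI) (simp_all add: X_dual_eq_coord A.smultD)

lemma X_dual_X: "u \<in> V \<Longrightarrow> v \<in> V \<Longrightarrow> X_dual v (X u) = (if u = v then 1 else 0)"
  by (simp add: X_dual_eq_coord X_closed coord_X)

lemma X_expansion:
  assumes "Y \<in> carrier A"
  shows "Y = (\<Oplus>\<^bsub>A\<^esub>v\<in>V. X_dual v Y \<odot>\<^bsub>A\<^esub> X v)"
proof -
  have "(\<Oplus>\<^bsub>A\<^esub>v\<in>V. X_dual v Y \<odot>\<^bsub>A\<^esub> X v) = (\<Oplus>\<^bsub>A\<^esub>v\<in>V. coord v Y \<odot>\<^bsub>A\<^esub> X v)"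
    using assms by (intro A.M.finsum_cong') (auto simp: X_dual_eq_coord X_closed A.smultD)
  then show ?thesis using coord_expansion[OF assms] by simp
qed

lemma finite_dimensional_A: "finite_dimensional A"
  unfolding finite_dimensional_def
proof (intro exI[of _ "X ` V"] conjI ballI)
  show "finite (X ` V)" using finite_exponents by simp
  show "X ` V \<subseteq> carrier A" using X_closed by auto
  fix Y assume Y: "Y \<in> carrier A"
  have inj: "inj_on X V"
    by (rule inj_onI) (metis coord_X zero_neq_one)
  \<comment> \<open>Finite dimensionality asks for coefficients indexed by vectors, so exponents are
    recovered from monomials by injectivity of \<open>X\<close>.\<close>
  have "(\<Oplus>\<^bsub>A\<^esub>b\<in>X ` V. X_dual (the_inv_into V X b) Y \<odot>\<^bsub>A\<^esub> b) =
      (\<Oplus>\<^bsub>A\<^esub>v\<in>V. X_dual (the_inv_into V X (X v)) Y \<odot>\<^bsub>A\<^esub> X v)"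
    by (rule A.M.finsum_reindex[OF _ inj]) (auto simp: X_closed A.smultD)
  also have "\<dots> = (\<Oplus>\<^bsub>A\<^esub>v\<in>V. X_dual v Y \<odot>\<^bsub>A\<^esub> X v)"
    by (rule A.M.finsum_cong') (auto simp: X_closed A.smultD the_inv_into_f_f[OF inj])
  also have "\<dots> = Y" by (rule X_expansion[OF Y, symmetric])
  finally show "\<exists>c. Y = (\<Oplus>\<^bsub>A\<^esub>b\<in>X ` V. c b \<odot>\<^bsub>A\<^esub> b)" by (intro exI) (rule sym)
qed

text \<open>Reduces every identity between linear maps below to the basis monomials, where \<Delta>,
  the counit and the antipode are known explicitly.\<close>

lemma k_linear_eqI:
  assumes "vspace M" "k_linear A M f" "k_linear A M h" "\<And>v. v \<in> V \<Longrightarrow> f (X v) = h (X v)"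
    and "Y \<in> carrier A"
  shows "f Y = h Y"
proof -
  interpret M: vspace M by fact
  have *: "f Y = (\<Oplus>\<^bsub>M\<^esub>v\<in>V. X_dual v Y \<odot>\<^bsub>M\<^esub> f (X v))" if "k_linear A M f" for f
  proof -
    have "f Y = f (\<Oplus>\<^bsub>A\<^esub>v\<in>V. X_dual v Y \<odot>\<^bsub>A\<^esub> X v)" using X_expansion[OF assms(5)] by simp
    also have "\<dots> = (\<Oplus>\<^bsub>M\<^esub>v\<in>V. f (X_dual v Y \<odot>\<^bsub>A\<^esub> X v))"
      using X_closed by (intro k_linear_finsum[OF vspace_A assms(1) that]) (auto simp: A.smultD)
    also have "\<dots> = (\<Oplus>\<^bsub>M\<^esub>v\<in>V. X_dual v Y \<odot>\<^bsub>M\<^esub> f (X v))"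
      using k_linearD[OF that] X_closed by (intro M.M.finsum_cong') (auto simp: M.smultD)
    finally show ?thesis .
  qed
  show ?thesis
    unfolding *[OF assms(2)] *[OF assms(3)]
    using k_linearD(1)[OF assms(3) X_closed] assms(4)
    by (intro M.M.finsum_cong') (auto simp: M.smultD)
qed

lemma
  assumes M: "vspace M" and f: "\<And>v. v \<in> V \<Longrightarrow> f v \<in> carrier M"
  shows k_linear_linear_extension: "k_linear A M (linear_extension n q a M f)"
    and linear_extension_X: "v \<in> V \<Longrightarrow> linear_extension n q a M f (X v) = f v"
proof -
  interpret M: vspace M by (rule M)
  show "k_linear A M (linear_extension n q a M f)"
  proof (rule k_linearI; unfold linear_extension_def)
    fix x y c assume x: "x \<in> carrier A"
    show "(\<Oplus>\<^bsub>M\<^esub>v\<in>V. X_dual v x \<odot>\<^bsub>M\<^esub> f v) \<in> carrier M"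
      using f by (intro M.M.finsum_closed) (auto simp: M.smultD)
    have "(\<Oplus>\<^bsub>M\<^esub>v\<in>V. X_dual v (c \<odot>\<^bsub>A\<^esub> x) \<odot>\<^bsub>M\<^esub> f v) = (\<Oplus>\<^bsub>M\<^esub>v\<in>V. c \<odot>\<^bsub>M\<^esub> (X_dual v x \<odot>\<^bsub>M\<^esub> f v))"
      using f x k_linearD(3)[OF k_linear_X_dual]
      by (intro M.M.finsum_cong') (auto simp: M.smultD)
    also have "\<dots> = c \<odot>\<^bsub>M\<^esub> (\<Oplus>\<^bsub>M\<^esub>v\<in>V. X_dual v x \<odot>\<^bsub>M\<^esub> f v)"
      using f finite_exponents by (intro M.finsum_smult[symmetric]) (auto simp: M.smultD)
    finally show "(\<Oplus>\<^bsub>M\<^esub>v\<in>V. X_dual v (c \<odot>\<^bsub>A\<^esub> x) \<odot>\<^bsub>M\<^esub> f v) = c \<odot>\<^bsub>M\<^esub> (\<Oplus>\<^bsub>M\<^esub>v\<in>V. X_dual v x \<odot>\<^bsub>M\<^esub> f v)" .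
    assume y: "y \<in> carrier A"
    have "(\<Oplus>\<^bsub>M\<^esub>v\<in>V. X_dual v (x \<oplus>\<^bsub>A\<^esub> y) \<odot>\<^bsub>M\<^esub> f v) = (\<Oplus>\<^bsub>M\<^esub>v\<in>V. (X_dual v x + X_dual v y) \<odot>\<^bsub>M\<^esub> f v)"
      using f x y k_linearD(2)[OF k_linear_X_dual]
      by (intro M.M.finsum_cong') (auto simp: M.smultD)
    then show "(\<Oplus>\<^bsub>M\<^esub>v\<in>V. X_dual v (x \<oplus>\<^bsub>A\<^esub> y) \<odot>\<^bsub>M\<^esub> f v) =
        (\<Oplus>\<^bsub>M\<^esub>v\<in>V. X_dual v x \<odot>\<^bsub>M\<^esub> f v) \<oplus>\<^bsub>M\<^esub> (\<Oplus>\<^bsub>M\<^esub>v\<in>V. X_dual v y \<odot>\<^bsub>M\<^esub> f v)"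
      using M.finsum_smult_add[of f V] f by (simp add: Pi_iff)
  qed
  assume v: "v \<in> V"
  have "linear_extension n q a M f (X v) = (\<Oplus>\<^bsub>M\<^esub>u\<in>V. (if u = v then 1 else 0) \<odot>\<^bsub>M\<^esub> f u)"
    unfolding linear_extension_def using f v
    by (intro M.M.finsum_cong') (auto simp: X_dual_X M.smultD)
  also have "\<dots> = f v"
    using f v finite_exponents by (intro M.finsum_delta) auto
  finally show "linear_extension n q a M f (X v) = f v" .
qed

end

context quantum_ci begin

section \<open>The coalgebra structure\<close>

abbreviation "vzero \<equiv> zero_exponent n"
abbreviation "vtop \<equiv> top_exponent n a"
abbreviation "co \<equiv> co_exponent n a"
abbreviation "AA \<equiv> tensor_product A A"
abbreviation "pt \<equiv> pure_tensor A A"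
abbreviation "\<epsilon> \<equiv> eps0 n q a"
abbreviation unit :: "nat \<Rightarrow> nat \<Rightarrow> nat" where "unit i \<equiv> count_list [i]"

declare One_nat_def [simp del]

lemma exponent_mem_iff: "v \<in> V \<longleftrightarrow> v \<in> extensional {1..n} \<and> (\<forall>i\<in>{1..n}. v i < a i)"
proof -
  have "v i \<le> a i - 1 \<longleftrightarrow> v i < a i" if "i \<in> {1..n}" for i using a_ge[OF that] by auto
  then show ?thesis by (auto simp: exponents_def PiE_iff)
qed

lemma exponent_eqI: "u \<in> V \<Longrightarrow> v \<in> V \<Longrightarrow> (\<And>i. i \<in> {1..n} \<Longrightarrow> u i = v i) \<Longrightarrow> u = v"
  by (rule extensionalityI[of _ "{1..n}"]) (auto simp: extensional_exponents)

lemma exponent_less: "v \<in> V \<Longrightarrow> i \<in> {1..n} \<Longrightarrow> v i < a i"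
  by (simp add: exponent_mem_iff)

lemma a_pos: "i \<in> {1..n} \<Longrightarrow> 0 < a i"
  using a_ge[of i] by simp

lemma z_mem: "vzero \<in> V" and top_mem: "vtop \<in> V" and co_mem: "co v \<in> V"
  using a_pos by (auto simp: exponent_mem_iff zero_exponent_def top_exponent_def co_exponent_def less_imp_diff_less)

lemma co_co: "v \<in> V \<Longrightarrow> co (co v) = v"
  by (rule exponent_eqI[OF co_mem]) (auto simp: co_exponent_def dest: exponent_less)

lemma co_z: "co vzero = vtop"
  by (rule exponent_eqI[OF co_mem top_mem]) (auto simp: co_exponent_def zero_exponent_def top_exponent_def)

lemma co_top: "co vtop = vzero"
  by (rule exponent_eqI[OF co_mem z_mem]) (auto simp: co_exponent_def zero_exponent_def top_exponent_def)

lemma co_eq_iff: "u \<in> V \<Longrightarrow> v \<in> V \<Longrightarrow> co u = v \<longleftrightarrow> u = co v"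
  using co_co by metis

lemma co_eq_z_iff: "u \<in> V \<Longrightarrow> co u = vzero \<longleftrightarrow> u = vtop"
  by (simp add: co_eq_iff z_mem co_z)

lemma co_eq_top_iff: "u \<in> V \<Longrightarrow> co u = vtop \<longleftrightarrow> u = vzero"
  by (simp add: co_eq_iff top_mem co_top)

lemma one_in_range: "1 \<in> {1..n}" "2 \<in> {1..n}" using n_ge by auto

lemma z_neq_top: "vzero \<noteq> vtop"
proof
  assume "vzero = vtop"
  then have "vzero 1 = vtop 1" by simp
  then show False using one_in_range(1) a_ge[OF one_in_range(1)] by (simp add: zero_exponent_def top_exponent_def)
qed

text \<open>A unit exponent differs from the top one because \<open>n >= 2\<close> provides a second
  index, where the unit is 0 and the top exponent is at least 1. Hence the generators are primitive
  for \<open>Delta_g\<close>.\<close>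

lemma unit_exponent:
  assumes i: "i \<in> {1..n}"
  shows "word_exponent [i] \<in> V" "word_exponent [i] \<noteq> vzero" "word_exponent [i] \<noteq> vtop"
proof -
  have 2: "j \<in> {1..n} \<Longrightarrow> 1 < a j" for j using a_ge[of j] by simp
  show "word_exponent [i] \<in> V" using a_pos 2 by (auto simp: exponent_mem_iff)
  show "word_exponent [i] \<noteq> vzero"
  proof
    assume "word_exponent [i] = vzero"
    then have "word_exponent [i] i = vzero i" by simp
    then show False using i by (simp add: zero_exponent_def)
  qed
  show "word_exponent [i] \<noteq> vtop"
  proof
    assume e: "word_exponent [i] = vtop"
    obtain j where j: "j \<in> {1..n}" "j \<noteq> i" using that[of 1] that[of 2] one_in_range by (cases "i = 1") auto
    have "word_exponent [i] j = vtop j" using e by simp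
    then show False using j a_ge[OF j(1)] by (simp add: top_exponent_def)
  qed
qed

lemma add_eq_top_iff:
  assumes "u \<in> V" "v \<in> V"
  shows "(\<lambda>i\<in>{1..n}. u i + v i) = vtop \<longleftrightarrow> v = co u"
proof
  assume "v = co u"
  then show "(\<lambda>i\<in>{1..n}. u i + v i) = vtop"
    using exponent_less[OF assms(1)] by (fastforce simp: co_exponent_def top_exponent_def fun_eq_iff)
next
  assume *: "(\<lambda>i\<in>{1..n}. u i + v i) = vtop"
  show "v = co u"
  proof (rule exponent_eqI[OF assms(2) co_mem])
    fix i assume i: "i \<in> {1..n}"
    have "(\<lambda>i\<in>{1..n}. u i + v i) i = vtop i" using * by simp
    then show "v i = co u i" using i by (simp add: top_exponent_def co_exponent_def)
  qed
qed

lemma X_mult_eq_zero: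
  assumes "(\<lambda>i\<in>{1..n}. u i + v i) \<notin> V"
  shows "X u \<otimes>\<^bsub>A\<^esub> X v = \<zero>\<^bsub>A\<^esub>"
proof -
  obtain i where "i \<in> {1..n}" "u i + v i \<ge> a i"
    using assms by (auto simp: exponent_mem_iff not_less)
  then have "X (\<lambda>i\<in>{1..n}. u i + v i) = \<zero>\<^bsub>A\<^esub>" by (intro X_eq_zero[of i]) auto
  then show ?thesis by (simp add: X_mult A.smultD)
qed

lemma functional_zero: "k_linear A ground f \<Longrightarrow> f \<zero>\<^bsub>A\<^esub> = 0"
  using k_linear_zero[OF vspace_A vspace_ground] by simp

lemma functional_smult: "k_linear A ground f \<Longrightarrow> x \<in> carrier A \<Longrightarrow> f (c \<odot>\<^bsub>A\<^esub> x) = c * f x"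
  by (simp add: k_linearD)

lemma functional_expansion:
  assumes f: "k_linear A ground f" and Y: "Y \<in> carrier A"
  shows "f Y = (\<Sum>v\<in>V. X_dual v Y * f (X v))"
proof -
  have "f Y = f (\<Oplus>\<^bsub>A\<^esub>v\<in>V. X_dual v Y \<odot>\<^bsub>A\<^esub> X v)" using X_expansion[OF Y] by simp
  also have "\<dots> = (\<Sum>v\<in>V. f (X_dual v Y \<odot>\<^bsub>A\<^esub> X v))"
    using X_closed by (subst k_linear_finsum[OF vspace_A vspace_ground f]) (auto simp: A.smultD ground_finsum)
  finally show ?thesis using X_closed by (simp add: functional_smult[OF f])
qed

text \<open>The Gram matrix of the form given by the dual top monomial: each row and column has one
  nonzero entry, at complementary exponents, which is why the form is nondegenerate.\<close>

lemma X_dual_top_mult: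
  assumes "u \<in> V" "v \<in> V"
  shows "X_dual vtop (X u \<otimes>\<^bsub>A\<^esub> X v) = (if v = co u then B u v else 0)"
proof (cases "(\<lambda>i\<in>{1..n}. u i + v i) \<in> V")
  case True
  then show ?thesis
    unfolding X_mult functional_smult[OF k_linear_X_dual[OF top_mem] X_closed] X_dual_X[OF True top_mem]
    using add_eq_top_iff[OF assms] by simp
next
  case False
  then show ?thesis
    using add_eq_top_iff[OF assms] top_mem X_mult_eq_zero[OF False] functional_zero[OF k_linear_X_dual[OF top_mem]]
    by auto
qed

lemma vspace_AA: "vspace AA"
  by (rule vspace_tensor_product[OF vspace_A vspace_A])

sublocale AA: vspace AA
  by (rule vspace_AA)

lemma one_closed: "\<one>\<^bsub>A\<^esub> \<in> carrier A"
  using X_closed[of vzero] by (simp add: X_zero_exponent)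

lemma pt_closed: "x \<in> carrier A \<Longrightarrow> y \<in> carrier A \<Longrightarrow> pt x y \<in> carrier AA"
  using k_linearD(1)[OF pure_tensor_linear(1)[OF vspace_A vspace_A]] .

lemma k_linear_eps: "k_linear A ground \<epsilon>"
  unfolding eps0_def by (rule k_linear_linear_extension[OF vspace_ground]) simp

lemma eps_X: "v \<in> V \<Longrightarrow> \<epsilon> (X v) = (if v = vzero then 1 else 0)"
  unfolding eps0_def by (subst linear_extension_X[OF vspace_ground]) simp_all

lemma eps_one: "\<epsilon> \<one>\<^bsub>A\<^esub> = 1"
  using eps_X[OF z_mem] by (simp add: X_zero_exponent)

lemma k_linear_mult_left: "x \<in> carrier A \<Longrightarrow> k_linear A A (\<lambda>y. x \<otimes>\<^bsub>A\<^esub> y)"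
  and k_linear_mult_right: "x \<in> carrier A \<Longrightarrow> k_linear A A (\<lambda>y. y \<otimes>\<^bsub>A\<^esub> x)"
proof -
  interpret A: ring A by (rule ring_A)
  have "(c \<odot>\<^bsub>A\<^esub> x) \<otimes>\<^bsub>A\<^esub> y = c \<odot>\<^bsub>A\<^esub> (x \<otimes>\<^bsub>A\<^esub> y)" "x \<otimes>\<^bsub>A\<^esub> (c \<odot>\<^bsub>A\<^esub> y) = c \<odot>\<^bsub>A\<^esub> (x \<otimes>\<^bsub>A\<^esub> y)"
    if "x \<in> carrier A" "y \<in> carrier A" for c x y
    using k_algebra_A that by (auto simp: k_algebra_def)
  then show "x \<in> carrier A \<Longrightarrow> k_linear A A (\<lambda>y. x \<otimes>\<^bsub>A\<^esub> y)"
    "x \<in> carrier A \<Longrightarrow> k_linear A A (\<lambda>y. y \<otimes>\<^bsub>A\<^esub> x)"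
    by (auto intro!: k_linearI simp: A.l_distr A.r_distr)
qed

lemma mult_closed: "x \<in> carrier A \<Longrightarrow> y \<in> carrier A \<Longrightarrow> x \<otimes>\<^bsub>A\<^esub> y \<in> carrier A"
  using k_linearD(1)[OF k_linear_mult_left] .

lemma finsum_delta_weighted:
  assumes M: "vspace M" and "f \<in> V \<rightarrow> carrier M" "i \<in> V"
    and "\<And>j. j \<in> V \<Longrightarrow> h j = (if j = i then c else 0) \<odot>\<^bsub>M\<^esub> f j"
  shows "(\<Oplus>\<^bsub>M\<^esub>j\<in>V. h j) = c \<odot>\<^bsub>M\<^esub> f i"
proof -
  interpret M: vspace M by (rule M)
  have "(\<Oplus>\<^bsub>M\<^esub>j\<in>V. h j) = (\<Oplus>\<^bsub>M\<^esub>j\<in>V. if i = j then c \<odot>\<^bsub>M\<^esub> f j else \<zero>\<^bsub>M\<^esub>)"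
    using assms by (intro M.M.finsum_cong') (auto simp: M.smultD Pi_iff)
  also have "\<dots> = c \<odot>\<^bsub>M\<^esub> f i"
    using assms finite_exponents by (intro M.M.finsum_singleton) (auto simp: M.smultD)
  finally show ?thesis .
qed

end

locale quantum_ci_family = quantum_ci n a q
  for n and a and q :: "nat \<Rightarrow> nat \<Rightarrow> 'k::field" +
  fixes g :: "(nat \<Rightarrow> nat) \<Rightarrow> (nat \<Rightarrow> nat) \<Rightarrow> 'k"
  assumes adm: "admissible n a g"
begin

abbreviation "\<Delta> \<equiv> Delta_g n q a g"

lemma g_nz: "v \<in> V \<Longrightarrow> g v (co v) \<noteq> 0" and g_z: "g vzero vtop = 1" and g_top: "g vtop vzero = 1"
  using adm by (auto simp: admissible_def)

lemma k_linear_Delta: "k_linear A AA \<Delta>"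
  and Delta_X: "v \<in> V \<Longrightarrow> \<Delta> (X v) = (if v = vzero then pt \<one>\<^bsub>A\<^esub> \<one>\<^bsub>A\<^esub>
       else if v = vtop then (\<Oplus>\<^bsub>AA\<^esub>u\<in>V. g u (co u) \<odot>\<^bsub>AA\<^esub> pt (X u) (X (co u)))
       else pt \<one>\<^bsub>A\<^esub> (X v) \<oplus>\<^bsub>AA\<^esub> pt (X v) \<one>\<^bsub>A\<^esub>)"
proof -
  let ?f = "\<lambda>v. if v = vzero then pt \<one>\<^bsub>A\<^esub> \<one>\<^bsub>A\<^esub>
       else if v = vtop then (\<Oplus>\<^bsub>AA\<^esub>u\<in>V. g u (co u) \<odot>\<^bsub>AA\<^esub> pt (X u) (X (co u)))
       else pt \<one>\<^bsub>A\<^esub> (X v) \<oplus>\<^bsub>AA\<^esub> pt (X v) \<one>\<^bsub>A\<^esub>"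
  have eq: "\<Delta> = linear_extension n q a AA ?f"
    unfolding Delta_g_def Let_def ..
  have cl: "?f v \<in> carrier AA" for v
    using X_closed one_closed by (auto simp: pt_closed AA.smultD intro!: AA.M.finsum_closed)
  show "k_linear A AA \<Delta>" unfolding eq by (rule k_linear_linear_extension[OF vspace_AA cl])
  show "v \<in> V \<Longrightarrow> \<Delta> (X v) = ?f v" unfolding eq by (rule linear_extension_X[OF vspace_AA cl])
qed

lemma Delta_one: "\<Delta> \<one>\<^bsub>A\<^esub> = pt \<one>\<^bsub>A\<^esub> \<one>\<^bsub>A\<^esub>"
  using Delta_X[OF z_mem] by (simp add: X_zero_exponent)

lemma Delta_closed: "x \<in> carrier A \<Longrightarrow> \<Delta> x \<in> carrier AA"
  using k_linearD(1)[OF k_linear_Delta] .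

section \<open>Sweedler sums over the comultiplication of a monomial\<close>

context
  fixes P :: "('k, 'c) module" and \<beta>
  assumes P: "vspace P" and \<beta>: "k_bilinear A A P \<beta>"
begin

interpretation P: vspace P by (rule P)

lemma k_linear_sweedler_Delta: "k_linear A P (\<lambda>x. sweedler P (\<Delta> x) \<beta>)"
  by (rule k_linear_comp[OF k_linear_Delta k_linear_sweedler[OF vspace_A vspace_A P \<beta>]])

lemma sweedler_Delta_one: "sweedler P (\<Delta> \<one>\<^bsub>A\<^esub>) \<beta> = \<beta> \<one>\<^bsub>A\<^esub> \<one>\<^bsub>A\<^esub>"
  unfolding Delta_one by (rule sweedler_pure_tensor[OF vspace_A vspace_A P \<beta> one_closed one_closed])

lemma sweedler_Delta_mid:
  assumes "v \<in> V" "v \<noteq> vzero" "v \<noteq> vtop"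
  shows "sweedler P (\<Delta> (X v)) \<beta> = \<beta> \<one>\<^bsub>A\<^esub> (X v) \<oplus>\<^bsub>P\<^esub> \<beta> (X v) \<one>\<^bsub>A\<^esub>"
  using assms X_closed one_closed
  by (simp add: Delta_X pt_closed sweedler_pure_tensor[OF vspace_A vspace_A P \<beta>]
      k_linearD(2)[OF k_linear_sweedler[OF vspace_A vspace_A P \<beta>]])

lemma \<beta>_closed: "x \<in> carrier A \<Longrightarrow> y \<in> carrier A \<Longrightarrow> \<beta> x y \<in> carrier P"
  using k_linearD(1)[OF k_bilinearD(1)[OF \<beta>]] .

lemma sweedler_Delta_top:
  "sweedler P (\<Delta> (X vtop)) \<beta> = (\<Oplus>\<^bsub>P\<^esub>u\<in>V. g u (co u) \<odot>\<^bsub>P\<^esub> \<beta> (X u) (X (co u)))"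
proof -
  note lin = k_linear_sweedler[OF vspace_A vspace_A P \<beta>]
  have "\<Delta> (X vtop) = (\<Oplus>\<^bsub>AA\<^esub>u\<in>V. g u (co u) \<odot>\<^bsub>AA\<^esub> pt (X u) (X (co u)))"
    using Delta_X[OF top_mem] z_neq_top by simp
  then have "sweedler P (\<Delta> (X vtop)) \<beta> =
      (\<Oplus>\<^bsub>P\<^esub>u\<in>V. sweedler P (g u (co u) \<odot>\<^bsub>AA\<^esub> pt (X u) (X (co u))) \<beta>)"
    by (simp add: k_linear_finsum[OF vspace_AA P lin] Pi_iff AA.smultD pt_closed X_closed)
  also have "\<dots> = (\<Oplus>\<^bsub>P\<^esub>u\<in>V. g u (co u) \<odot>\<^bsub>P\<^esub> \<beta> (X u) (X (co u)))"
    by (intro P.M.finsum_cong')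
      (simp_all add: k_linearD(3)[OF lin] pt_closed X_closed P.smultD \<beta>_closed
        sweedler_pure_tensor[OF vspace_A vspace_A P \<beta>])
  finally show ?thesis .
qed

end

lemma k_bilinear_functional:
  assumes "k_linear A ground f"
  shows "k_bilinear A A A (\<lambda>x y. f x \<odot>\<^bsub>A\<^esub> y)" "k_bilinear A A A (\<lambda>x y. f y \<odot>\<^bsub>A\<^esub> x)"
  using assms
  by (auto intro!: k_bilinearI k_linear_functional_smult[OF vspace_A] k_linear_smult_const[OF vspace_A])

lemma counit_left:
  assumes "Y \<in> carrier A"
  shows "sweedler A (\<Delta> Y) (\<lambda>x y. \<epsilon> x \<odot>\<^bsub>A\<^esub> y) = Y"
proof -
  let ?\<beta> = "\<lambda>x y. \<epsilon> x \<odot>\<^bsub>A\<^esub> y"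
  have b: "k_bilinear A A A ?\<beta>" by (rule k_bilinear_functional[OF k_linear_eps])
  show ?thesis
  proof (rule k_linear_eqI[OF vspace_A k_linear_sweedler_Delta[OF vspace_A b] k_linear_id _ assms])
    fix v assume v: "v \<in> V"
    consider "v = vzero" | "v = vtop" | "v \<noteq> vzero" "v \<noteq> vtop" by blast
    then show "sweedler A (\<Delta> (X v)) ?\<beta> = X v"
    proof cases
      case 1 then show ?thesis
        by (simp add: X_zero_exponent sweedler_Delta_one[OF vspace_A b] eps_one A.smultD one_closed)
    next
      case 2
      \<comment> \<open>The counit kills all summands except the one with left factor 1, whose
        coefficient \<open>g vzero vtop\<close> is 1 by admissibility.\<close>
      have "sweedler A (\<Delta> (X vtop)) ?\<beta> = 1 \<odot>\<^bsub>A\<^esub> X (co vzero)"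
        unfolding sweedler_Delta_top[OF vspace_A b]
        by (rule finsum_delta_weighted[OF vspace_A, of "\<lambda>u. X (co u)"]) (auto simp: X_closed z_mem eps_X A.smultD g_z co_z)
      then show ?thesis using 2 by (simp add: co_z A.smultD X_closed)
    next
      case 3 then show ?thesis using v
        by (simp add: sweedler_Delta_mid[OF vspace_A b] eps_one eps_X A.smultD X_closed one_closed)
    qed
  qed
qed

lemma counit_right:
  assumes "Y \<in> carrier A"
  shows "sweedler A (\<Delta> Y) (\<lambda>x y. \<epsilon> y \<odot>\<^bsub>A\<^esub> x) = Y"
proof -
  let ?\<beta> = "\<lambda>x y. \<epsilon> y \<odot>\<^bsub>A\<^esub> x"
  have b: "k_bilinear A A A ?\<beta>" by (rule k_bilinear_functional[OF k_linear_eps])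
  show ?thesis
  proof (rule k_linear_eqI[OF vspace_A k_linear_sweedler_Delta[OF vspace_A b] k_linear_id _ assms])
    fix v assume v: "v \<in> V"
    consider "v = vzero" | "v = vtop" | "v \<noteq> vzero" "v \<noteq> vtop" by blast
    then show "sweedler A (\<Delta> (X v)) ?\<beta> = X v"
    proof cases
      case 1 then show ?thesis
        by (simp add: X_zero_exponent sweedler_Delta_one[OF vspace_A b] eps_one A.smultD one_closed)
    next
      case 2
      have "sweedler A (\<Delta> (X vtop)) ?\<beta> = 1 \<odot>\<^bsub>A\<^esub> X vtop"
        unfolding sweedler_Delta_top[OF vspace_A b]
        by (rule finsum_delta_weighted[OF vspace_A, of X])
          (auto simp: X_closed top_mem co_mem eps_X A.smultD g_top co_top co_eq_z_iff)
      then show ?thesis using 2 by (simp add: A.smultD X_closed)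
    next
      case 3 then show ?thesis using v
        by (simp add: sweedler_Delta_mid[OF vspace_A b] eps_one eps_X A.smultD X_closed one_closed)
    qed
  qed
qed

abbreviation "AAA \<equiv> tensor_product A AA"
abbreviation "pt3 \<equiv> pure_tensor A AA"

lemma vspace_AAA: "vspace AAA"
  by (rule vspace_tensor_product[OF vspace_A vspace_AA])

lemma pt3_closed: "x \<in> carrier A \<Longrightarrow> T \<in> carrier AA \<Longrightarrow> pt3 x T \<in> carrier AAA"
  using k_linearD(1)[OF pure_tensor_linear(1)[OF vspace_A vspace_AA]] .

text \<open>Separates the two summands of the top comultiplication that have 1 as a tensor factor.
  In all others both factors are primitive.\<close>

lemma finsum_split:
  assumes M: "vspace M" and f: "f \<in> V \<rightarrow> carrier M"
  shows "(\<Oplus>\<^bsub>M\<^esub>v\<in>V. f v) = f vzero \<oplus>\<^bsub>M\<^esub> (f vtop \<oplus>\<^bsub>M\<^esub> (\<Oplus>\<^bsub>M\<^esub>v\<in>V - {vzero, vtop}. f v))"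
proof -
  interpret M: vspace M by (rule M)
  have "V = insert vzero (insert vtop (V - {vzero, vtop}))" using z_mem top_mem by auto
  then have "(\<Oplus>\<^bsub>M\<^esub>v\<in>V. f v) = (\<Oplus>\<^bsub>M\<^esub>v\<in>insert vzero (insert vtop (V - {vzero, vtop})). f v)" by simp
  also have "\<dots> = f vzero \<oplus>\<^bsub>M\<^esub> (f vtop \<oplus>\<^bsub>M\<^esub> (\<Oplus>\<^bsub>M\<^esub>v\<in>V - {vzero, vtop}. f v))"
    using f z_mem top_mem finite_exponents z_neq_top by (subst M.M.finsum_insert; (subst M.M.finsum_insert)?) auto
  finally show ?thesis .
qed

end

context quantum_ci_family begin

lemma sweedler_Delta_top_split:
  assumes P: "vspace P" and \<beta>: "k_bilinear A A P \<beta>"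
  shows "sweedler P (\<Delta> (X vtop)) \<beta> = \<beta> \<one>\<^bsub>A\<^esub> (X vtop) \<oplus>\<^bsub>P\<^esub> (\<beta> (X vtop) \<one>\<^bsub>A\<^esub> \<oplus>\<^bsub>P\<^esub>
    (\<Oplus>\<^bsub>P\<^esub>u\<in>V - {vzero, vtop}. g u (co u) \<odot>\<^bsub>P\<^esub> \<beta> (X u) (X (co u))))"
proof -
  interpret P: vspace P by (rule P)
  show ?thesis
    unfolding sweedler_Delta_top[OF P \<beta>]
    by (subst finsum_split[OF P])
      (simp_all add: \<beta>_closed[OF P \<beta>] P.smultD X_closed one_closed co_z co_top g_z g_top X_zero_exponent)
qed

text \<open>For the top monomial both sides consist of the three tensors with the top monomial in
  one slot and 1 in the two others, together with \<open>S1 + S2 + S3\<close>. On the left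
  \<open>S1\<close> comes from \<open>1 \<otimes> \<Delta>(x)\<close> with \<open>x\<close> the top
  monomial, and \<open>S2 + S3\<close> from the primitive right factors; on the right
  \<open>S3\<close> comes from \<open>\<Delta>(x) \<otimes> 1\<close>, and \<open>S1 + S2\<close>
  from the primitive left factors.\<close>

lemma coassociative:
  assumes "Y \<in> carrier A"
  shows "sweedler AAA (\<Delta> Y) (\<lambda>x y. pt3 x (\<Delta> y)) =
    sweedler AAA (\<Delta> Y) (\<lambda>x y. sweedler AAA (\<Delta> x) (\<lambda>u v. pt3 u (pt v y)))"
proof -
  interpret AAA: vspace AAA by (rule vspace_AAA)
  define \<gamma> where "\<gamma> = (\<lambda>y u v. pt3 u (pt v y))"
  define \<beta>1 where "\<beta>1 = (\<lambda>x y. pt3 x (\<Delta> y))"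
  define \<beta>2 where "\<beta>2 = (\<lambda>x y. sweedler AAA (\<Delta> x) (\<gamma> y))"
  note pt = pure_tensor_linear[OF vspace_A vspace_A] and pt3 = pure_tensor_linear[OF vspace_A vspace_AA]
  have \<gamma>: "k_bilinear A A AAA (\<gamma> y)" if "y \<in> carrier A" for y
    unfolding \<gamma>_def
    by (rule k_bilinearI) (use that in \<open>auto intro: k_linear_comp[OF pt(2) pt3(1)] pt3(2) pt_closed\<close>)
  have \<beta>1: "k_bilinear A A AAA \<beta>1"
    unfolding \<beta>1_def
    by (rule k_bilinearI) (auto intro: k_linear_comp[OF k_linear_Delta pt3(1)] pt3(2) Delta_closed)
  have \<beta>2: "k_bilinear A A AAA \<beta>2"
    unfolding \<beta>2_def
  proof (rule k_bilinearI)
    fix x assume x: "x \<in> carrier A"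
    have "k_linear A AAA (\<lambda>y. \<gamma> y u v)" if "u \<in> carrier A" "v \<in> carrier A" for u v
      unfolding \<gamma>_def by (rule k_linear_comp[OF pt(1) pt3(1)]) fact+
    then show "k_linear A AAA (\<lambda>y. sweedler AAA (\<Delta> x) (\<gamma> y))"
      by (intro k_linear_sweedler_parameter[OF vspace_A vspace_A vspace_AAA vspace_A \<gamma> _ Delta_closed[OF x]])
  qed (rule k_linear_sweedler_Delta[OF vspace_AAA \<gamma>])
  have \<beta>2_one: "\<beta>2 \<one>\<^bsub>A\<^esub> y = \<gamma> y \<one>\<^bsub>A\<^esub> \<one>\<^bsub>A\<^esub>" if "y \<in> carrier A" for y
    unfolding \<beta>2_def by (rule sweedler_Delta_one[OF vspace_AAA \<gamma>[OF that]])
  have \<beta>2_mid: "\<beta>2 (X v) y = \<gamma> y \<one>\<^bsub>A\<^esub> (X v) \<oplus>\<^bsub>AAA\<^esub> \<gamma> y (X v) \<one>\<^bsub>A\<^esub>"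
    if "v \<in> V" "v \<noteq> vzero" "v \<noteq> vtop" "y \<in> carrier A" for v y
    unfolding \<beta>2_def by (rule sweedler_Delta_mid[OF vspace_AAA \<gamma>[OF that(4)] that(1-3)])
  have \<beta>1_mid: "\<beta>1 x (X v) = pt3 x (pt \<one>\<^bsub>A\<^esub> (X v)) \<oplus>\<^bsub>AAA\<^esub> pt3 x (pt (X v) \<one>\<^bsub>A\<^esub>)"
    if "v \<in> V" "v \<noteq> vzero" "v \<noteq> vtop" "x \<in> carrier A" for v x
    unfolding \<beta>1_def using that
    by (simp add: Delta_X k_linearD(2)[OF pt3(1)] pt_closed X_closed one_closed)
  have \<beta>1_one: "\<beta>1 x \<one>\<^bsub>A\<^esub> = pt3 x (pt \<one>\<^bsub>A\<^esub> \<one>\<^bsub>A\<^esub>)" for x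
    unfolding \<beta>1_def Delta_one ..
  note closed = pt3_closed pt_closed X_closed one_closed
  let ?M = "V - {vzero, vtop}"
  have M: "u \<in> V" "co u \<in> V" "u \<noteq> vzero" "u \<noteq> vtop" "co u \<noteq> vzero" "co u \<noteq> vtop" if "u \<in> ?M" for u
    using that co_mem[of u] co_eq_z_iff[of u] co_eq_top_iff[of u] by auto
  have "sweedler AAA (\<Delta> Y) \<beta>1 = sweedler AAA (\<Delta> Y) \<beta>2"
  proof (rule k_linear_eqI[OF vspace_AAA k_linear_sweedler_Delta[OF vspace_AAA \<beta>1]
        k_linear_sweedler_Delta[OF vspace_AAA \<beta>2] _ assms])
    fix v assume v: "v \<in> V"
    consider "v = vzero" | "v = vtop" | "v \<noteq> vzero" "v \<noteq> vtop" by blast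
    then show "sweedler AAA (\<Delta> (X v)) \<beta>1 = sweedler AAA (\<Delta> (X v)) \<beta>2"
    proof cases
      case 1
      then show ?thesis
        by (simp add: X_zero_exponent sweedler_Delta_one[OF vspace_AAA \<beta>1] sweedler_Delta_one[OF vspace_AAA \<beta>2]
            \<beta>1_one \<beta>2_one one_closed) (simp add: \<gamma>_def)
    next
      case 3
      then show ?thesis
        using v
        by (simp add: sweedler_Delta_mid[OF vspace_AAA \<beta>1] sweedler_Delta_mid[OF vspace_AAA \<beta>2]
            \<beta>1_one \<beta>2_one \<beta>1_mid \<beta>2_mid closed) (simp add: \<gamma>_def closed AAA.M.a_ac)
    next
      case 2
      \<comment> \<open>The sums over complementary pairs of intermediate monomials, with 1 in the
        first, second and third slot respectively.\<close>
      define S1 S2 S3 where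
        "S1 = (\<Oplus>\<^bsub>AAA\<^esub>u\<in>?M. g u (co u) \<odot>\<^bsub>AAA\<^esub> pt3 \<one>\<^bsub>A\<^esub> (pt (X u) (X (co u))))" and
        "S2 = (\<Oplus>\<^bsub>AAA\<^esub>u\<in>?M. g u (co u) \<odot>\<^bsub>AAA\<^esub> pt3 (X u) (pt \<one>\<^bsub>A\<^esub> (X (co u))))" and
        "S3 = (\<Oplus>\<^bsub>AAA\<^esub>u\<in>?M. g u (co u) \<odot>\<^bsub>AAA\<^esub> pt3 (X u) (pt (X (co u)) \<one>\<^bsub>A\<^esub>))"
      have S: "S1 \<in> carrier AAA" "S2 \<in> carrier AAA" "S3 \<in> carrier AAA"
        unfolding S1_def S2_def S3_def by (auto intro!: AAA.M.finsum_closed AAA.smultD closed)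
      have "\<beta>1 \<one>\<^bsub>A\<^esub> (X vtop) = sweedler AAA (\<Delta> (X vtop)) (\<lambda>u v. pt3 \<one>\<^bsub>A\<^esub> (pt u v))"
      proof -
        have b: "k_bilinear A A AAA (\<lambda>u v. pt3 \<one>\<^bsub>A\<^esub> (pt u v))"
          by (rule k_bilinearI) (auto intro: k_linear_comp[OF pt(1) pt3(1)] k_linear_comp[OF pt(2) pt3(1)] one_closed)
        have d: "\<Delta> (X vtop) = (\<Oplus>\<^bsub>AA\<^esub>u\<in>V. g u (co u) \<odot>\<^bsub>AA\<^esub> pt (X u) (X (co u)))"
          using Delta_X[OF top_mem] z_neq_top by simp
        show ?thesis
          unfolding sweedler_Delta_top[OF vspace_AAA b] unfolding \<beta>1_def d
          by (subst k_linear_finsum[OF vspace_AA vspace_AAA pt3(1)[OF one_closed]])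
            (auto intro!: AAA.M.finsum_cong' simp: AA.smultD AAA.smultD closed k_linearD(3)[OF pt3(1)])
      qed
      also have "\<dots> = pt3 \<one>\<^bsub>A\<^esub> (pt \<one>\<^bsub>A\<^esub> (X vtop)) \<oplus>\<^bsub>AAA\<^esub> (pt3 \<one>\<^bsub>A\<^esub> (pt (X vtop) \<one>\<^bsub>A\<^esub>) \<oplus>\<^bsub>AAA\<^esub> S1)"
        unfolding S1_def
        by (rule sweedler_Delta_top_split[OF vspace_AAA], rule k_bilinearI)
          (auto intro: k_linear_comp[OF pt(1) pt3(1)] k_linear_comp[OF pt(2) pt3(1)] one_closed)
      finally have a: "\<beta>1 \<one>\<^bsub>A\<^esub> (X vtop) = \<dots>" .
      have sum: "(\<Oplus>\<^bsub>AAA\<^esub>u\<in>?M. g u (co u) \<odot>\<^bsub>AAA\<^esub> f u) \<oplus>\<^bsub>AAA\<^esub> (\<Oplus>\<^bsub>AAA\<^esub>u\<in>?M. g u (co u) \<odot>\<^bsub>AAA\<^esub> h u) =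
          (\<Oplus>\<^bsub>AAA\<^esub>u\<in>?M. g u (co u) \<odot>\<^bsub>AAA\<^esub> (f u \<oplus>\<^bsub>AAA\<^esub> h u))"
        if "f \<in> ?M \<rightarrow> carrier AAA" "h \<in> ?M \<rightarrow> carrier AAA" for f h
      proof -
        have "(\<Oplus>\<^bsub>AAA\<^esub>u\<in>?M. g u (co u) \<odot>\<^bsub>AAA\<^esub> (f u \<oplus>\<^bsub>AAA\<^esub> h u)) =
            (\<Oplus>\<^bsub>AAA\<^esub>u\<in>?M. g u (co u) \<odot>\<^bsub>AAA\<^esub> f u \<oplus>\<^bsub>AAA\<^esub> g u (co u) \<odot>\<^bsub>AAA\<^esub> h u)"
          using that by (intro AAA.M.finsum_cong') (auto simp: AAA.smultD Pi_iff)
        also have "\<dots> = (\<Oplus>\<^bsub>AAA\<^esub>u\<in>?M. g u (co u) \<odot>\<^bsub>AAA\<^esub> f u) \<oplus>\<^bsub>AAA\<^esub> (\<Oplus>\<^bsub>AAA\<^esub>u\<in>?M. g u (co u) \<odot>\<^bsub>AAA\<^esub> h u)"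
          using that by (intro AAA.M.finsum_addf) (auto simp: AAA.smultD Pi_iff)
        finally show ?thesis by (rule sym)
      qed
      have "(\<Oplus>\<^bsub>AAA\<^esub>u\<in>?M. g u (co u) \<odot>\<^bsub>AAA\<^esub> \<beta>1 (X u) (X (co u))) = S2 \<oplus>\<^bsub>AAA\<^esub> S3"
      proof -
        have "(\<Oplus>\<^bsub>AAA\<^esub>u\<in>?M. g u (co u) \<odot>\<^bsub>AAA\<^esub> \<beta>1 (X u) (X (co u))) =
            (\<Oplus>\<^bsub>AAA\<^esub>u\<in>?M. g u (co u) \<odot>\<^bsub>AAA\<^esub> (pt3 (X u) (pt \<one>\<^bsub>A\<^esub> (X (co u))) \<oplus>\<^bsub>AAA\<^esub> pt3 (X u) (pt (X (co u)) \<one>\<^bsub>A\<^esub>)))"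
        proof (rule AAA.M.finsum_cong')
          fix u assume u: "u \<in> ?M"
          show "g u (co u) \<odot>\<^bsub>AAA\<^esub> \<beta>1 (X u) (X (co u)) = g u (co u) \<odot>\<^bsub>AAA\<^esub> (pt3 (X u) (pt \<one>\<^bsub>A\<^esub> (X (co u))) \<oplus>\<^bsub>AAA\<^esub> pt3 (X u) (pt (X (co u)) \<one>\<^bsub>A\<^esub>))"
            using M[OF u] by (simp add: \<beta>1_mid X_closed)
        qed (simp_all add: closed AAA.smultD(1))
        also have "\<dots> = S2 \<oplus>\<^bsub>AAA\<^esub> S3"
          unfolding S2_def S3_def by (rule sum[symmetric]) (simp_all add: closed)
        finally show ?thesis .
      qed
      moreover have "(\<Oplus>\<^bsub>AAA\<^esub>u\<in>?M. g u (co u) \<odot>\<^bsub>AAA\<^esub> \<beta>2 (X u) (X (co u))) = S1 \<oplus>\<^bsub>AAA\<^esub> S2"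
      proof -
        have "(\<Oplus>\<^bsub>AAA\<^esub>u\<in>?M. g u (co u) \<odot>\<^bsub>AAA\<^esub> \<beta>2 (X u) (X (co u))) =
            (\<Oplus>\<^bsub>AAA\<^esub>u\<in>?M. g u (co u) \<odot>\<^bsub>AAA\<^esub> (pt3 \<one>\<^bsub>A\<^esub> (pt (X u) (X (co u))) \<oplus>\<^bsub>AAA\<^esub> pt3 (X u) (pt \<one>\<^bsub>A\<^esub> (X (co u)))))"
        proof (rule AAA.M.finsum_cong')
          fix u assume u: "u \<in> ?M"
          show "g u (co u) \<odot>\<^bsub>AAA\<^esub> \<beta>2 (X u) (X (co u)) = g u (co u) \<odot>\<^bsub>AAA\<^esub> (pt3 \<one>\<^bsub>A\<^esub> (pt (X u) (X (co u))) \<oplus>\<^bsub>AAA\<^esub> pt3 (X u) (pt \<one>\<^bsub>A\<^esub> (X (co u))))"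
            using M[OF u] by (simp add: \<beta>2_mid \<gamma>_def X_closed)
        qed (simp_all add: closed AAA.smultD(1))
        also have "\<dots> = S1 \<oplus>\<^bsub>AAA\<^esub> S2"
          unfolding S1_def S2_def by (rule sum[symmetric]) (simp_all add: closed)
        finally show ?thesis .
      qed
      moreover have "\<beta>2 (X vtop) \<one>\<^bsub>A\<^esub> = pt3 \<one>\<^bsub>A\<^esub> (pt (X vtop) \<one>\<^bsub>A\<^esub>) \<oplus>\<^bsub>AAA\<^esub> (pt3 (X vtop) (pt \<one>\<^bsub>A\<^esub> \<one>\<^bsub>A\<^esub>) \<oplus>\<^bsub>AAA\<^esub> S3)"
        unfolding \<beta>2_def S3_def
        by (subst sweedler_Delta_top_split[OF vspace_AAA \<gamma>[OF one_closed]]) (simp add: \<gamma>_def)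
      ultimately show ?thesis
        unfolding 2
        by (simp add: sweedler_Delta_top_split[OF vspace_AAA \<beta>1] sweedler_Delta_top_split[OF vspace_AAA \<beta>2]
            a \<beta>1_one \<beta>2_one X_closed) (simp add: \<gamma>_def S closed AAA.M.a_ac)
    qed
  qed
  then show ?thesis by (simp add: \<beta>1_def \<beta>2_def \<gamma>_def)
qed

lemma k_coalgebra_A: "k_coalgebra A \<Delta> \<epsilon>"
  unfolding k_coalgebra_def
  by (intro conjI ballI A.module_axioms k_linear_Delta k_linear_eps counit_left counit_right coassociative)

section \<open>Frobenius structures and multiplicativity of the counit\<close>

lemma frobenius_algebra_A: "frobenius_algebra A (X_dual vtop)"
  unfolding frobenius_algebra_def
proof (intro conjI allI impI)
  show "k_linear A ground (X_dual vtop)" by (rule k_linear_X_dual[OF top_mem])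
  fix f assume f: "k_linear A ground f"
  \<comment> \<open>The top form pairs \<open>X u\<close> with \<open>X (co v)\<close> to
    \<open>B v (co v)\<close> if \<open>u = v\<close> and to zero otherwise; dividing by the bracket
    gives the element that represents \<open>f\<close>.\<close>
  let ?c = "\<lambda>v. f (X v) / B v (co v)"
  let ?y = "\<Oplus>\<^bsub>A\<^esub>v\<in>V. ?c v \<odot>\<^bsub>A\<^esub> X (co v)"
  have y: "?y \<in> carrier A" by (auto intro!: A.M.finsum_closed A.smultD X_closed)
  have "f x = X_dual vtop (x \<otimes>\<^bsub>A\<^esub> ?y)" if "x \<in> carrier A" for x
  proof (rule k_linear_eqI[OF vspace_ground f k_linear_comp[OF k_linear_mult_right[OF y] k_linear_X_dual[OF top_mem]] _ that])
    fix u assume u: "u \<in> V"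
    have l: "k_linear A ground (\<lambda>y. X_dual vtop (X u \<otimes>\<^bsub>A\<^esub> y))"
      by (rule k_linear_comp[OF k_linear_mult_left[OF X_closed] k_linear_X_dual[OF top_mem]])
    have "X_dual vtop (X u \<otimes>\<^bsub>A\<^esub> ?y) = (\<Sum>v\<in>V. ?c v * X_dual vtop (X u \<otimes>\<^bsub>A\<^esub> X (co v)))"
      by (subst k_linear_finsum[OF vspace_A vspace_ground l])
        (auto simp: ground_finsum X_closed A.smultD functional_smult[OF l])
    also have "\<dots> = (\<Sum>v\<in>V. if v = u then f (X u) else 0)"
      by (rule sum.cong) (use u co_co in \<open>auto simp: X_dual_top_mult co_mem B_nz dest: arg_cong[of _ _ co]\<close>)
    also have "\<dots> = f (X u)" using u finite_exponents by simp
    finally show "f (X u) = X_dual vtop (X u \<otimes>\<^bsub>A\<^esub> ?y)" by simp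
  qed
  then show "\<exists>y\<in>carrier A. \<forall>x\<in>carrier A. f x = X_dual vtop (x \<otimes>\<^bsub>A\<^esub> y)"
    using y by blast
qed

lemma inj_co: "inj_on co V" and image_co: "co ` V = V"
proof -
  show "inj_on co V" by (rule inj_on_inverseI[of _ co]) (rule co_co)
  have "v \<in> co ` V" if "v \<in> V" for v
    by (rule image_eqI[of _ _ "co v"]) (simp_all add: co_mem co_co that)
  then show "co ` V = V" using co_mem by blast
qed

lemma finsum_co:
  assumes "vspace M" "f \<in> V \<rightarrow> carrier M"
  shows "(\<Oplus>\<^bsub>M\<^esub>v\<in>V. f (co v)) = (\<Oplus>\<^bsub>M\<^esub>v\<in>V. f v)"
proof -
  interpret M: vspace M by fact
  show ?thesis using M.M.finsum_reindex[of f co V] inj_co image_co assms by simp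
qed

lemma frobenius_coalgebra_A: "frobenius_coalgebra A \<Delta> (X vtop)"
  unfolding frobenius_coalgebra_def
proof (intro conjI equalityI subsetI)
  show "X vtop \<in> carrier A" by (rule X_closed)
  show "y \<in> carrier A" if y: "y \<in> {sweedler A (\<Delta> (X vtop)) (\<lambda>x y. f x \<odot>\<^bsub>A\<^esub> y) |f. k_linear A ground f}" for y
    using y k_linearD(1)[OF k_linear_sweedler_Delta[OF vspace_A k_bilinear_functional(1)] X_closed] by blast
  fix y assume y: "y \<in> carrier A"
  \<comment> \<open>Chosen to satisfy \<open>g v (co v) * f (X v) = X_dual (co v) y\<close>, so that
    the summand of \<open>v\<close> produces the component of \<open>y\<close> at
    \<open>co v\<close>.\<close>
  define f where "f = linear_extension n q a ground (\<lambda>v. X_dual (co v) y / g v (co v))"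
  have f: "k_linear A ground f"
    unfolding f_def by (rule k_linear_linear_extension[OF vspace_ground]) simp
  have fX: "f (X v) = X_dual (co v) y / g v (co v)" if "v \<in> V" for v
    unfolding f_def using that by (subst linear_extension_X[OF vspace_ground]) simp_all
  have "sweedler A (\<Delta> (X vtop)) (\<lambda>x y. f x \<odot>\<^bsub>A\<^esub> y) = (\<Oplus>\<^bsub>A\<^esub>u\<in>V. X_dual (co u) y \<odot>\<^bsub>A\<^esub> X (co u))"
    unfolding sweedler_Delta_top[OF vspace_A k_bilinear_functional(1)[OF f]]
    by (rule A.M.finsum_cong')
      (auto simp: fX X_closed A.smultD g_nz simp flip: A.smultD(4))
  also have "\<dots> = (\<Oplus>\<^bsub>A\<^esub>u\<in>V. X_dual u y \<odot>\<^bsub>A\<^esub> X u)"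
    by (rule finsum_co[OF vspace_A]) (auto simp: X_closed A.smultD)
  also have "\<dots> = y" by (rule X_expansion[OF y, symmetric])
  finally show "y \<in> {sweedler A (\<Delta> (X vtop)) (\<lambda>x y. f x \<odot>\<^bsub>A\<^esub> y) |f. k_linear A ground f}"
    using f by blast
qed

text \<open>Exponents add to zero only if both are zero. So a product of monomials with a
  nonconstant factor is zero or a multiple of a nonconstant monomial, and the counit vanishes on
  it.\<close>

lemma eps_ring_hom: "\<epsilon> \<in> ring_hom A ground"
proof (rule ring_hom_memI)
  fix x y assume x: "x \<in> carrier A" and y: "y \<in> carrier A"
  show "\<epsilon> x \<in> carrier ground" by simp
  show "\<epsilon> (x \<oplus>\<^bsub>A\<^esub> y) = \<epsilon> x \<oplus>\<^bsub>ground\<^esub> \<epsilon> y" by (rule k_linearD(2)[OF k_linear_eps x y])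
  have XX: "\<epsilon> (X u \<otimes>\<^bsub>A\<^esub> X v) = \<epsilon> (X u) * \<epsilon> (X v)" if u: "u \<in> V" and v: "v \<in> V" for u v
  proof (cases "u = vzero \<or> v = vzero")
    case True
    interpret A: ring A by (rule ring_A)
    from True show ?thesis by (auto simp: X_zero_exponent eps_one X_closed)
  next
    case False
    let ?w = "\<lambda>i\<in>{1..n}. u i + v i"
    have "?w \<noteq> vzero"
    proof
      assume w: "?w = vzero"
      have "u i = vzero i" if "i \<in> {1..n}" for i
        using fun_cong[OF w, of i] that by (simp add: zero_exponent_def)
      then show False using False exponent_eqI[OF u z_mem] by blast
    qed
    then show ?thesis
    proof (cases "?w \<in> V")
      case True
      then show ?thesis using False u v \<open>?w \<noteq> vzero\<close>
        unfolding X_mult functional_smult[OF k_linear_eps X_closed] by (simp add: eps_X)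
    next
      case w: False
      then show ?thesis using False u v
        by (simp add: X_mult_eq_zero functional_zero[OF k_linear_eps] eps_X)
    qed
  qed
  have "\<epsilon> (X u \<otimes>\<^bsub>A\<^esub> y) = \<epsilon> (X u) * \<epsilon> y" if u: "u \<in> V" for u
  proof (rule k_linear_eqI[OF vspace_ground k_linear_comp[OF k_linear_mult_left[OF X_closed] k_linear_eps] _ _ y])
    show "k_linear A ground (\<lambda>y. \<epsilon> (X u) * \<epsilon> y)"
      using k_linear_comp[OF k_linear_eps k_linear_smult_const[OF vspace_ground, of "\<epsilon> (X u)"]] by simp
  qed (rule XX[OF u])
  then show "\<epsilon> (x \<otimes>\<^bsub>A\<^esub> y) = \<epsilon> x \<otimes>\<^bsub>ground\<^esub> \<epsilon> y"
    using k_linear_eqI[OF vspace_ground k_linear_comp[OF k_linear_mult_right[OF y] k_linear_eps]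
        k_linear_functional_smult[OF vspace_ground k_linear_eps, of "\<epsilon> y"] _ x] by simp
qed (simp add: eps_one)

section \<open>The antipode as a diagonal map\<close>

abbreviation "S \<equiv> antipode_g n q a g"

text \<open>The family \<open>s\<close> collects the eigenvalues of the antipode on monomials.
  Condition \<open>s_add\<close> is anti-multiplicativity on a product of two monomials. Condition
  \<open>s_co\<close> is the coalgebra condition at the top monomial, obtained by comparing the
  coefficients of \<open>X u \<otimes> X (co u)\<close>.\<close>

context
  fixes s :: "(nat \<Rightarrow> nat) \<Rightarrow> 'k"
  assumes s: "\<And>v. v \<in> V \<Longrightarrow> s v = g (co v) v * B (co v) v"
    and s_add: "\<And>u v. u \<in> V \<Longrightarrow> v \<in> V \<Longrightarrow> (\<lambda>i\<in>{1..n}. u i + v i) \<in> V \<Longrightarrow>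
      B u v * s (\<lambda>i\<in>{1..n}. u i + v i) = s u * s v * B v u"
    and s_co: "\<And>u. u \<in> V \<Longrightarrow> g u (co u) = g (co u) u * (s u * s (co u))"
begin

lemma B_vzero: "B v vzero = 1" "B vzero v = 1"
proof -
  have "B v vzero = B v (\<lambda>i. 0)" "B vzero v = B (\<lambda>i. 0) v"
    by (rule B_cong; simp add: zero_exponent_def)+
  then show "B v vzero = 1" "B vzero v = 1" by simp_all
qed

lemma s_z: "s vzero = 1" and s_top: "s vtop = 1"
  using s[OF z_mem] s[OF top_mem] by (simp_all add: co_z co_top g_z g_top B_vzero)

text \<open>The values prescribed separately at 1 and at the top monomial agree with the general
  formula, since admissibility makes \<open>s\<close> equal to 1 there.\<close>

lemma k_linear_S: "k_linear A A S" and S_X: "v \<in> V \<Longrightarrow> S (X v) = s v \<odot>\<^bsub>A\<^esub> X v"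
proof -
  let ?f = "\<lambda>v. if v = vzero then \<one>\<^bsub>A\<^esub> else if v = vtop then X vtop
     else (g (co v) v * B (co v) v) \<odot>\<^bsub>A\<^esub> X v"
  have eq: "S = linear_extension n q a A ?f"
    unfolding antipode_g_def Let_def ..
  have cl: "?f v \<in> carrier A" for v
    using X_closed one_closed by (auto simp: A.smultD)
  show "k_linear A A S" unfolding eq by (rule k_linear_linear_extension[OF vspace_A cl])
  assume v: "v \<in> V"
  have S: "S (X v) = ?f v" unfolding eq by (rule linear_extension_X[OF vspace_A cl v])
  consider "v = vzero" | "v = vtop" "v \<noteq> vzero" | "v \<noteq> vzero" "v \<noteq> vtop" by blast
  then show "S (X v) = s v \<odot>\<^bsub>A\<^esub> X v"
  proof cases
    case 1
    then show ?thesis unfolding S by (simp add: s_z X_zero_exponent A.smultD(5) one_closed)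
  next
    case 2
    then show ?thesis unfolding S by (simp add: s_top A.smultD(5) X_closed)
  next
    case 3
    then show ?thesis unfolding S s[OF v] by simp
  qed
qed

lemma S_closed: "x \<in> carrier A \<Longrightarrow> S x \<in> carrier A"
  using k_linearD(1)[OF k_linear_S] .

lemma S_one: "S \<one>\<^bsub>A\<^esub> = \<one>\<^bsub>A\<^esub>"
  using S_X[OF z_mem] by (simp add: X_zero_exponent s_z A.smultD one_closed)

text \<open>In the comultiplication of the top monomial only the summand \<open>u = co w\<close>
  pairs nontrivially with \<open>X w\<close>; its weight \<open>g (co w) w * B (co w) w\<close>
  explains the coefficients in the definition of the antipode.\<close>

lemma S_formula:
  assumes y: "y \<in> carrier A"
  shows "S y = sweedler A (\<Delta> (X vtop)) (\<lambda>u v. X_dual vtop (u \<otimes>\<^bsub>A\<^esub> y) \<odot>\<^bsub>A\<^esub> v)"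
proof (rule k_linear_eqI[OF vspace_A k_linear_S _ _ y])
  have lin: "k_linear A ground (\<lambda>u. X_dual vtop (u \<otimes>\<^bsub>A\<^esub> y))" if "y \<in> carrier A" for y
    by (rule k_linear_comp[OF k_linear_mult_right[OF that] k_linear_X_dual[OF top_mem]])
  show "k_linear A A (\<lambda>y. sweedler A (\<Delta> (X vtop)) (\<lambda>u v. X_dual vtop (u \<otimes>\<^bsub>A\<^esub> y) \<odot>\<^bsub>A\<^esub> v))"
  proof (rule k_linear_sweedler_parameter[OF vspace_A vspace_A vspace_A vspace_A _ _ Delta_closed[OF X_closed]])
    show "y \<in> carrier A \<Longrightarrow> k_bilinear A A A (\<lambda>u v. X_dual vtop (u \<otimes>\<^bsub>A\<^esub> y) \<odot>\<^bsub>A\<^esub> v)" for y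
      by (rule k_bilinear_functional(1)[OF lin])
    show "u \<in> carrier A \<Longrightarrow> v \<in> carrier A \<Longrightarrow> k_linear A A (\<lambda>y. X_dual vtop (u \<otimes>\<^bsub>A\<^esub> y) \<odot>\<^bsub>A\<^esub> v)" for u v
      by (rule k_linear_functional_smult[OF vspace_A k_linear_comp[OF k_linear_mult_left k_linear_X_dual[OF top_mem]]])
  qed
  fix w assume w: "w \<in> V"
  have "sweedler A (\<Delta> (X vtop)) (\<lambda>u v. X_dual vtop (u \<otimes>\<^bsub>A\<^esub> X w) \<odot>\<^bsub>A\<^esub> v) = s w \<odot>\<^bsub>A\<^esub> X (co (co w))"
    unfolding sweedler_Delta_top[OF vspace_A k_bilinear_functional(1)[OF lin[OF X_closed]]]
  proof (rule finsum_delta_weighted[OF vspace_A, of "\<lambda>u. X (co u)"])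
    show "(\<lambda>u. X (co u)) \<in> V \<rightarrow> carrier A" by (simp add: X_closed)
    show "co w \<in> V" by (rule co_mem)
    fix u assume u: "u \<in> V"
    show "g u (co u) \<odot>\<^bsub>A\<^esub> (X_dual vtop (X u \<otimes>\<^bsub>A\<^esub> X w) \<odot>\<^bsub>A\<^esub> X (co u)) =
        (if u = co w then s w else 0) \<odot>\<^bsub>A\<^esub> X (co u)"
    proof (cases "u = co w")
      case True
      then show ?thesis using w u
        by (simp add: X_dual_top_mult co_co s X_closed flip: A.smultD(4))
    next
      case False
      then have "w \<noteq> co u" using co_co[OF u] by auto
      then show ?thesis using False w u by (simp add: X_dual_top_mult X_closed A.smultD)
    qed
  qed
  then show "S (X w) = sweedler A (\<Delta> (X vtop)) (\<lambda>u v. X_dual vtop (u \<otimes>\<^bsub>A\<^esub> X w) \<odot>\<^bsub>A\<^esub> v)"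
    using w by (simp add: S_X co_co)
qed

text \<open>Both sides are bilinear, so pairs of monomials suffice. If the sum of the exponents
  leaves the basis range, both products vanish; otherwise the claim is \<open>s_add\<close>.\<close>

lemma S_mult:
  assumes x: "x \<in> carrier A" and y: "y \<in> carrier A"
  shows "S (x \<otimes>\<^bsub>A\<^esub> y) = S y \<otimes>\<^bsub>A\<^esub> S x"
proof -
  have XX: "S (X u \<otimes>\<^bsub>A\<^esub> X v) = S (X v) \<otimes>\<^bsub>A\<^esub> S (X u)" if u: "u \<in> V" and v: "v \<in> V" for u v
  proof -
    let ?w = "\<lambda>i\<in>{1..n}. u i + v i"
    have w: "(\<lambda>i\<in>{1..n}. v i + u i) = ?w" by (simp add: add.commute)
    have SS: "S (X v) \<otimes>\<^bsub>A\<^esub> S (X u) = (s u * s v) \<odot>\<^bsub>A\<^esub> (X v \<otimes>\<^bsub>A\<^esub> X u)"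
      using u v
      by (simp add: S_X k_linearD(3)[OF k_linear_mult_left] k_linearD(3)[OF k_linear_mult_right] X_closed
          A.smultD(1) mult_closed flip: A.smultD(4))
    also have "\<dots> = (s u * s v * B v u) \<odot>\<^bsub>A\<^esub> X ?w"
      unfolding X_mult w by (simp only: A.smultD(4)[OF X_closed])
    finally have 1: "S (X v) \<otimes>\<^bsub>A\<^esub> S (X u) = \<dots>" .
    show ?thesis
    proof (cases "?w \<in> V")
      case True
      have "S (X u \<otimes>\<^bsub>A\<^esub> X v) = (B u v * s ?w) \<odot>\<^bsub>A\<^esub> X ?w"
        unfolding X_mult k_linearD(3)[OF k_linear_S X_closed] S_X[OF True]
        by (simp only: A.smultD(4)[OF X_closed])
      then show ?thesis unfolding 1 s_add[OF u v True] .
    next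
      case False
      have "S (X v) \<otimes>\<^bsub>A\<^esub> S (X u) = \<zero>\<^bsub>A\<^esub>"
        unfolding SS using X_mult_eq_zero[of v u] False by (simp add: w A.smultD(7))
      then show ?thesis
        by (simp add: X_mult_eq_zero[OF False] k_linear_zero[OF vspace_A vspace_A k_linear_S])
    qed
  qed
  have "S (X u \<otimes>\<^bsub>A\<^esub> y) = S y \<otimes>\<^bsub>A\<^esub> S (X u)" if u: "u \<in> V" for u
    by (rule k_linear_eqI[OF vspace_A k_linear_comp[OF k_linear_mult_left[OF X_closed] k_linear_S]
          k_linear_comp[OF k_linear_S k_linear_mult_right[OF S_closed[OF X_closed]]] XX[OF u] y])
  then show ?thesis
    by (rule k_linear_eqI[OF vspace_A k_linear_comp[OF k_linear_mult_right[OF y] k_linear_S]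
          k_linear_comp[OF k_linear_S k_linear_mult_left[OF S_closed[OF y]]] _ x])
qed

lemma eps_S:
  assumes "x \<in> carrier A"
  shows "\<epsilon> (S x) = \<epsilon> x"
  by (rule k_linear_eqI[OF vspace_ground k_linear_comp[OF k_linear_S k_linear_eps] k_linear_eps _ assms])
    (simp add: S_X functional_smult[OF k_linear_eps X_closed] eps_X s_z)

text \<open>For intermediate monomials the comultiplication is symmetric, so the flip of factors has
  no effect. For the top monomial the flip is undone by reindexing the sum along \<open>co\<close>,
  and \<open>s_co\<close> matches the coefficients.\<close>

lemma Delta_S:
  assumes "x \<in> carrier A"
  shows "\<Delta> (S x) = sweedler AA (\<Delta> x) (\<lambda>u v. pt (S v) (S u))"
proof -
  let ?\<beta> = "\<lambda>u v. pt (S v) (S u)"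
  note pt = pure_tensor_linear[OF vspace_A vspace_A]
  have \<beta>: "k_bilinear A A AA ?\<beta>"
    by (rule k_bilinearI) (auto intro: k_linear_comp[OF k_linear_S pt(1)] k_linear_comp[OF k_linear_S pt(2)] S_closed)
  note pt_smult = k_linearD(3)[OF pt(1)] k_linearD(3)[OF pt(2)]
  show ?thesis
  proof (rule k_linear_eqI[OF vspace_AA k_linear_comp[OF k_linear_S k_linear_Delta]
        k_linear_sweedler_Delta[OF vspace_AA \<beta>] _ assms])
    fix v assume v: "v \<in> V"
    consider "v = vzero" | "v = vtop" | "v \<noteq> vzero" "v \<noteq> vtop" by blast
    then show "\<Delta> (S (X v)) = sweedler AA (\<Delta> (X v)) ?\<beta>"
    proof cases
      case 1
      then show ?thesis
        by (simp add: X_zero_exponent S_one sweedler_Delta_one[OF vspace_AA \<beta>]) (rule Delta_one)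
    next
      case 2
      let ?h = "\<lambda>u. g u (co u) \<odot>\<^bsub>AA\<^esub> pt (X u) (X (co u))"
      have "sweedler AA (\<Delta> (X vtop)) ?\<beta> = (\<Oplus>\<^bsub>AA\<^esub>u\<in>V. ?h (co u))"
        unfolding sweedler_Delta_top[OF vspace_AA \<beta>]
      proof (rule AA.M.finsum_cong')
        fix u assume u: "u \<in> V"
        have "g u (co u) \<odot>\<^bsub>AA\<^esub> pt (S (X (co u))) (S (X u)) =
            (g u (co u) * (s u * s (co u))) \<odot>\<^bsub>AA\<^esub> pt (X (co u)) (X u)"
          using u by (simp add: S_X co_mem pt_smult X_closed A.smultD AA.smultD pt_closed mult_ac flip: AA.smultD(4))
        also have "g u (co u) * (s u * s (co u)) = g (co u) (co (co u))"
          using s_co[OF co_mem[of u]] u by (simp add: co_co mult_ac)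
        finally show "g u (co u) \<odot>\<^bsub>AA\<^esub> pt (S (X (co u))) (S (X u)) = ?h (co u)"
          using u by (simp add: co_co)
      qed (auto simp: AA.smultD pt_closed X_closed)
      also have "\<dots> = (\<Oplus>\<^bsub>AA\<^esub>u\<in>V. ?h u)"
        by (rule finsum_co[OF vspace_AA]) (auto simp: AA.smultD pt_closed X_closed)
      finally show ?thesis
        using 2 z_neq_top by (simp add: S_X top_mem s_top A.smultD X_closed Delta_X)
    next
      case 3
      then show ?thesis using v
        unfolding sweedler_Delta_mid[OF vspace_AA \<beta> v 3]
        by (simp add: S_one S_X k_linearD(3)[OF k_linear_Delta] X_closed
          Delta_X pt_smult one_closed AA.smultD pt_closed AA.M.a_ac)
    qed
  qed
qed

lemma bi_frobenius_A: "bi_frobenius A \<Delta> \<epsilon> (X_dual vtop) (X vtop) S"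
  unfolding bi_frobenius_def
  by (intro conjI ballI k_algebra_A finite_dimensional_A k_coalgebra_A eps_ring_hom Delta_one
      frobenius_algebra_A frobenius_coalgebra_A S_formula k_linear_S S_one S_mult eps_S Delta_S)

end

end

section \<open>Necessity\<close>

context quantum_ci_family begin

text \<open>For \<open>v\<close> below the top, \<open>1 \<otimes> X v\<close> contributes
  \<open>f 1\<close> at \<open>u = v\<close>, and \<open>X v \<otimes> 1\<close> contributes
  \<open>f (X v)\<close> at the constant monomial. The guard \<open>v \<noteq> vzero\<close>
  prevents counting \<open>1 \<otimes> 1\<close> twice.\<close>

lemma X_dual_coaction_X:
  assumes f: "k_linear A ground f" and u: "u \<in> V" and v: "v \<in> V"
  shows "X_dual u (sweedler A (\<Delta> (X v)) (\<lambda>x y. f x \<odot>\<^bsub>A\<^esub> y)) =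
    (if v = vtop then g (co u) u * f (X (co u))
     else (if u = v then f \<one>\<^bsub>A\<^esub> else 0) + (if u = vzero \<and> v \<noteq> vzero then f (X v) else 0))"
proof -
  note \<beta> = k_bilinear_functional(1)[OF f]
  note lin = k_linear_X_dual[OF u]
  have one: "X_dual u \<one>\<^bsub>A\<^esub> = (if u = vzero then 1 else 0)"
    using X_dual_X[OF z_mem u] by (auto simp: X_zero_exponent)
  consider "v = vzero" | "v = vtop" | "v \<noteq> vzero" "v \<noteq> vtop" by blast
  then show ?thesis
  proof cases
    case 1
    then show ?thesis using z_neq_top
      by (simp add: X_zero_exponent sweedler_Delta_one[OF vspace_A \<beta>] functional_smult[OF lin one_closed] one)
  next
    case 2
    have l: "k_linear A ground (\<lambda>x. X_dual u x)" by (rule lin)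
    have "X_dual u (sweedler A (\<Delta> (X vtop)) (\<lambda>x y. f x \<odot>\<^bsub>A\<^esub> y)) =
        (\<Sum>w\<in>V. g w (co w) * (f (X w) * X_dual u (X (co w))))"
      unfolding sweedler_Delta_top[OF vspace_A \<beta>]
      by (subst k_linear_finsum[OF vspace_A vspace_ground l])
        (auto simp: ground_finsum A.smultD(1) X_closed functional_smult[OF l])
    also have "\<dots> = (\<Sum>w\<in>V. if w = co u then g (co u) u * f (X (co u)) else 0)"
    proof (rule sum.cong[OF refl])
      fix w assume w: "w \<in> V"
      show "g w (co w) * (f (X w) * X_dual u (X (co w))) = (if w = co u then g (co u) u * f (X (co u)) else 0)"
        using co_eq_iff[OF w u] by (simp add: X_dual_X co_mem u co_co)
    qed
    also have "\<dots> = g (co u) u * f (X (co u))" using finite_exponents co_mem by simp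
    finally show ?thesis using 2 by simp
  next
    case 3
    then show ?thesis
      unfolding sweedler_Delta_mid[OF vspace_A \<beta> v 3]
      using v by (simp add: k_linearD(2)[OF lin] A.smultD(1) X_closed one_closed functional_smult[OF lin] one X_dual_X u)
  qed
qed

lemma X_dual_coaction:
  assumes f: "k_linear A ground f" and u: "u \<in> V" and t: "t \<in> carrier A"
  shows "X_dual u (sweedler A (\<Delta> t) (\<lambda>x y. f x \<odot>\<^bsub>A\<^esub> y)) = (\<Sum>v\<in>V. X_dual v t *
    (if v = vtop then g (co u) u * f (X (co u))
     else (if u = v then f \<one>\<^bsub>A\<^esub> else 0) + (if u = vzero \<and> v \<noteq> vzero then f (X v) else 0)))"
proof -
  have "k_linear A ground (\<lambda>t. X_dual u (sweedler A (\<Delta> t) (\<lambda>x y. f x \<odot>\<^bsub>A\<^esub> y)))"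
    by (rule k_linear_comp[OF k_linear_sweedler_Delta[OF vspace_A k_bilinear_functional(1)[OF f]] k_linear_X_dual[OF u]])
  from functional_expansion[OF this t] show ?thesis
    by (simp only: X_dual_coaction_X[OF f u] cong: sum.cong)
qed

text \<open>Products of two functionals serve to read off coefficients of tensors through Sweedler
  sums, in place of a basis of the tensor square.\<close>

lemma k_bilinear_ground_mult:
  assumes "k_linear A ground f" "k_linear A ground h"
  shows "k_bilinear A A ground (\<lambda>x y. f x * h y)"
proof (rule k_bilinearI)
  fix x
  show "k_linear A ground (\<lambda>y. f x * h y)"
    using k_linear_comp[OF assms(2) k_linear_smult_const[OF vspace_ground, of "f x"]] by simp
next
  fix y
  show "k_linear A ground (\<lambda>x. f x * h y)"
    using k_linear_functional_smult[OF vspace_ground assms(1), of "h y"] by simp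
qed

text \<open>The given \<phi> and \<open>t\<close> are arbitrary. From \<open>t\<close> only its top
  coefficient \<open>c\<close> is extracted, and from \<phi> its value \<open>p\<close> on the top
  monomial; both turn out to be nonzero, and together with \<open>g\<close> they determine how the
  antipode scales intermediate monomials.\<close>

lemma q_square_eq_one:
  assumes bf: "bi_frobenius A \<Delta> \<epsilon> \<phi> t S'" and ij: "i \<in> {1..n}" "j \<in> {1..n}"
  shows "(q i j)\<^sup>2 = 1"
proof -
  interpret A: ring A by (rule ring_A)
  have \<phi>: "k_linear A ground \<phi>" and t: "t \<in> carrier A"
    and surj: "carrier A = {sweedler A (\<Delta> t) (\<lambda>x y. f x \<odot>\<^bsub>A\<^esub> y) |f. k_linear A ground f}"
    and S: "k_linear A A S'" and S_one: "S' \<one>\<^bsub>A\<^esub> = \<one>\<^bsub>A\<^esub>"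
    using bf by (auto simp: bi_frobenius_def frobenius_algebra_def frobenius_coalgebra_def)
  have S_formula: "S' y = sweedler A (\<Delta> t) (\<lambda>u v. \<phi> (u \<otimes>\<^bsub>A\<^esub> y) \<odot>\<^bsub>A\<^esub> v)"
    and eps_S: "\<epsilon> (S' y) = \<epsilon> y"
    and Delta_S: "\<Delta> (S' y) = sweedler AA (\<Delta> y) (\<lambda>u v. pt (S' v) (S' u))" if "y \<in> carrier A" for y
    using bf that by (auto simp: bi_frobenius_def)
  have S_mult: "S' (x \<otimes>\<^bsub>A\<^esub> y) = S' y \<otimes>\<^bsub>A\<^esub> S' x" if "x \<in> carrier A" "y \<in> carrier A" for x y
    using bf that by (auto simp: bi_frobenius_def)
  have S_closed: "S' x \<in> carrier A" if "x \<in> carrier A" for x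
    using k_linearD(1)[OF S that] .
  define c where "c = X_dual vtop t"
  have top_coeff: "X_dual vtop (sweedler A (\<Delta> t) (\<lambda>x y. f x \<odot>\<^bsub>A\<^esub> y)) = c * f \<one>\<^bsub>A\<^esub>"
    if f: "k_linear A ground f" for f
  proof -
    have "X_dual vtop (sweedler A (\<Delta> t) (\<lambda>x y. f x \<odot>\<^bsub>A\<^esub> y)) =
        (\<Sum>v\<in>V. if v = vtop then X_dual vtop t * f \<one>\<^bsub>A\<^esub> else 0)"
      unfolding X_dual_coaction[OF f top_mem t] using z_neq_top
      by (intro sum.cong) (auto simp: co_top g_z X_zero_exponent)
    then show ?thesis using finite_exponents top_mem by (simp add: c_def)
  qed
  have one_dual: "X_dual u \<one>\<^bsub>A\<^esub> = (if u = vzero then 1 else 0)" if "u \<in> V" for u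
    using X_dual_X[OF z_mem that] by (auto simp: X_zero_exponent)
  \<comment> \<open>The top monomial itself has to be of the form obtained from \<open>t\<close> by
    some functional, and its top coefficient is 1.\<close>
  have c: "c \<noteq> 0"
  proof -
    obtain f where f: "k_linear A ground f" "X vtop = sweedler A (\<Delta> t) (\<lambda>x y. f x \<odot>\<^bsub>A\<^esub> y)"
      using surj X_closed[of vtop] by blast
    then have "1 = c * f \<one>\<^bsub>A\<^esub>" using top_coeff[OF f(1)] X_dual_X[OF top_mem top_mem] by simp
    then show ?thesis by auto
  qed
  have \<phi>_mult: "k_linear A ground (\<lambda>x. \<phi> (x \<otimes>\<^bsub>A\<^esub> y))" if "y \<in> carrier A" for y
    by (rule k_linear_comp[OF k_linear_mult_right[OF that] \<phi>])
  have S_top: "X_dual vtop (S' y) = c * \<phi> y" if y: "y \<in> carrier A" for y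
    unfolding S_formula[OF y] top_coeff[OF \<phi>_mult[OF y]] using y by simp
  \<comment> \<open>The antipode fixes 1, which has no top coefficient.\<close>
  have \<phi>_one: "\<phi> \<one>\<^bsub>A\<^esub> = 0"
    using S_top[OF one_closed] c z_neq_top by (simp add: S_one one_dual top_mem)
  have \<phi>_mid: "\<phi> (X w) = 0" if w: "w \<in> V" "w \<noteq> vzero" "w \<noteq> vtop" for w
  proof -
    \<comment> \<open>The antipode maps primitive elements to primitive elements, and those have no top coefficient.\<close>
    obtain e where e: "e \<in> V" "e \<noteq> vzero" "e \<noteq> vtop"
      using unit_exponent[OF one_in_range(1)] by blast
    \<comment> \<open>Reads off the coefficient of \<open>X e \<otimes> X (co e)\<close>. Among
      comultiplications of monomials only that of the top one has it nonzero, and it vanishes on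
      \<open>x \<otimes> 1\<close> and \<open>1 \<otimes> x\<close> because both exponents are
      nonzero.\<close>
    let ?\<beta> = "\<lambda>x y. X_dual e x * X_dual (co e) y"
    have \<beta>: "k_bilinear A A ground ?\<beta>"
      by (rule k_bilinear_ground_mult) (intro k_linear_X_dual e co_mem)+
    have e_one: "X_dual e \<one>\<^bsub>A\<^esub> = 0" "X_dual (co e) \<one>\<^bsub>A\<^esub> = 0"
      using e by (simp_all add: one_dual co_mem co_eq_z_iff)
    have G: "sweedler ground (\<Delta> (X v)) ?\<beta> = (if v = vtop then g e (co e) else 0)" if v: "v \<in> V" for v
    proof -
      consider "v = vzero" | "v = vtop" | "v \<noteq> vzero" "v \<noteq> vtop" by blast
      then show ?thesis
      proof cases
        case 1
        then show ?thesis using z_neq_top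
          by (simp add: X_zero_exponent sweedler_Delta_one[OF vspace_ground \<beta>] e_one)
      next
        case 2
        have "sweedler ground (\<Delta> (X vtop)) ?\<beta> = (\<Sum>u\<in>V. if u = e then g e (co e) else 0)"
          unfolding sweedler_Delta_top[OF vspace_ground \<beta>] ground_finsum
          by (rule sum.cong) (use e in \<open>auto simp: X_dual_X co_mem\<close>)
        then show ?thesis using 2 e finite_exponents by simp
      next
        case 3
        then show ?thesis
          unfolding sweedler_Delta_mid[OF vspace_ground \<beta> v 3] by (simp add: e_one)
      qed
    qed
    have "sweedler ground (\<Delta> (S' (X w))) ?\<beta> = (\<Sum>v\<in>V. X_dual v (S' (X w)) * (if v = vtop then g e (co e) else 0))"
      unfolding functional_expansion[OF k_linear_sweedler_Delta[OF vspace_ground \<beta>] S_closed[OF X_closed]]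
      by (rule sum.cong) (simp_all add: G)
    also have "\<dots> = X_dual vtop (S' (X w)) * g e (co e)"
      using finite_exponents top_mem by (simp add: if_distrib cong: if_cong)
    finally have 1: "sweedler ground (\<Delta> (S' (X w))) ?\<beta> = c * \<phi> (X w) * g e (co e)"
      by (simp add: S_top X_closed)
    note pt = pure_tensor_linear[OF vspace_A vspace_A]
    have "k_bilinear A A AA (\<lambda>u v. pt (S' v) (S' u))"
      by (rule k_bilinearI) (auto intro: k_linear_comp[OF S pt(1)] k_linear_comp[OF S pt(2)] S_closed)
    then have "\<Delta> (S' (X w)) = pt (S' (X w)) \<one>\<^bsub>A\<^esub> \<oplus>\<^bsub>AA\<^esub> pt \<one>\<^bsub>A\<^esub> (S' (X w))"
      unfolding Delta_S[OF X_closed] by (subst sweedler_Delta_mid[OF vspace_AA _ w]) (simp_all add: S_one)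
    then have "sweedler ground (\<Delta> (S' (X w))) ?\<beta> = 0"
      by (simp add: k_linearD(2)[OF k_linear_sweedler[OF vspace_A vspace_A vspace_ground \<beta>]] pt_closed
          S_closed X_closed one_closed sweedler_pure_tensor[OF vspace_A vspace_A vspace_ground \<beta>] e_one)
    then show ?thesis using 1 c g_nz[OF e(1)] by simp
  qed
  define p where "p = \<phi> (X vtop)"
  have \<phi>_X: "\<phi> (X v) = (if v = vtop then p else 0)" if "v \<in> V" for v
    using that \<phi>_mid[of v] \<phi>_one by (cases "v = vzero") (auto simp: p_def X_zero_exponent z_neq_top)
  have \<phi>_XX: "\<phi> (X u \<otimes>\<^bsub>A\<^esub> X v) = p * (if v = co u then B u v else 0)" if "u \<in> V" "v \<in> V" for u v
  proof -
    have l: "k_linear A ground (\<lambda>x. p * X_dual vtop x)"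
      using k_linear_comp[OF k_linear_X_dual[OF top_mem] k_linear_smult_const[OF vspace_ground, of p]] by simp
    have "\<phi> (X u \<otimes>\<^bsub>A\<^esub> X v) = p * X_dual vtop (X u \<otimes>\<^bsub>A\<^esub> X v)"
      by (rule k_linear_eqI[OF vspace_ground \<phi> l]) (auto simp: \<phi>_X X_dual_X top_mem X_closed mult_closed)
    then show ?thesis by (simp only: X_dual_top_mult[OF that])
  qed
  \<comment> \<open>The constant coefficient of the antipode of 1 equals 1. As \<phi> vanishes on
    all other monomials, only the top component of \<open>t\<close> contributes, giving
    \<open>c * p\<close>.\<close>
  have p: "p \<noteq> 0"
  proof -
    have "1 = X_dual vzero (S' \<one>\<^bsub>A\<^esub>)" by (simp add: S_one one_dual z_mem)
    also have "\<dots> = (\<Sum>v\<in>V. if v = vtop then c * p else 0)"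
      unfolding S_formula[OF one_closed] X_dual_coaction[OF \<phi>_mult[OF one_closed] z_mem t]
      by (rule sum.cong) (auto simp: \<phi>_one \<phi>_X X_closed one_closed co_z g_top c_def p_def)
    finally show ?thesis using finite_exponents top_mem by auto
  qed
  \<comment> \<open>The contribution of the top component of \<open>t\<close>, since \<phi> takes
    the value \<open>p * B (co w) w\<close> on the product of \<open>X (co w)\<close> and
    \<open>X w\<close>.\<close>
  define \<sigma> where "\<sigma> w = c * (g (co w) w * (p * B (co w) w))" for w
  have S_X: "S' (X w) = \<sigma> w \<odot>\<^bsub>A\<^esub> X w" if w: "w \<in> V" "w \<noteq> vzero" "w \<noteq> vtop" for w
  proof -
    have coeff: "X_dual u (S' (X w)) = (if u = w then \<sigma> w else 0)" if u: "u \<in> V" for u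
    proof (cases "u = vzero")
      case True
      \<comment> \<open>At the constant monomial the coaction formula also involves lower
        coefficients of \<open>t\<close>, which are unknown. Compatibility of the antipode with the
        counit gives this coefficient instead.\<close>
      have "\<epsilon> (S' (X w)) = X_dual vzero (S' (X w))"
        by (rule k_linear_eqI[OF vspace_ground k_linear_eps k_linear_X_dual[OF z_mem]])
          (auto simp: eps_X X_dual_X z_mem S_closed X_closed)
      then show ?thesis using True w eps_S[OF X_closed, of w] by (simp add: eps_X)
    next
      case False
      have "X_dual u (S' (X w)) = (\<Sum>v\<in>V. if v = vtop then c * (g (co u) u * \<phi> (X (co u) \<otimes>\<^bsub>A\<^esub> X w)) else 0)"
        unfolding S_formula[OF X_closed] X_dual_coaction[OF \<phi>_mult[OF X_closed] u t]
        by (rule sum.cong) (use False w in \<open>auto simp: \<phi>_X X_closed c_def\<close>)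
      also have "\<dots> = c * (g (co u) u * \<phi> (X (co u) \<otimes>\<^bsub>A\<^esub> X w))"
        using finite_exponents top_mem by simp
      also have "\<dots> = (if u = w then \<sigma> w else 0)"
        using w u by (auto simp: \<phi>_XX co_mem co_co \<sigma>_def)
      finally show ?thesis .
    qed
    have "S' (X w) = (\<Oplus>\<^bsub>A\<^esub>u\<in>V. X_dual u (S' (X w)) \<odot>\<^bsub>A\<^esub> X u)"
      by (rule X_expansion[OF S_closed[OF X_closed]])
    also have "\<dots> = \<sigma> w \<odot>\<^bsub>A\<^esub> X w"
      by (rule finsum_delta_weighted[OF vspace_A, of X]) (simp_all add: X_closed w coeff)
    finally show ?thesis .
  qed
  have \<sigma>: "\<sigma> w \<noteq> 0" if "w \<in> V" for w
    using c p B_nz g_nz[OF co_mem, of w] co_co[OF that] by (simp add: \<sigma>_def)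
  show ?thesis
  proof (cases "i = j")
    case True then show ?thesis using q_diag[OF ij(1)] by simp
  next
    case False
    define u v where "u = word_exponent [i]" and "v = word_exponent [j]"
    define w where "w = (\<lambda>l\<in>{1..n}. u l + v l)"
    have u: "u \<in> V" "u \<noteq> vzero" "u \<noteq> vtop" and v: "v \<in> V" "v \<noteq> vzero" "v \<noteq> vtop"
      unfolding u_def v_def using unit_exponent[OF ij(1)] unit_exponent[OF ij(2)] by auto
    have w: "w \<in> V"
    proof -
      have "u l + v l < a l" if l: "l \<in> {1..n}" for l
        using a_ge[OF l] False l by (simp add: u_def v_def)
      then show ?thesis by (simp add: w_def exponent_mem_iff)
    qed
    have w': "w = (\<lambda>l\<in>{1..n}. v l + u l)" unfolding w_def by (simp add: add.commute)
    have Buv: "B u v = (if j < i then - q i j else 1)"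
      unfolding B_units[OF ij, symmetric] u_def v_def by (rule B_cong) auto
    have Bvu: "B v u = (if i < j then - q j i else 1)"
      unfolding B_units[OF ij(2,1), symmetric] u_def v_def by (rule B_cong) auto
    \<comment> \<open>Only the coefficient at \<open>w\<close> is compared, and
      \<open>S' (X w)\<close> is not evaluated: for \<open>n = 2\<close> and both entries of
      \<open>a\<close> equal to 2, \<open>w\<close> is the top exponent, where \<open>S_X\<close>
      does not apply. Using both orders of the factors eliminates this coefficient.\<close>
    have anti: "B x y * X_dual w (S' (X w)) = \<sigma> x * \<sigma> y * B y x"
      if x: "x \<in> V" "x \<noteq> vzero" "x \<noteq> vtop" and y: "y \<in> V" "y \<noteq> vzero" "y \<noteq> vtop"
        and xy: "w = (\<lambda>l\<in>{1..n}. x l + y l)" "w = (\<lambda>l\<in>{1..n}. y l + x l)" for x y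
    proof -
      have "S' (X x \<otimes>\<^bsub>A\<^esub> X y) = S' (X y) \<otimes>\<^bsub>A\<^esub> S' (X x)" by (rule S_mult[OF X_closed X_closed])
      also have "\<dots> = (\<sigma> x * \<sigma> y) \<odot>\<^bsub>A\<^esub> (X y \<otimes>\<^bsub>A\<^esub> X x)"
        by (simp add: S_X[OF x] S_X[OF y] k_linearD(3)[OF k_linear_mult_left] k_linearD(3)[OF k_linear_mult_right]
            X_closed A.smultD(1) mult_closed flip: A.smultD(4))
      finally have "B x y \<odot>\<^bsub>A\<^esub> S' (X w) = (\<sigma> x * \<sigma> y) \<odot>\<^bsub>A\<^esub> (B y x \<odot>\<^bsub>A\<^esub> X w)"
        unfolding X_mult xy(1)[symmetric] xy(2)[symmetric] k_linearD(3)[OF S X_closed] .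
      then have "X_dual w (B x y \<odot>\<^bsub>A\<^esub> S' (X w)) = X_dual w ((\<sigma> x * \<sigma> y) \<odot>\<^bsub>A\<^esub> (B y x \<odot>\<^bsub>A\<^esub> X w))"
        by simp
      then show ?thesis
        by (simp add: functional_smult[OF k_linear_X_dual[OF w]] S_closed X_closed A.smultD(1) X_dual_X w)
    qed
    let ?d = "X_dual w (S' (X w))"
    have "B v u * (B u v * ?d) = B u v * (B v u * ?d)" by simp
    then have "\<sigma> u * \<sigma> v * (B v u)\<^sup>2 = \<sigma> u * \<sigma> v * (B u v)\<^sup>2"
      unfolding anti[OF u v w_def w'] anti[OF v u w' w_def] by (simp add: power2_eq_square mult_ac)
    then have "(B v u)\<^sup>2 = (B u v)\<^sup>2" using \<sigma>[OF u(1)] \<sigma>[OF v(1)] by simp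
    \<comment> \<open>Since \<open>i \<noteq> j\<close>, one of the two brackets is 1 and the other
      is the negative of an entry of \<open>q\<close>.\<close>
    then have "(q i j)\<^sup>2 = 1 \<or> (q j i)\<^sup>2 = 1"
      using False unfolding Buv Bvu by (auto split: if_splits)
    moreover have "(q i j)\<^sup>2 * (q j i)\<^sup>2 = 1"
      using q_inv[OF ij] by (simp flip: power_mult_distrib)
    ultimately show ?thesis by auto
  qed
qed

end

section \<open>Sufficiency\<close>

context quantum_ci begin

lemma B_scale_left: "B (\<lambda>i. m * u i) w = B u w ^ m"
proof (induction m)
  case (Suc m)
  have "B (\<lambda>i. Suc m * u i) w = B (\<lambda>i. u i + m * u i) w" by simp
  then show ?case unfolding B_add_left Suc by simp
qed simp

lemma B_scale_right: "B w (\<lambda>i. m * u i) = B w u ^ m"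
proof (induction m)
  case (Suc m)
  have "B w (\<lambda>i. Suc m * u i) = B w (\<lambda>i. u i + m * u i)" by simp
  then show ?case unfolding B_add_right Suc by simp
qed simp

lemma B_sum_left: "finite J \<Longrightarrow> B (\<lambda>i. \<Sum>j\<in>J. v j * unit j i) w = (\<Prod>j\<in>J. B (unit j) w ^ v j)"
  by (induction J rule: finite_induct) (simp_all add: B_add_left B_scale_left del: count_list.simps)

lemma B_sum_right: "finite J \<Longrightarrow> B w (\<lambda>i. \<Sum>j\<in>J. v j * unit j i) = (\<Prod>j\<in>J. B w (unit j) ^ v j)"
  by (induction J rule: finite_induct) (simp_all add: B_add_right B_scale_right del: count_list.simps)

lemma sum_units: "i \<in> {1..n} \<Longrightarrow> (\<Sum>j\<in>{1..n}. v j * unit j i) = v i"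
  by (simp add: if_distrib[of "(*) x" for x] cong: if_cong)

text \<open>A bicharacter is determined by its values on unit exponents. This turns products of
  powers of the commutation signs of the generators back into brackets with the top
  exponent.\<close>

lemma B_expand_left: "B v w = (\<Prod>j\<in>{1..n}. B (unit j) w ^ v j)"
  unfolding B_sum_left[OF finite_atLeastAtMost, symmetric] by (rule B_cong) (simp_all only: sum_units)

lemma B_expand_right: "B w v = (\<Prod>j\<in>{1..n}. B w (unit j) ^ v j)"
  unfolding B_sum_right[OF finite_atLeastAtMost, symmetric] by (rule B_cong) (simp_all only: sum_units)

context
  fixes \<iota> :: 'k
  assumes \<iota>: "\<iota>\<^sup>2 = - 1" and q_square: "\<And>i j. i \<in> {1..n} \<Longrightarrow> j \<in> {1..n} \<Longrightarrow> (q i j)\<^sup>2 = 1"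
begin

lemma power_square_swap: "(x ^ m)\<^sup>2 = (x\<^sup>2) ^ m" for x :: 'k
  by (metis mult.commute power_mult)

lemma B_square: "(B u v)\<^sup>2 = 1"
proof -
  have "((- 1 / q i j) ^ m)\<^sup>2 = 1" if "i \<in> {1..n}" "j \<in> {1..n}" for i j m
  proof -
    have "((- 1 / q i j) ^ m)\<^sup>2 = ((- 1 / q i j)\<^sup>2) ^ m" by (rule power_square_swap)
    then show ?thesis using q_square[OF that] by (simp add: power_divide)
  qed
  then show ?thesis
    unfolding q_bracket_def prod_power_distrib by (intro prod.neutral) auto
qed

lemma B_mult_self: "B u v * B u v = 1"
  using B_square by (simp add: power2_eq_square)

lemma exists_signs:
  "\<exists>\<sigma>. (\<forall>i\<in>{1..n}. (\<sigma> i)\<^sup>2 = B (unit i) vtop * B vtop (unit i)) \<and>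
     B vtop vtop * (\<Prod>i\<in>{1..n}. \<sigma> i ^ vtop i) = 1"
proof -
  let ?c = "\<lambda>i. B (unit i) vtop * B vtop (unit i)"
  define \<sigma> where "\<sigma> i = (if ?c i = 1 then 1 else \<iota>)" for i
  have c: "?c i = 1 \<or> ?c i = - 1" for i
  proof -
    have "(?c i)\<^sup>2 = 1" by (simp add: power_mult_distrib B_square)
    then show ?thesis by (simp add: power2_eq_1_iff)
  qed
  have \<sigma>: "(\<sigma> i)\<^sup>2 = ?c i" for i
    using c[of i] \<iota> by (auto simp: \<sigma>_def)
  \<comment> \<open>The value at the top exponent of the scaling function built from \<sigma>, which
    has to be normalised to 1.\<close>
  define e where "e = B vtop vtop * (\<Prod>i\<in>{1..n}. \<sigma> i ^ vtop i)"
  have "e\<^sup>2 = (\<Prod>i\<in>{1..n}. ?c i ^ vtop i)"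
    unfolding e_def power_mult_distrib B_square prod_power_distrib power_square_swap \<sigma> by simp
  also have "\<dots> = B vtop vtop * B vtop vtop"
    unfolding power_mult_distrib prod.distrib by (simp only: B_expand_left[symmetric] B_expand_right[symmetric])
  finally have "e\<^sup>2 = 1" by (simp add: B_mult_self)
  then consider "e = 1" | "e = - 1" by (auto simp: power2_eq_1_iff)
  then show ?thesis
  proof cases
    case 1
    then show ?thesis using \<sigma> by (intro exI[of _ \<sigma>]) (simp add: e_def)
  next
    case 2
    show ?thesis
    proof (cases "\<exists>l\<in>{1..n}. odd (vtop l)")
      case True
      then obtain l where l: "l \<in> {1..n}" "odd (vtop l)" by blast
      \<comment> \<open>All squares are kept, while the odd power at \<open>l\<close> changes the
        sign of the whole product.\<close>
      let ?\<sigma> = "\<sigma>(l := - \<sigma> l)"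
      have "(\<Prod>i\<in>{1..n}. ?\<sigma> i ^ vtop i) = (- \<sigma> l) ^ vtop l * (\<Prod>i\<in>{1..n} - {l}. \<sigma> i ^ vtop i)"
        using l by (subst prod.remove[of _ l]) auto
      also have "\<dots> = - (\<Prod>i\<in>{1..n}. \<sigma> i ^ vtop i)"
        using l by (subst (2) prod.remove[of _ l]) auto
      finally have "B vtop vtop * (\<Prod>i\<in>{1..n}. ?\<sigma> i ^ vtop i) = 1" using 2 by (simp add: e_def)
      then show ?thesis using \<sigma> by (intro exI[of _ ?\<sigma>]) simp
    next
      case False
      \<comment> \<open>If all \<open>a\<^sub>i - 1\<close> are even, then the top exponent is twice an exponent, and all brackets
        with it are squares of signs.\<close>
      define h where "h i = vtop i div 2" for i
      have h: "vtop i = 2 * h i" if "i \<in> {1..n}" for i using False that by (auto simp: h_def)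
      have B1: "B vtop w = 1" for w
      proof -
        have "B vtop w = B (\<lambda>i. 2 * h i) w" by (rule B_cong) (simp_all add: h)
        then show ?thesis by (simp add: B_scale_left B_square)
      qed
      have B2: "B w vtop = 1" for w
      proof -
        have "B w vtop = B w (\<lambda>i. 2 * h i)" by (rule B_cong) (simp_all add: h)
        then show ?thesis by (simp add: B_scale_right B_square)
      qed
      then show ?thesis using B1 by (intro exI[of _ "\<lambda>_. 1"]) simp
    qed
  qed
qed

lemma exists_bi_frobenius:
  "\<exists>g. admissible n a g \<and>
    bi_frobenius A (Delta_g n q a g) \<epsilon> (X_dual vtop) (X vtop) (antipode_g n q a g)"
proof -
  obtain \<sigma> where \<sigma>: "\<And>i. i \<in> {1..n} \<Longrightarrow> (\<sigma> i)\<^sup>2 = B (unit i) vtop * B vtop (unit i)"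
    and \<sigma>_top: "B vtop vtop * (\<Prod>i\<in>{1..n}. \<sigma> i ^ vtop i) = 1"
    using exists_signs by blast
  define s where "s v = B v v * (\<Prod>i\<in>{1..n}. \<sigma> i ^ v i)" for v
  \<comment> \<open>Solves \<open>s v = g (co v) v * B (co v) v\<close> for \<open>g\<close>;
    brackets are signs and hence their own inverses. Admissibility of \<open>g\<close> then amounts
    to \<open>s\<close> being nonzero and equal to 1 at the zero and top exponents.\<close>
  define g where "g u v = s v * B u v" for u v
  have s_top: "s vtop = 1" using \<sigma>_top by (simp add: s_def)
  have s_add: "s (\<lambda>i\<in>{1..n}. u i + v i) = s u * s v * (B u v * B v u)" for u v
  proof -
    have "B (\<lambda>i\<in>{1..n}. u i + v i) (\<lambda>i\<in>{1..n}. u i + v i) = B (\<lambda>i. u i + v i) (\<lambda>i. u i + v i)"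
      by (rule B_cong) auto
    moreover have "(\<Prod>i\<in>{1..n}. \<sigma> i ^ (\<lambda>i\<in>{1..n}. u i + v i) i) =
        (\<Prod>i\<in>{1..n}. \<sigma> i ^ u i) * (\<Prod>i\<in>{1..n}. \<sigma> i ^ v i)"
      unfolding prod.distrib[symmetric] by (rule prod.cong) (auto simp: power_add)
    ultimately show ?thesis
      unfolding s_def B_add_left B_add_right by (simp add: mult_ac)
  qed
  have s_square: "(s v)\<^sup>2 = B v vtop * B vtop v" for v
  proof -
    have "(s v)\<^sup>2 = (\<Prod>i\<in>{1..n}. (B (unit i) vtop * B vtop (unit i)) ^ v i)"
      unfolding s_def power_mult_distrib[of "B v v"] B_square prod_power_distrib power_square_swap
      by (simp add: \<sigma>)
    then show ?thesis
      unfolding power_mult_distrib prod.distrib by (simp only: B_expand_left[symmetric] B_expand_right[symmetric])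
  qed
  have s_nz: "s v \<noteq> 0" for v
    using s_square[of v] B_nz by auto
  have top_sum: "(\<lambda>i\<in>{1..n}. u i + co u i) = vtop" if "u \<in> V" for u
    using add_eq_top_iff[OF that co_mem] by simp
  \<comment> \<open>Replacing the top exponent by \<open>u + co u\<close> in \<open>s_square\<close>
    adds only the factor \<open>B u u\<close> twice, which is 1.\<close>
  have s_square': "s u * s u = B u (co u) * B (co u) u" if u: "u \<in> V" for u
  proof -
    have "B u vtop = B u (\<lambda>i. u i + co u i)" "B vtop u = B (\<lambda>i. u i + co u i) u"
      by (rule B_cong; simp flip: top_sum[OF u])+
    then have "s u * s u = (B u u * B u u) * (B u (co u) * B (co u) u)"
      using s_square[of u] by (simp add: B_add_left B_add_right power2_eq_square mult_ac)
    then show ?thesis by (simp add: B_mult_self)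
  qed
  \<comment> \<open>Additivity at \<open>u + co u\<close> and \<open>s vtop = 1\<close> give
    \<open>s u * s (co u) * ?\<chi> = 1\<close>, while \<open>s_square'\<close> gives
    \<open>s u * s u * ?\<chi> = 1\<close>; cancelling identifies the two values.\<close>
  have s_co: "s (co u) = s u" if u: "u \<in> V" for u
  proof -
    let ?\<chi> = "B u (co u) * B (co u) u"
    have "s u * s (co u) * ?\<chi> = 1"
      using s_add[of u "co u"] unfolding top_sum[OF u] s_top by simp
    moreover have "s u * s u * ?\<chi> = 1"
    proof -
      have "s u * s u * ?\<chi> = (B u (co u) * B u (co u)) * (B (co u) u * B (co u) u)"
        unfolding s_square'[OF u] by (simp only: mult_ac)
      then show ?thesis by (simp add: B_mult_self)
    qed
    ultimately have "s u * (s (co u) * ?\<chi>) = s u * (s u * ?\<chi>)" by (simp add: mult.assoc)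
    then show ?thesis using s_nz[of u] B_nz by simp
  qed
  have "s vzero = 1"
  proof -
    have "B vzero vzero = B (\<lambda>i. 0) (\<lambda>i. 0)" by (rule B_cong) (simp_all add: zero_exponent_def)
    then show ?thesis by (simp add: s_def zero_exponent_def)
  qed
  moreover have "B vtop vzero = B vtop (\<lambda>i. 0)" "B vzero vtop = B (\<lambda>i. 0) vtop"
    by (rule B_cong; simp add: zero_exponent_def)+
  ultimately have adm: "admissible n a g"
    by (simp add: admissible_def g_def s_nz B_nz s_top)
  interpret quantum_ci_family n a q g by unfold_locales (rule adm)
  have "bi_frobenius A \<Delta> \<epsilon> (X_dual vtop) (X vtop) S"
  proof (rule bi_frobenius_A[of s])
    show "s v = g (co v) v * B (co v) v" for v
      by (simp add: g_def mult.assoc B_mult_self)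
    show "B u v * s (\<lambda>i\<in>{1..n}. u i + v i) = s u * s v * B v u" for u v
    proof -
      have "B u v * s (\<lambda>i\<in>{1..n}. u i + v i) = (B u v * B u v) * (s u * s v * B v u)"
        unfolding s_add by (simp only: mult_ac)
      then show ?thesis by (simp add: B_mult_self)
    qed
    fix u assume u: "u \<in> V"
    \<comment> \<open>With \<open>s (co u) = s u\<close> the last two factors on the left form a
      square, which \<open>s_square'\<close> converts to brackets; the two copies of
      \<open>B (co u) u\<close> then cancel.\<close>
    have eq: "g (co u) u * (s u * s (co u)) = s u * (B (co u) u * B (co u) u) * B u (co u)"
      unfolding g_def s_co[OF u] s_square'[OF u] by (simp only: mult_ac)
    show "g u (co u) = g (co u) u * (s u * s (co u))"
      unfolding eq by (simp add: B_mult_self g_def s_co[OF u])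
  qed
  then show ?thesis using adm by blast
qed

end

end

theorem theorem3p2:
  fixes n :: nat
    and a :: "nat \<Rightarrow> nat"
    and q :: "nat \<Rightarrow> nat \<Rightarrow> 'k::field"
  assumes "n \<ge> 2"
    and "\<And>i. i \<in> {1..n} \<Longrightarrow> a i \<ge> 2"
    and "\<And>i. i \<in> {1..n} \<Longrightarrow> q i i = - 1"
    and "\<And>i j. i \<in> {1..n} \<Longrightarrow> j \<in> {1..n} \<Longrightarrow> q i j * q j i = 1"
  shows "((\<exists>g \<phi> t S. admissible n a g \<and>
             bi_frobenius (qci n q a) (Delta_g n q a g) (eps0 n q a) \<phi> t S)
           \<longrightarrow> (\<forall>i\<in>{1..n}. \<forall>j\<in>{1..n}. (q i j)\<^sup>2 = 1))
       \<and> ((\<exists>s::'k. s\<^sup>2 = - 1) \<and> (\<forall>i\<in>{1..n}. \<forall>j\<in>{1..n}. (q i j)\<^sup>2 = 1)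
           \<longrightarrow> (\<exists>g. admissible n a g \<and>
                  bi_frobenius (qci n q a) (Delta_g n q a g) (eps0 n q a)
                    (dual_monom n q a (top_exponent n a)) (qci_monom n q a (top_exponent n a))
                    (antipode_g n q a g)))"
proof -
  interpret quantum_ci n a q
    by unfold_locales (fact assms)+
  have "(q i j)\<^sup>2 = 1"
    if "admissible n a g" "bi_frobenius (qci n q a) (Delta_g n q a g) (eps0 n q a) \<phi> t S"
      "i \<in> {1..n}" "j \<in> {1..n}" for g \<phi> t S i j
  proof -
    interpret quantum_ci_family n a q g
      by unfold_locales (fact that(1))
    show ?thesis by (rule q_square_eq_one[OF that(2-4)])
  qed
  then show ?thesis using exists_bi_frobenius by blast
qed

end
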